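(* Let $Y=(Y_1,Y_2)\in\mathcal{L}^2(\Omega,\mathcal{F},\mathbb{P})$ and suppose $\nu=\operatorname{Law}(Y)$ is $\mathcal{D}$-regular. Let $G\in\mathfrak{M}$ be a maximizer of $\int\phi_G\,d\nu$ over $\mathfrak{M}$, and set $\phi=\phi_G$, $E=E^G$. Then the random variable $$X=Y\,1_{\{Y\in E\}}+D^c\phi(Y)\,1_{\{Y\notin E\}}$$ (well defined almost surely) is an optimal map, i.e. a minimizer of $\mathbb{E}[c(X,Y)]$ over $\mathcal{X}(Y)$; $\gamma=\operatorname{Law}(X,Y)$ is an optimal plan, i.e. a minimizer of $\int c\,d\gamma$ over $\Gamma(\nu)$; and the law of $X$ is $\mathcal{D}$-regular. Moreover, if $\widetilde X$ is any optimal map and $\widetilde\gamma$ any optimal plan, then $$X1_{\{Y\notin E\}}=\widetilde X1_{\{Y\notin E\}}\ \text{a.s.},\qquad 1_{\{y\notin E\}}\gamma(dx,dy)=1_{\{y\notin E\}}\widetilde\gamma(dx,dy).$$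
   Context: $c(x,y)=(x_1-y_1)(x_2-y_2)$ for $x,y\in\mathbb{R}^2$. $\Gamma(\nu)$: Borel probability measures $\gamma$ on $\mathbb{R}^2\times\mathbb{R}^2$ (points $(x,y)$) with finite second moment, $y$-marginal $\nu$ and $\gamma(y|x)=x$ (conditional expectation of $y$ given $x$ equals $x$, $\gamma$-a.s.). $\mathcal{X}(Y)$: two-dimensional $Y$-measurable $X\in\mathcal{L}^2$ with $\mathbb{E}[Y|X]=X$. A set $G\subset\mathbb{R}^2$ is monotone if $c(r,s)\ge0$ for $r,s\in G$; maximal monotone if not a proper subset of a monotone set; $\mathfrak{M}$ denotes the family of maximal monotone sets; $\phi_G(y)=\inf_{x\in G}c(x,y)\in[-\infty,0]$. $\mathcal{D}$ is the family of graphs of strictly decreasing functions $f$ on closed intervals of $\mathbb{R}$ (possibly a single point) with $\frac1K(t-s)\le f(s)-f(t)\le K(t-s)$ for $s<t$, for some $K>0$; a Borel probability measure $\mu$ on $\mathbb{R}^2$ is $\mathcal{D}$-regular if $\mu(D)=0$ for every $D\in\mathcal{D}$. For $i=1,2$ and $t\in\mathbb{R}$ let $E^G_i(t)=\{x\in G: x_i=t\}$, $\mathcal{T}^G_i=\{t: E^G_i(t)\text{ has more than one point}\}$, $E^G_i=\bigcup_{t\in\mathcal{T}^G_i}E^G_i(t)$, and $E^G=E^G_1\cup E^G_2$ (the union of vertical and horizontal segments of $G$). Let $\operatorname{dom}\phi=\{\phi>-\infty\}$. For $y$ in the interior of $\operatorname{dom}\phi$, $\nabla\phi(y)$ is the classical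 gradient when it exists; for $y$ in the relative boundary of $\operatorname{dom}\phi$, $\nabla\phi(y)$ exists if $\nabla\phi(y^n)$ converges to a common limit for every sequence $y^n\to y$ of interior points of $\operatorname{dom}\phi$ at which $\phi$ is differentiable. $\operatorname{dom}\nabla\phi$ is the set of $y\in\operatorname{dom}\phi$ where $\nabla\phi(y)$ exists and there $D^c\phi(y)=\big(y_1-\frac{\partial\phi}{\partial y_2}(y),\,y_2-\frac{\partial\phi}{\partial y_1}(y)\big)$. *)

theory Defs
  imports "HOL-Probability.Probability"
begin

type_synonym pt = "real \<times> real"

definition cost :: "pt \<Rightarrow> pt \<Rightarrow> real" where
  "cost x y = (fst x - fst y) * (snd x - snd y)"

definition monotone_set :: "pt set \<Rightarrow> bool" where
  "monotone_set G \<longleftrightarrow> (\<forall>r\<in>G. \<forall>s\<in>G. cost r s \<ge> 0)"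

definition maximal_monotone :: "pt set \<Rightarrow> bool" where
  "maximal_monotone G \<longleftrightarrow> monotone_set G \<and> \<not> (\<exists>H. G \<subset> H \<and> monotone_set H)"

definition MM :: "pt set set" where
  "MM = {G. maximal_monotone G}"

definition phiG :: "pt set \<Rightarrow> pt \<Rightarrow> ereal" where
  "phiG G y = (INF x\<in>G. ereal (cost x y))"

text \<open>Integral of the nonpositive extended-real function phi_G against nu.\<close>
definition phi_integral :: "pt measure \<Rightarrow> pt set \<Rightarrow> ereal" where
  "phi_integral \<nu> G = - enn2ereal (\<integral>\<^sup>+ y. e2ennreal (- phiG G y) \<partial>\<nu>)"

definition Dfam :: "pt set set" where
  "Dfam = {D. \<exists>(f::real \<Rightarrow> real) a b K. a \<le> b \<and> K > 0 \<and>
      (\<forall>s\<in>{a..b}. \<forall>t\<in>{a..b}. s < t \<longrightarrow>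
          (t - s) / K \<le> f s - f t \<and> f s - f t \<le> K * (t - s)) \<and>
      D = (\<lambda>t. (t, f t)) ` {a..b}}"

definition D_regular :: "pt measure \<Rightarrow> bool" where
  "D_regular \<mu> \<longleftrightarrow> (\<forall>D\<in>Dfam. emeasure \<mu> D = 0)"

definition coord :: "nat \<Rightarrow> pt \<Rightarrow> real" where
  "coord i x = (if i = 1 then fst x else snd x)"

definition E_at :: "pt set \<Rightarrow> nat \<Rightarrow> real \<Rightarrow> pt set" where
  "E_at G i t = {x\<in>G. coord i x = t}"

definition T_set :: "pt set \<Rightarrow> nat \<Rightarrow> real set" where
  "T_set G i = {t. \<exists>a b. a \<in> E_at G i t \<and> b \<in> E_at G i t \<and> a \<noteq> b}"

definition E_i :: "pt set \<Rightarrow> nat \<Rightarrow> pt set" where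
  "E_i G i = (\<Union>t\<in>T_set G i. E_at G i t)"

definition E_G :: "pt set \<Rightarrow> pt set" where
  "E_G G = E_i G 1 \<union> E_i G 2"

definition dom_phi :: "pt set \<Rightarrow> pt set" where
  "dom_phi G = {y. phiG G y > -\<infinity>}"

definition phi_real :: "pt set \<Rightarrow> pt \<Rightarrow> real" where
  "phi_real G y = real_of_ereal (phiG G y)"

definition diff_pts :: "pt set \<Rightarrow> pt set" where
  "diff_pts G = {z \<in> interior (dom_phi G). \<exists>w. GDERIV (phi_real G) z :> w}"

definition grad_at :: "pt set \<Rightarrow> pt \<Rightarrow> pt \<Rightarrow> bool" where
  "grad_at G y v \<longleftrightarrow>
     (y \<in> interior (dom_phi G) \<and> GDERIV (phi_real G) y :> v) \<or>
     (y \<in> dom_phi G \<and> y \<in> rel_frontier (dom_phi G) \<and> y \<in> closure (diff_pts G) \<and>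
      (\<forall>(s::nat \<Rightarrow> pt) (w::nat \<Rightarrow> pt).
          (\<forall>n. s n \<in> interior (dom_phi G) \<and> GDERIV (phi_real G) (s n) :> w n) \<longrightarrow>
          s \<longlonglongrightarrow> y \<longrightarrow> w \<longlonglongrightarrow> v))"

definition dom_grad :: "pt set \<Rightarrow> pt set" where
  "dom_grad G = {y \<in> dom_phi G. \<exists>v. grad_at G y v}"

definition grad_phi :: "pt set \<Rightarrow> pt \<Rightarrow> pt" where
  "grad_phi G y = (THE v. grad_at G y v)"

definition Dc_phi :: "pt set \<Rightarrow> pt \<Rightarrow> pt" where
  "Dc_phi G y = (fst y - snd (grad_phi G y), snd y - fst (grad_phi G y))"

definition L2 :: "'a measure \<Rightarrow> ('a \<Rightarrow> 'b::euclidean_space) \<Rightarrow> bool" where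
  "L2 M X \<longleftrightarrow> X \<in> borel_measurable M \<and> integrable M (\<lambda>\<omega>. (norm (X \<omega>))\<^sup>2)"

definition maps_X :: "'a measure \<Rightarrow> ('a \<Rightarrow> pt) \<Rightarrow> ('a \<Rightarrow> pt) set" where
  "maps_X M Y = {X. X \<in> measurable (vimage_algebra (space M) Y borel) borel \<and> L2 M X \<and>
     (AE \<omega> in M. real_cond_exp M (vimage_algebra (space M) X borel) (\<lambda>\<omega>. fst (Y \<omega>)) \<omega> = fst (X \<omega>)) \<and>
     (AE \<omega> in M. real_cond_exp M (vimage_algebra (space M) X borel) (\<lambda>\<omega>. snd (Y \<omega>)) \<omega> = snd (X \<omega>))}"

definition plans :: "pt measure \<Rightarrow> (pt \<times> pt) measure set" where
  "plans \<nu> = {\<gamma>. sets \<gamma> = sets borel \<and> prob_space \<gamma> \<and>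
     integrable \<gamma> (\<lambda>p. (norm p)\<^sup>2) \<and> distr \<gamma> borel snd = \<nu> \<and>
     (AE p in \<gamma>. real_cond_exp \<gamma> (vimage_algebra (space \<gamma>) fst borel) (\<lambda>p. fst (snd p)) p = fst (fst p)) \<and>
     (AE p in \<gamma>. real_cond_exp \<gamma> (vimage_algebra (space \<gamma>) fst borel) (\<lambda>p. snd (snd p)) p = snd (fst p))}"

definition optimal_map :: "'a measure \<Rightarrow> ('a \<Rightarrow> pt) \<Rightarrow> ('a \<Rightarrow> pt) \<Rightarrow> bool" where
  "optimal_map M Y X \<longleftrightarrow> X \<in> maps_X M Y \<and>
     (\<forall>X'\<in>maps_X M Y. (\<integral>\<omega>. cost (X \<omega>) (Y \<omega>) \<partial>M) \<le> (\<integral>\<omega>. cost (X' \<omega>) (Y \<omega>) \<partial>M))"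

definition optimal_plan :: "pt measure \<Rightarrow> (pt \<times> pt) measure \<Rightarrow> bool" where
  "optimal_plan \<nu> \<gamma> \<longleftrightarrow> \<gamma> \<in> plans \<nu> \<and>
     (\<forall>\<gamma>'\<in>plans \<nu>. (\<integral>p. cost (fst p) (snd p) \<partial>\<gamma>) \<le> (\<integral>p. cost (fst p) (snd p) \<partial>\<gamma>'))"

end

theory Submission
  imports Defs
begin

text \<open>A maximal monotone set is a curve \<open>u \<mapsto> (P u, Q u)\<close> with \<open>P\<close>, \<open>Q\<close> nondecreasing and
  \<open>P u + Q u = u\<close>, and \<open>\<phi>\<^sub>G(y)\<close> is the infimum over \<open>u\<close> of \<open>(P u - y\<^sub>1) (Q u - y\<^sub>2)\<close>.
  Weak duality \<open>\<integral>c d\<gamma> \<ge> \<integral>\<phi>\<^sub>G d\<nu>\<close> comes from testing \<open>\<phi>\<^sub>G(y)\<close> against the projection of \<open>x\<close> on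
  \<open>G\<close> along the antidiagonal; equality forces \<open>x\<close> to lie in \<open>G\<close> and to minimize \<open>c(\<cdot>, y)\<close> there.

  For almost every \<open>y\<close> outside \<open>E\<close> the minimizer exists and is unique, with all minimizing sequences
  converging to it: points with two minimizers lie on countably many curves of \<open>\<D>\<close>, and minimizing
  sequences that run off to infinity contradict the optimality of \<open>G\<close>. At such points \<open>D\<^sup>c\<phi>(y)\<close> is the
  minimizer, also on the boundary of the domain. Moving pieces of \<open>G\<close> horizontally or vertically, the
  first-order condition for the dual maximizer shows that the minimizer is almost surely off the
  segments of \<open>G\<close> and is the conditional expectation of \<open>Y\<close>, so that equality holds in weak duality.\<close>

section \<open>Minimizing the cost along a monotone curve\<close>

text \<open>Parametrizing \<open>G\<close> by the sum of coordinates makes \<open>P\<close> and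
  \<open>Q\<close> 1-Lipschitz and turns \<open>phiG\<close> into the infimum of a continuous
  function on the line; attainment (sequences may run off) and uniqueness can fail. A unique
  minimizer alone would not give the gradient, above all on the boundary of the domain, so the
  working notion is \<open>well_posed\<close>: near-minimal values force nearness to
  \<open>U\<close>. It yields the envelope formula for the gradient and the limit in the first-order
  condition. The obstacle in the first-order condition is that the dual class is not linear:
  \<open>P + \<epsilon>\<kappa>\<close> must stay nondecreasing, so \<open>\<kappa>\<close> cannot
  fall where \<open>P\<close> is flat. Only one-sided inequalities are available, for parameters
  with \<open>incr_at\<close> or \<open>decr_at\<close>; they combine to equalities once vertical
  segments, ends included, are shown to receive no mass. A perturbation also destroys
  \<open>P u + Q u = u\<close>, so competitors are only required to have \<open>P' + Q'\<close>
  onto. Exchange of coordinates and reflection at the origin preserve all notions involved, so that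
  most estimates are proved for one end and one coordinate.\<close>

definition ccost :: "(real \<Rightarrow> real) \<Rightarrow> (real \<Rightarrow> real) \<Rightarrow> real \<Rightarrow> real \<Rightarrow> real \<Rightarrow> real" where
  "ccost P Q y1 y2 u = (P u - y1) * (Q u - y2)"

definition phiE :: "(real \<Rightarrow> real) \<Rightarrow> (real \<Rightarrow> real) \<Rightarrow> real \<Rightarrow> real \<Rightarrow> ereal" where
  "phiE P Q y1 y2 = (INF u. ereal (ccost P Q y1 y2 u))"

definition phiR :: "(real \<Rightarrow> real) \<Rightarrow> (real \<Rightarrow> real) \<Rightarrow> real \<Rightarrow> real \<Rightarrow> real" where
  "phiR P Q y1 y2 = real_of_ereal (phiE P Q y1 y2)"

text \<open>Membership in \<open>E_G\<close> read off the parametrization: a point of the curve has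
  parameter \<open>y1 + y2\<close>, and a second parameter sharing a coordinate with it means a
  vertical or horizontal segment (\<open>E_G_curve\<close>).\<close>

definition on_segment :: "(real \<Rightarrow> real) \<Rightarrow> (real \<Rightarrow> real) \<Rightarrow> real \<Rightarrow> real \<Rightarrow> bool" where
  "on_segment P Q y1 y2 \<longleftrightarrow> P (y1 + y2) = y1 \<and> Q (y1 + y2) = y2 \<and>
     (\<exists>u. u \<noteq> y1 + y2 \<and> (P u = y1 \<or> Q u = y2))"

text \<open>Some minimizing sequence runs off along the upper end. Meaningful only where
  \<open>phiE\<close> is finite, since \<open>phiR\<close> is 0 at
  \<open>-\<infinity>\<close>.\<close>

definition escape_up :: "(real \<Rightarrow> real) \<Rightarrow> (real \<Rightarrow> real) \<Rightarrow> real \<Rightarrow> real \<Rightarrow> bool" where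
  "escape_up P Q y1 y2 \<longleftrightarrow> (\<forall>R. \<forall>e>0. \<exists>u\<ge>R. ccost P Q y1 y2 u < phiR P Q y1 y2 + e)"

definition escape_down :: "(real \<Rightarrow> real) \<Rightarrow> (real \<Rightarrow> real) \<Rightarrow> real \<Rightarrow> real \<Rightarrow> bool" where
  "escape_down P Q y1 y2 \<longleftrightarrow> (\<forall>R. \<forall>e>0. \<exists>u\<le>R. ccost P Q y1 y2 u < phiR P Q y1 y2 + e)"

text \<open>Tykhonov well-posedness: \<open>U\<close> is the minimizer and every minimizing sequence
  converges to it.\<close>

definition well_posed :: "(real \<Rightarrow> real) \<Rightarrow> (real \<Rightarrow> real) \<Rightarrow> real \<Rightarrow> real \<Rightarrow> real \<Rightarrow> bool" where
  "well_posed P Q y1 y2 U \<longleftrightarrow> phiE P Q y1 y2 > -\<infinity> \<and> ccost P Q y1 y2 U = phiR P Q y1 y2 \<and>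
     (\<forall>\<delta>>0. \<exists>\<eta>>0. \<forall>u. \<bar>u - U\<bar> \<ge> \<delta> \<longrightarrow> phiR P Q y1 y2 + \<eta> \<le> ccost P Q y1 y2 u)"

text \<open>Used on both components it reflects the curve at the origin, with parameter
  \<open>u\<close> sent to \<open>-u\<close>. The product defining the cost is unchanged, so
  statements on the upper end transfer to the lower end.\<close>

definition reflect :: "(real \<Rightarrow> real) \<Rightarrow> real \<Rightarrow> real" where
  "reflect f u = - f (- u)"

section \<open>Invariance under exchange of coordinates and reflection at the origin\<close>

lemma ccost_swap: "ccost Q P y2 y1 u = ccost P Q y1 y2 u"
  by (simp add: ccost_def)

lemma ccost_neg: "ccost (reflect P) (reflect Q) (- y1) (- y2) u = ccost P Q y1 y2 (- u)"
  by (simp add: ccost_def reflect_def algebra_simps)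

lemma phiE_swap: "phiE Q P y2 y1 = phiE P Q y1 y2"
  by (simp add: phiE_def ccost_swap[of Q P])

lemma phiE_neg: "phiE (reflect P) (reflect Q) (- y1) (- y2) = phiE P Q y1 y2"
proof -
  have "(\<lambda>u. ereal (ccost P Q y1 y2 (- u))) ` UNIV = (\<lambda>u. ereal (ccost P Q y1 y2 u)) ` UNIV"
    by (auto simp: image_iff) (metis minus_minus)
  then show ?thesis unfolding phiE_def ccost_neg by simp
qed

lemma phiR_swap: "phiR Q P y2 y1 = phiR P Q y1 y2"
  by (simp add: phiR_def phiE_swap)

lemma phiR_neg: "phiR (reflect P) (reflect Q) (- y1) (- y2) = phiR P Q y1 y2"
  by (simp add: phiR_def phiE_neg)

lemma on_segment_swap: "on_segment Q P y2 y1 \<longleftrightarrow> on_segment P Q y1 y2"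
  unfolding on_segment_def by (auto simp: add.commute)

lemma on_segment_neg: "on_segment (reflect P) (reflect Q) (- y1) (- y2) \<longleftrightarrow> on_segment P Q y1 y2"
proof -
  have "(\<exists>u. u \<noteq> - y1 - y2 \<and> (P (- u) = y1 \<or> Q (- u) = y2)) \<longleftrightarrow>
        (\<exists>u. u \<noteq> y1 + y2 \<and> (P u = y1 \<or> Q u = y2))"
  proof (intro iffI; elim exE)
    fix u assume "u \<noteq> - y1 - y2 \<and> (P (- u) = y1 \<or> Q (- u) = y2)"
    then show "\<exists>u. u \<noteq> y1 + y2 \<and> (P u = y1 \<or> Q u = y2)" by (intro exI[of _ "-u"]) auto
  next
    fix u assume "u \<noteq> y1 + y2 \<and> (P u = y1 \<or> Q u = y2)"
    then show "\<exists>u. u \<noteq> - y1 - y2 \<and> (P (- u) = y1 \<or> Q (- u) = y2)" by (intro exI[of _ "-u"]) auto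
  qed
  then show ?thesis unfolding on_segment_def reflect_def by (simp add: add.commute)
qed

lemma escape_up_swap: "escape_up Q P y2 y1 \<longleftrightarrow> escape_up P Q y1 y2"
  by (simp add: escape_up_def ccost_swap phiR_swap)

lemma escape_up_neg: "escape_up (reflect P) (reflect Q) (- y1) (- y2) \<longleftrightarrow> escape_down P Q y1 y2"
proof -
  have "(\<exists>u\<ge>R. ccost P Q y1 y2 (- u) < e) \<longleftrightarrow> (\<exists>u\<le>-R. ccost P Q y1 y2 u < e)" for R e
  proof (intro iffI; elim exE conjE)
    fix u assume "R \<le> u" "ccost P Q y1 y2 (- u) < e"
    then show "\<exists>u\<le>-R. ccost P Q y1 y2 u < e" by (intro exI[of _ "-u"]) auto
  next
    fix u assume "u \<le> - R" "ccost P Q y1 y2 u < e"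
    then show "\<exists>u\<ge>R. ccost P Q y1 y2 (- u) < e" by (intro exI[of _ "-u"]) auto
  qed
  moreover have "(\<forall>R. H (- R)) \<longleftrightarrow> (\<forall>R. H R)" for H :: "real \<Rightarrow> bool"
    by (metis minus_minus)
  ultimately show ?thesis unfolding escape_up_def escape_down_def ccost_neg phiR_neg
    by (simp only:) 
qed

lemma well_posed_swap: "well_posed Q P y2 y1 U \<longleftrightarrow> well_posed P Q y1 y2 U"
  by (simp add: well_posed_def ccost_swap phiR_swap phiE_swap)

lemma well_posed_neg: "well_posed (reflect P) (reflect Q) (- y1) (- y2) (- U) \<longleftrightarrow> well_posed P Q y1 y2 U"
proof -
  have "(\<forall>u. \<bar>u - - U\<bar> \<ge> \<delta> \<longrightarrow> h \<le> ccost P Q y1 y2 (- u)) \<longleftrightarrow>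
        (\<forall>u. \<bar>u - U\<bar> \<ge> \<delta> \<longrightarrow> h \<le> ccost P Q y1 y2 u)" for \<delta> h :: real
  proof -
    have "\<bar>- u - - U\<bar> = \<bar>u - U\<bar>" for u by simp
    then show ?thesis by (metis minus_minus)
  qed
  then show ?thesis unfolding well_posed_def ccost_neg phiR_neg phiE_neg by simp
qed

lemma phiE_less_PInf: "phiE P Q y1 y2 < \<infinity>"
proof -
  have "phiE P Q y1 y2 \<le> ereal (ccost P Q y1 y2 0)" unfolding phiE_def by (rule INF_lower) simp
  then show ?thesis by (cases "phiE P Q y1 y2") auto
qed

lemma phiE_eq_ph: "phiE P Q y1 y2 > -\<infinity> \<Longrightarrow> phiE P Q y1 y2 = ereal (phiR P Q y1 y2)"
  using phiE_less_PInf[of P Q y1 y2] unfolding phiR_def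
  by (cases "phiE P Q y1 y2") auto

lemma phiR_le: "phiE P Q y1 y2 > -\<infinity> \<Longrightarrow> phiR P Q y1 y2 \<le> ccost P Q y1 y2 u"
  using phiE_eq_ph[of P Q y1 y2] INF_lower[of u UNIV "\<lambda>u. ereal (ccost P Q y1 y2 u)"]
  unfolding phiE_def by simp

lemma phiE_gt_MInf_I: "(\<And>u. b \<le> ccost P Q y1 y2 u) \<Longrightarrow> phiE P Q y1 y2 > -\<infinity>"
proof -
  assume "\<And>u. b \<le> ccost P Q y1 y2 u"
  then have "ereal b \<le> phiE P Q y1 y2" unfolding phiE_def by (intro INF_greatest) simp
  then show ?thesis by (cases "phiE P Q y1 y2") auto
qed

lemma phiR_greatest: "(\<And>u. b \<le> ccost P Q y1 y2 u) \<Longrightarrow> b \<le> phiR P Q y1 y2"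
proof -
  assume a: "\<And>u. b \<le> ccost P Q y1 y2 u"
  then have "ereal b \<le> phiE P Q y1 y2" unfolding phiE_def by (intro INF_greatest) simp
  then show ?thesis using phiE_eq_ph[OF phiE_gt_MInf_I[OF a]] by simp
qed

lemma phiR_near:
  assumes "phiE P Q y1 y2 > -\<infinity>" "e > 0"
  obtains u where "ccost P Q y1 y2 u < phiR P Q y1 y2 + e"
proof -
  have "\<not> (\<forall>u. phiR P Q y1 y2 + e \<le> ccost P Q y1 y2 u)"
    using phiR_greatest[of "phiR P Q y1 y2 + e"] assms(2) by force
  then show ?thesis using that by (auto simp: not_le)
qed

text \<open>Minty's parametrization by the antidiagonal coordinate: both components are then
  automatically 1-Lipschitz, and every maximal monotone set has this form
  (\<open>maximal_curve\<close>).\<close>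

locale curve =
  fixes P Q :: "real \<Rightarrow> real"
  assumes mP: "mono P" and mQ: "mono Q" and PQ: "P u + Q u = u"
begin

lemma swap: "curve Q P"
  by unfold_locales (use mP mQ PQ in \<open>auto simp: add.commute\<close>)

lemma neg: "curve (reflect P) (reflect Q)"
proof
  show "mono (reflect P)" using mP unfolding reflect_def mono_def by simp
  show "mono (reflect Q)" using mQ unfolding reflect_def mono_def by simp
  show "reflect P u + reflect Q u = u" for u using PQ[of "-u"] unfolding reflect_def by simp
qed

lemma P_mono: "u \<le> v \<Longrightarrow> P u \<le> P v" using mP by (rule monoD)
lemma Q_mono: "u \<le> v \<Longrightarrow> Q u \<le> Q v" using mQ by (rule monoD)

lemma P_lip: "u \<le> v \<Longrightarrow> P v - P u \<le> v - u"
  using PQ[of u] PQ[of v] Q_mono[of u v] by linarith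
lemma Q_lip: "u \<le> v \<Longrightarrow> Q v - Q u \<le> v - u"
  using PQ[of u] PQ[of v] P_mono[of u v] by linarith

lemma P_lip': "\<bar>P v - P u\<bar> \<le> \<bar>v - u\<bar>"
  using P_lip[of u v] P_lip[of v u] P_mono[of u v] P_mono[of v u] by linarith
lemma Q_lip': "\<bar>Q v - Q u\<bar> \<le> \<bar>v - u\<bar>"
  using Q_lip[of u v] Q_lip[of v u] Q_mono[of u v] Q_mono[of v u] by linarith

lemma P_cont: "continuous_on A P"
proof -
  have "1-lipschitz_on A P" by (rule lipschitz_onI) (use P_lip' in \<open>auto simp: dist_real_def\<close>)
  then show ?thesis by (rule lipschitz_on_continuous_on)
qed
lemma Q_cont: "continuous_on A Q"
proof -
  have "1-lipschitz_on A Q" by (rule lipschitz_onI) (use Q_lip' in \<open>auto simp: dist_real_def\<close>)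
  then show ?thesis by (rule lipschitz_on_continuous_on)
qed

lemma PQ_borel[measurable]: "P \<in> borel_measurable borel" "Q \<in> borel_measurable borel"
  using P_cont Q_cont by (auto intro: borel_measurable_continuous_onI)

lemma ccost_cont: "continuous_on A (ccost P Q y1 y2)"
  unfolding ccost_def by (intro continuous_intros P_cont Q_cont)

lemma ccost_pos_pt: "ccost P Q (P v) (Q v) u \<ge> 0"
  unfolding ccost_def using P_mono[of u v] P_mono[of v u] Q_mono[of u v] Q_mono[of v u]
  by (cases "u \<le> v") (auto simp: mult_nonpos_nonpos)

text \<open>The parameter \<open>y1 + y2\<close> is the antidiagonal projection of \<open>y\<close>
  onto the curve, where the two factors are opposite numbers. This is why \<open>phiR\<close> is
  nonpositive on the domain and vanishes only on the curve.\<close>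

lemma ccost_at_sum: "ccost P Q y1 y2 (y1 + y2) = - (P (y1 + y2) - y1)\<^sup>2"
proof -
  have *: "Q (y1 + y2) - y2 = - (P (y1 + y2) - y1)" using PQ[of "y1 + y2"] by linarith
  show ?thesis unfolding ccost_def * power2_eq_square by (rule mult_minus_right)
qed

lemma phiR_nonpos: "phiE P Q y1 y2 > -\<infinity> \<Longrightarrow> phiR P Q y1 y2 \<le> 0"
  using phiR_le[of P Q y1 y2 "y1+y2"] unfolding ccost_at_sum by (smt (verit) zero_le_power2)

lemma phiR_zero_on_curve: assumes "phiE P Q y1 y2 > -\<infinity>" "phiR P Q y1 y2 = 0"
  shows "P (y1 + y2) = y1" "Q (y1 + y2) = y2"
proof -
  have "(P (y1 + y2) - y1)\<^sup>2 \<le> 0" using phiR_le[of P Q y1 y2 "y1+y2"] assms unfolding ccost_at_sum by simp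
  then show "P (y1 + y2) = y1" by simp
  then show "Q (y1 + y2) = y2" using PQ[of "y1 + y2"] by linarith
qed

lemma phiE_curve: "phiE P Q (P v) (Q v) > -\<infinity>"
  by (rule phiE_gt_MInf_I[OF ccost_pos_pt])

lemma phiR_curve: "phiR P Q (P v) (Q v) = 0"
  using phiR_greatest[of 0 P Q "P v" "Q v", OF ccost_pos_pt] phiR_nonpos[OF phiE_curve[of v]] by linarith

lemma on_segment_phe: "on_segment P Q y1 y2 \<Longrightarrow> phiE P Q y1 y2 > -\<infinity>"
  unfolding on_segment_def by (metis phiE_curve)

lemma on_segment_ph: "on_segment P Q y1 y2 \<Longrightarrow> phiR P Q y1 y2 = 0"
  unfolding on_segment_def by (metis phiR_curve)

text \<open>A zero minimum puts \<open>y\<close> on the curve; a zero of the product at another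
  parameter then shares a coordinate with \<open>y\<close>, which makes \<open>y\<close> a point of
  a segment.\<close>

lemma ccost_neg_off_segment:
  assumes "phiE P Q y1 y2 > -\<infinity>" "\<not> on_segment P Q y1 y2" "ccost P Q y1 y2 u = phiR P Q y1 y2" "u \<noteq> y1 + y2"
  shows "ccost P Q y1 y2 u < 0"
proof (rule ccontr)
  assume "\<not> ?thesis"
  then have "phiR P Q y1 y2 = 0" using phiR_nonpos[OF assms(1)] assms(3) by linarith
  with phiR_zero_on_curve[OF assms(1) this] assms(2-4) show False
    unfolding on_segment_def ccost_def by auto
qed

text \<open>If the first coordinates agreed, the cost would be affine in the second one and equal at
  two values, so the common factor and both costs would be zero. One of \<open>u\<close>,
  \<open>v\<close> differs from \<open>y1 + y2\<close>, and there the cost must be negative.\<close>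

lemma two_argmin:
  assumes d: "phiE P Q y1 y2 > -\<infinity>" and n: "\<not> on_segment P Q y1 y2"
    and u: "ccost P Q y1 y2 u = phiR P Q y1 y2" and v: "ccost P Q y1 y2 v = phiR P Q y1 y2" and "u < v"
  shows "P u < P v"
proof (rule ccontr)
  assume "\<not> P u < P v"
  then have e: "P u = P v" using P_mono[of u v] \<open>u < v\<close> by simp
  then have "Q u \<noteq> Q v" using PQ[of u] PQ[of v] \<open>u < v\<close> by linarith
  have "(P v - y1) * (Q u - y2) = (P v - y1) * (Q v - y2)" using u v e unfolding ccost_def by simp
  then have "(P v - y1) * (Q u - Q v) = 0" by (simp add: algebra_simps)
  then have "P u = y1" using \<open>Q u \<noteq> Q v\<close> e by simp
  then have "ccost P Q y1 y2 u = 0" "ccost P Q y1 y2 v = 0" using e unfolding ccost_def by auto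
  then show False using ccost_neg_off_segment[OF d n u] ccost_neg_off_segment[OF d n v] \<open>u < v\<close> by fastforce
qed

end

lemma (in curve) two_argmin_Q:
  assumes "phiE P Q y1 y2 > -\<infinity>" "\<not> on_segment P Q y1 y2"
    "ccost P Q y1 y2 u = phiR P Q y1 y2" "ccost P Q y1 y2 v = phiR P Q y1 y2" "u < v"
  shows "Q u < Q v"
  using curve.two_argmin[OF swap, of y2 y1 u v] assms
  by (simp add: ccost_swap phiR_swap phiE_swap on_segment_swap)

context curve begin

lemma compact_gap:
  assumes "compact C" "\<And>u. u \<in> C \<Longrightarrow> p < ccost P Q y1 y2 u"
  shows "\<exists>\<eta>>0. \<forall>u\<in>C. p + \<eta> \<le> ccost P Q y1 y2 u"
proof (cases "C = {}")
  case True then show ?thesis by (auto intro: exI[of _ 1])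
next
  case False
  obtain w where w: "w \<in> C" "\<forall>u\<in>C. ccost P Q y1 y2 w \<le> ccost P Q y1 y2 u"
    using continuous_attains_inf[OF assms(1) False ccost_cont] by blast
  show ?thesis using assms(2)[OF w(1)] w by (intro exI[of _ "ccost P Q y1 y2 w - p"]) auto
qed

text \<open>Without escape both tails stay above the infimum by fixed gaps. If it were not attained,
  compactness would give a gap in the middle as well, and a larger lower bound would exist.\<close>

lemma no_escape_attained:
  assumes d: "phiE P Q y1 y2 > -\<infinity>" and "\<not> escape_up P Q y1 y2" "\<not> escape_down P Q y1 y2"
  obtains u where "ccost P Q y1 y2 u = phiR P Q y1 y2"
proof -
  obtain R e where R: "e > 0" "\<And>u. u \<ge> R \<Longrightarrow> phiR P Q y1 y2 + e \<le> ccost P Q y1 y2 u"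
    using assms(2) unfolding escape_up_def by (meson not_le)
  obtain R' e' where R': "e' > 0" "\<And>u. u \<le> R' \<Longrightarrow> phiR P Q y1 y2 + e' \<le> ccost P Q y1 y2 u"
    using assms(3) unfolding escape_down_def by (meson not_le)
  show ?thesis
  proof (rule ccontr)
    assume "\<not> thesis"
    then have "phiR P Q y1 y2 < ccost P Q y1 y2 u" for u using that[of u] phiR_le[OF d, of u] \<open>\<not> thesis\<close> by (simp add: order_less_le) metis
    then obtain \<eta> where "\<eta> > 0" and g: "\<forall>u\<in>{R'..R}. phiR P Q y1 y2 + \<eta> \<le> ccost P Q y1 y2 u"
      using compact_gap[of "{R'..R}" "phiR P Q y1 y2" y1 y2] by auto
    have "phiR P Q y1 y2 + min \<eta> (min e e') \<le> ccost P Q y1 y2 u" for u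
    proof -
      consider "u \<ge> R" | "u \<le> R'" | "u \<in> {R'..R}" by fastforce
      then show ?thesis
        using R(2)[of u] R'(2)[of u] g by cases (smt (verit) min_def)+
    qed
    then have "phiR P Q y1 y2 + min \<eta> (min e e') \<le> phiR P Q y1 y2" by (rule phiR_greatest)
    then show False using \<open>\<eta> > 0\<close> R(1) R'(1) by linarith
  qed
qed

lemma well_posed_I:
  assumes d: "phiE P Q y1 y2 > -\<infinity>" and "\<not> escape_up P Q y1 y2" "\<not> escape_down P Q y1 y2"
    and U: "ccost P Q y1 y2 U = phiR P Q y1 y2"
    and uniq: "\<And>u. ccost P Q y1 y2 u = phiR P Q y1 y2 \<Longrightarrow> u = U"
  shows "well_posed P Q y1 y2 U"
  unfolding well_posed_def
proof (intro conjI allI impI d U)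
  fix \<delta> :: real assume "\<delta> > 0"
  obtain R e where R: "e > 0" "\<And>u. u \<ge> R \<Longrightarrow> phiR P Q y1 y2 + e \<le> ccost P Q y1 y2 u"
    using assms(2) unfolding escape_up_def by (meson not_le)
  obtain R' e' where R': "e' > 0" "\<And>u. u \<le> R' \<Longrightarrow> phiR P Q y1 y2 + e' \<le> ccost P Q y1 y2 u"
    using assms(3) unfolding escape_down_def by (meson not_le)
  have "compact ({R'..R} - {U-\<delta><..<U+\<delta>})" by (intro compact_diff) auto
  moreover have "phiR P Q y1 y2 < ccost P Q y1 y2 u" if "u \<in> {R'..R} - {U-\<delta><..<U+\<delta>}" for u
    using that uniq[of u] phiR_le[OF d, of u] \<open>\<delta> > 0\<close> by fastforce
  ultimately obtain \<eta> where "\<eta> > 0" and g: "\<forall>u\<in>{R'..R} - {U-\<delta><..<U+\<delta>}. phiR P Q y1 y2 + \<eta> \<le> ccost P Q y1 y2 u"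
    using compact_gap by blast
  show "\<exists>\<eta>>0. \<forall>u. \<delta> \<le> \<bar>u - U\<bar> \<longrightarrow> phiR P Q y1 y2 + \<eta> \<le> ccost P Q y1 y2 u"
  proof (intro exI[of _ "min \<eta> (min e e')"] conjI allI impI)
    show "0 < min \<eta> (min e e')" using \<open>\<eta> > 0\<close> R(1) R'(1) by simp
    fix u assume "\<delta> \<le> \<bar>u - U\<bar>"
    then have "u \<notin> {U-\<delta><..<U+\<delta>}" by auto
    then show "phiR P Q y1 y2 + min \<eta> (min e e') \<le> ccost P Q y1 y2 u"
    proof -
      consider "u \<ge> R" | "u \<le> R'" | "u \<in> {R'..R} - {U-\<delta><..<U+\<delta>}"
        using \<open>u \<notin> _\<close> by fastforce
      then show ?thesis
        using R(2)[of u] R'(2)[of u] g by cases (smt (verit) min_def)+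
    qed
  qed
qed

lemma well_posed_unique: "well_posed P Q y1 y2 U \<Longrightarrow> ccost P Q y1 y2 u = phiR P Q y1 y2 \<Longrightarrow> u = U"
proof (rule ccontr)
  assume a: "well_posed P Q y1 y2 U" "ccost P Q y1 y2 u = phiR P Q y1 y2" "u \<noteq> U"
  then have "\<bar>u - U\<bar> > 0" by simp
  with a(1) obtain \<eta> where "\<eta> > 0" "\<forall>v. \<bar>v - U\<bar> \<ge> \<bar>u - U\<bar> \<longrightarrow> phiR P Q y1 y2 + \<eta> \<le> ccost P Q y1 y2 v"
    unfolding well_posed_def by blast
  then show False using a(2) by (metis add_le_same_cancel1 linorder_not_less order_refl)
qed

text \<open>If \<open>P\<close> stayed below \<open>y1 - e\<close>, the second factor would grow
  like \<open>u\<close> against a first factor of at most \<open>-e\<close>, and the infimum would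
  be \<open>-\<infinity>\<close>.\<close>

lemma dom_upper:
  assumes d: "phiE P Q y1 y2 > -\<infinity>" and "e > 0"
  shows "\<exists>u. P u > y1 - e"
proof (rule ccontr)
  assume "\<not> ?thesis"
  then have a: "P u \<le> y1 - e" for u by (simp add: not_less)
  define u where "u = \<bar>y1\<bar> + \<bar>y2\<bar> + e + (\<bar>phiR P Q y1 y2\<bar> + 1) / e"
  have "Q u \<ge> u - y1" using PQ[of u] a[of u] \<open>e > 0\<close> by linarith
  then have q: "Q u - y2 \<ge> (\<bar>phiR P Q y1 y2\<bar> + 1) / e" unfolding u_def using \<open>e > 0\<close> by linarith
  have "0 \<le> (\<bar>phiR P Q y1 y2\<bar> + 1) / e" using \<open>e > 0\<close> by simp
  have "(y1 - P u) * (Q u - y2) \<ge> e * ((\<bar>phiR P Q y1 y2\<bar> + 1) / e)"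
    using a[of u] q \<open>e > 0\<close> \<open>0 \<le> _\<close> by (intro mult_mono) auto
  then have "(y1 - P u) * (Q u - y2) \<ge> \<bar>phiR P Q y1 y2\<bar> + 1" using \<open>e > 0\<close> by simp
  moreover have "ccost P Q y1 y2 u = - ((y1 - P u) * (Q u - y2))" by (simp add: ccost_def algebra_simps)
  ultimately show False using phiR_le[OF d, of u] by linarith
qed

lemma dom_lower:
  assumes d: "phiE P Q y1 y2 > -\<infinity>" and "e > 0"
  shows "\<exists>u. P u < y1 + e"
proof -
  interpret n: curve "reflect P" "reflect Q" by (rule neg)
  have "phiE (reflect P) (reflect Q) (-y1) (-y2) > -\<infinity>" using d by (simp only: phiE_neg)
  then obtain u where "reflect P u > - y1 - e"
    using n.dom_upper \<open>e > 0\<close> by blast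
  then show ?thesis by (intro exI[of _ "-u"]) (simp add: reflect_def)
qed

text \<open>Beyond a curve point dominating \<open>y\<close> strictly, both factors are positive and
  bounded below, while \<open>phiR\<close> is nonpositive.\<close>

lemma inside_up:
  assumes "y1 < P w" "y2 < Q w" "phiE P Q y1 y2 > -\<infinity>"
  shows "\<not> escape_up P Q y1 y2"
proof -
  define c where "c = (P w - y1) * (Q w - y2)"
  have "c > 0" using assms by (simp add: c_def)
  have *: "ccost P Q y1 y2 u \<ge> phiR P Q y1 y2 + c" if "u \<ge> w" for u
  proof -
    have "(P u - y1) * (Q u - y2) \<ge> (P w - y1) * (Q w - y2)"
      using assms P_mono[OF that] Q_mono[OF that] by (intro mult_mono) auto
    then show ?thesis using phiR_nonpos[OF \<open>phiE P Q y1 y2 > -\<infinity>\<close>] by (simp add: ccost_def c_def)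
  qed
  then show ?thesis using \<open>c > 0\<close> unfolding escape_up_def by (meson not_le)
qed

text \<open>Far out on either side the two factors have the same sign, and in between the cost is
  bounded by compactness. The box is open, which later gives interior points of the domain.\<close>

lemma box_dom:
  assumes "P u0 < y1" "y1 < P u1" "Q v0 < y2" "y2 < Q v1"
  shows "phiE P Q y1 y2 > -\<infinity>" "\<not> escape_up P Q y1 y2" "\<not> escape_down P Q y1 y2"
proof -
  define a where "a = min u0 v0"
  define b where "b = max u1 v1"
  have A: "P a < y1" "Q a < y2" using P_mono[of a u0] Q_mono[of a v0] assms by (auto simp: a_def)
  have B: "y1 < P b" "y2 < Q b" using P_mono[of u1 b] Q_mono[of v1 b] assms by (auto simp: b_def)
  have c: "\<exists>m. \<forall>u\<in>{a..b}. m \<le> ccost P Q y1 y2 u"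
  proof (cases "{a..b} = {}")
    case False
    show ?thesis using continuous_attains_inf[OF compact_Icc False ccost_cont] by blast
  qed auto
  then obtain m where m: "\<forall>u\<in>{a..b}. m \<le> ccost P Q y1 y2 u" by blast
  have "min m 0 \<le> ccost P Q y1 y2 u" for u
  proof -
    consider "u \<in> {a..b}" | "u \<ge> b" | "u \<le> a" by fastforce
    then show ?thesis
    proof cases
      case 1 then show ?thesis using m by fastforce
    next
      case 2 then show ?thesis using P_mono[OF 2] Q_mono[OF 2] B by (simp add: ccost_def min.coboundedI2)
    next
      case 3 
      have "0 \<le> (P u - y1) * (Q u - y2)" using P_mono[OF 3] Q_mono[OF 3] A by (intro mult_nonpos_nonpos) auto
      then show ?thesis by (simp add: ccost_def min.coboundedI2)
    qed
  qed
  then show d: "phiE P Q y1 y2 > -\<infinity>" by (rule phiE_gt_MInf_I)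
  show "\<not> escape_up P Q y1 y2" using inside_up[OF B d] .
  interpret n: curve "reflect P" "reflect Q" by (rule neg)
  have "phiE (reflect P) (reflect Q) (-y1) (-y2) > -\<infinity>" using d by (simp only: phiE_neg)
  moreover have "- y1 < reflect P (-a)" "- y2 < reflect Q (-a)" using A by (auto simp: reflect_def)
  ultimately have "\<not> escape_up (reflect P) (reflect Q) (-y1) (-y2)" by (intro n.inside_up)
  then show "\<not> escape_down P Q y1 y2" by (simp add: escape_up_neg)
qed

end

section \<open>Points with several minimizers\<close>

text \<open>The bi-Lipschitz extension is the infimum of the extremal one-point extensions.\<close>
lemma bilip_extend:
  fixes B :: "pt set" and K :: real
  assumes K: "K \<ge> 1"
    and B: "\<And>y s. y \<in> B \<Longrightarrow> s \<in> B \<Longrightarrow> fst s < fst y \<Longrightarrow>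
      (fst y - fst s) / K \<le> snd s - snd y \<and> snd s - snd y \<le> K * (fst y - fst s)"
    and V: "\<And>y s. y \<in> B \<Longrightarrow> s \<in> B \<Longrightarrow> fst s = fst y \<Longrightarrow> snd s = snd y"
  shows "\<exists>D. (\<forall>n. D n \<in> Dfam) \<and> B \<subseteq> (\<Union>n::nat. D n)"
proof (cases "B = {}")
  case True
  have "{(0,0)} \<in> Dfam" unfolding Dfam_def
    by (rule CollectI, rule exI[of _ "\<lambda>_. 0"], rule exI[of _ 0], rule exI[of _ 0], rule exI[of _ 1]) auto
  then show ?thesis using True by auto
next
  case False
  then obtain b where b: "b \<in> B" by blast
  \<comment> \<open>\<open>snd s - m (t - fst s)\<close> is the largest function of \<open>t\<close>
    through \<open>s\<close> with slopes between \<open>-K\<close> and \<open>-1/K\<close>: slope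
    \<open>-1/K\<close> to the right of \<open>s\<close>, slope \<open>-K\<close> to the
    left.\<close>
  define m where "m u = (if u \<ge> 0 then u / K else K * u)" for u :: real
  have mK: "m v - m u \<le> K * (v - u)" "(v - u) / K \<le> m v - m u" if "u \<le> v" for u v
  proof -
    have i: "x / K \<le> K * x" if "x \<ge> 0" for x
    proof -
      have "x \<le> K * K * x" using that K mult_mono[of 1 "K*K" x x] mult_mono[of 1 K 1 K] by simp
      then show ?thesis using K by (simp add: divide_simps mult_ac)
    qed
    show "m v - m u \<le> K * (v - u)" "(v - u) / K \<le> m v - m u"
      using i[of v] i[of "-u"] i[of "v-u"] that K unfolding m_def
      by (auto simp: algebra_simps diff_divide_distrib)
  qed
  have key: "snd y - snd s \<le> - m (fst y - fst s)" if "y \<in> B" "s \<in> B" for y s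
  proof -
    consider "fst s < fst y" | "fst s = fst y" | "fst y < fst s" by linarith
    then show ?thesis
    proof cases
      case 1 then show ?thesis using B[OF that 1] by (simp add: m_def)
    next
      case 2 then show ?thesis using V[OF that 2] by (simp add: m_def)
    next
      case 3 then show ?thesis using B[OF that(2,1) 3] by (simp add: m_def algebra_simps)
    qed
  qed
  define F where "F t = (\<lambda>s. snd s - m (t - fst s)) ` B" for t
  define f where "f t = Inf (F t)" for t
  have bdd: "bdd_below (F t)" for t
  proof (rule bdd_belowI)
    fix x assume "x \<in> F t"
    then obtain p where p: "p \<in> B" "x = snd p - m (t - fst p)" by (auto simp: F_def)
    have "m (t - fst p) - m (fst b - fst p) \<le> K * \<bar>t - fst b\<bar>"
    proof (cases "fst b \<le> t")
      case True then show ?thesis using mK(1)[of "fst b - fst p" "t - fst p"] by simp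
    next
      case False
      then have "0 \<le> (fst b - t) / K" "0 \<le> K * \<bar>t - fst b\<bar>" using K by auto
      then show ?thesis using mK(2)[of "t - fst p" "fst b - fst p"] False by simp
    qed
    then show "snd b - K * \<bar>t - fst b\<bar> \<le> x" using key[OF b p(1)] p(2) by linarith
  qed
  have ne: "F t \<noteq> {}" for t using False by (auto simp: F_def)
  have fB: "f (fst y) = snd y" if "y \<in> B" for y
    unfolding f_def
  proof (rule cInf_eq_minimum)
    show "snd y \<in> F (fst y)" using that by (force simp: F_def m_def)
    show "snd y \<le> x" if "x \<in> F (fst y)" for x
    proof -
      from that obtain p where "p \<in> B" "x = snd p - m (fst y - fst p)" by (auto simp: F_def)
      then show ?thesis using key[OF \<open>y \<in> B\<close>, of p] by linarith
    qed
  qed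
  have f1: "f s - f t \<le> K * (t - s)" if "s \<le> t" for s t
  proof -
    have "f s - K * (t - s) \<le> x" if "x \<in> F t" for x
    proof -
      from that obtain p where p: "p \<in> B" "x = snd p - m (t - fst p)" by (auto simp: F_def)
      have "f s \<le> snd p - m (s - fst p)" unfolding f_def
        by (rule cInf_lower[OF _ bdd]) (use p in \<open>auto simp: F_def\<close>)
      then show ?thesis using mK(1)[of "s - fst p" "t - fst p"] \<open>s \<le> t\<close> p(2) by simp
    qed
    then have "f s - K * (t - s) \<le> f t" unfolding f_def by (intro cInf_greatest[OF ne])
    then show ?thesis by simp
  qed
  have f2: "(t - s) / K \<le> f s - f t" if "s \<le> t" for s t
  proof -
    have "f t + (t - s) / K \<le> x" if "x \<in> F s" for x
    proof -
      from that obtain p where p: "p \<in> B" "x = snd p - m (s - fst p)" by (auto simp: F_def)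
      have "f t \<le> snd p - m (t - fst p)" unfolding f_def
        by (rule cInf_lower[OF _ bdd]) (use p in \<open>auto simp: F_def\<close>)
      then show ?thesis using mK(2)[of "s - fst p" "t - fst p"] \<open>s \<le> t\<close> p(2) by simp
    qed
    then have "f t + (t - s) / K \<le> f s" unfolding f_def by (intro cInf_greatest[OF ne])
    then show ?thesis by simp
  qed
  \<comment> \<open>Members of \<open>Dfam\<close> live over compact intervals, so the graph over
    the whole line is covered by countably many pieces.\<close>
  show ?thesis
  proof (intro exI[of _ "\<lambda>n. (\<lambda>t. (t, f t)) ` {- real n .. real n}"] conjI allI)
    fix n
    show "(\<lambda>t. (t, f t)) ` {- real n .. real n} \<in> Dfam"
      unfolding Dfam_def
      by (rule CollectI, rule exI[of _ f], rule exI[of _ "- real n"], rule exI[of _ "real n"], rule exI[of _ K])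
         (use K f1 f2 in auto)
    show "B \<subseteq> (\<Union>n. (\<lambda>t. (t, f t)) ` {- real n .. real n})"
    proof
      fix y assume "y \<in> B"
      obtain n :: nat where "\<bar>fst y\<bar> \<le> real n" using real_arch_simple by blast
      then have "y \<in> (\<lambda>t. (t, f t)) ` {- real n .. real n}"
        using fB[OF \<open>y \<in> B\<close>] by (intro image_eqI[of _ _ "fst y"]) (auto simp: prod_eq_iff)
      then show "y \<in> (\<Union>n. (\<lambda>t. (t, f t)) ` {- real n .. real n})" by blast
    qed
  qed
qed

definition multi_argmin :: "(real \<Rightarrow> real) \<Rightarrow> (real \<Rightarrow> real) \<Rightarrow> pt \<Rightarrow> bool" where
  "multi_argmin P Q y \<longleftrightarrow> phiE P Q (fst y) (snd y) > -\<infinity> \<and> \<not> on_segment P Q (fst y) (snd y) \<and>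
    (\<exists>u v. u < v \<and> ccost P Q (fst y) (snd y) u = phiR P Q (fst y) (snd y)
                 \<and> ccost P Q (fst y) (snd y) v = phiR P Q (fst y) (snd y))"

text \<open>Countable decomposition of \<open>multi_argmin\<close>: rationals \<open>p\<close>,
  \<open>q\<close> separate two minimizers in each coordinate with margin
  \<open>1 / (m + 1)\<close>, and \<open>m + 1\<close> bounds their distance in each coordinate, so
  that slopes are controlled uniformly in each piece.\<close>

definition multi_argmin_box :: "(real \<Rightarrow> real) \<Rightarrow> (real \<Rightarrow> real) \<Rightarrow> rat \<times> rat \<times> nat \<Rightarrow> pt set" where
  "multi_argmin_box P Q = (\<lambda>(p, q, m). {y. phiE P Q (fst y) (snd y) > -\<infinity> \<and>
    (\<exists>u v. ccost P Q (fst y) (snd y) u = phiR P Q (fst y) (snd y)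
         \<and> ccost P Q (fst y) (snd y) v = phiR P Q (fst y) (snd y)
         \<and> P u \<le> of_rat p \<and> of_rat p + 1 / (real m + 1) \<le> P v \<and> Q u \<le> of_rat q \<and> of_rat q + 1 / (real m + 1) \<le> Q v
         \<and> P v - P u \<le> real m + 1 \<and> Q v - Q u \<le> real m + 1)})"

context curve begin

lemma multi_argmin_in_box:
  assumes "multi_argmin P Q y" shows "\<exists>i. y \<in> multi_argmin_box P Q i"
proof -
  from assms obtain u v where d: "phiE P Q (fst y) (snd y) > -\<infinity>" and n: "\<not> on_segment P Q (fst y) (snd y)"
    and u: "ccost P Q (fst y) (snd y) u = phiR P Q (fst y) (snd y)"
    and v: "ccost P Q (fst y) (snd y) v = phiR P Q (fst y) (snd y)" and "u < v"
    unfolding multi_argmin_def by blast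
  have p: "P u < P v" using two_argmin[OF d n u v \<open>u < v\<close>] .
  have q: "Q u < Q v" using two_argmin_Q[OF d n u v \<open>u < v\<close>] .
  obtain r1 where r1: "P u < of_rat r1" "of_rat r1 < P v" using of_rat_dense[OF p] by blast
  obtain r2 where r2: "Q u < of_rat r2" "of_rat r2 < Q v" using of_rat_dense[OF q] by blast
  define e where "e = min (P v - of_rat r1) (Q v - of_rat r2)"
  have "e > 0" using r1 r2 by (simp add: e_def)
  obtain m :: nat where m: "1 / e + (v - u) \<le> real m" using real_arch_simple by blast
  have "1 / e \<le> real m + 1" using m \<open>u < v\<close> by linarith
  then have "1 / (real m + 1) \<le> e" using \<open>e > 0\<close> by (simp add: field_simps)
  moreover have "P v - P u \<le> real m + 1" "Q v - Q u \<le> real m + 1"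
    using P_lip[of u v] Q_lip[of u v] \<open>u < v\<close> m \<open>e > 0\<close> by (smt (verit) divide_pos_pos)+
  moreover have "e \<le> P v - of_rat r1" "e \<le> Q v - of_rat r2" by (auto simp: e_def)
  ultimately have "P u \<le> of_rat r1 \<and> of_rat r1 + 1 / (real m + 1) \<le> P v \<and> Q u \<le> of_rat r2 \<and>
      of_rat r2 + 1 / (real m + 1) \<le> Q v \<and> P v - P u \<le> real m + 1 \<and> Q v - Q u \<le> real m + 1"
    using r1 r2 by (intro conjI) linarith+
  then have "y \<in> multi_argmin_box P Q (r1, r2, m)"
    unfolding multi_argmin_box_def using d u v by blast
  then show ?thesis by blast
qed

text \<open>Two-point cyclical monotonicity: exchanging the minimizers of two points cannot lower
  the total cost.\<close>

lemma argmin_cross: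
  assumes d1: "phiE P Q y1 y2 > -\<infinity>" and d2: "phiE P Q s1 s2 > -\<infinity>"
    and u: "ccost P Q y1 y2 u = phiR P Q y1 y2" and v: "ccost P Q s1 s2 v = phiR P Q s1 s2"
  shows "(P v - P u) * (y2 - s2) + (Q v - Q u) * (y1 - s1) \<le> 0"
proof -
  have "ccost P Q y1 y2 u + ccost P Q s1 s2 v \<le> ccost P Q y1 y2 v + ccost P Q s1 s2 u"
    using phiR_le[OF d1, of v] phiR_le[OF d2, of u] u v by linarith
  then show ?thesis unfolding ccost_def by (simp add: algebra_simps)
qed

text \<open>The lower minimizer of one point is paired with the upper minimizer of the other. Both
  pairs straddle \<open>(p, q)\<close>, so the coefficients in \<open>argmin_cross\<close> are
  bounded away from 0, and the two pairings give opposite inequalities.\<close>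

lemma multi_argmin_box_rel:
  assumes "y \<in> multi_argmin_box P Q (p, q, m)" "s \<in> multi_argmin_box P Q (p, q, m)"
  obtains a b c d where
    "a * (snd y - snd s) + b * (fst y - fst s) \<le> 0" "c * (snd y - snd s) + d * (fst y - fst s) \<ge> 0"
    "1 / (real m + 1) \<le> a" "a \<le> 2 * (real m + 1)" "1 / (real m + 1) \<le> b" "b \<le> 2 * (real m + 1)"
    "1 / (real m + 1) \<le> c" "c \<le> 2 * (real m + 1)" "1 / (real m + 1) \<le> d" "d \<le> 2 * (real m + 1)"
proof -
  from assms(1) obtain u v where dy: "phiE P Q (fst y) (snd y) > -\<infinity>"
    and u: "ccost P Q (fst y) (snd y) u = phiR P Q (fst y) (snd y)"
    and v: "ccost P Q (fst y) (snd y) v = phiR P Q (fst y) (snd y)"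
    and uv: "P u \<le> of_rat p" "of_rat p + 1 / (real m + 1) \<le> P v" "Q u \<le> of_rat q" "of_rat q + 1 / (real m + 1) \<le> Q v"
      "P v - P u \<le> real m + 1" "Q v - Q u \<le> real m + 1"
    unfolding multi_argmin_box_def by auto
  from assms(2) obtain u' v' where ds: "phiE P Q (fst s) (snd s) > -\<infinity>"
    and u': "ccost P Q (fst s) (snd s) u' = phiR P Q (fst s) (snd s)"
    and v': "ccost P Q (fst s) (snd s) v' = phiR P Q (fst s) (snd s)"
    and uv': "P u' \<le> of_rat p" "of_rat p + 1 / (real m + 1) \<le> P v'" "Q u' \<le> of_rat q" "of_rat q + 1 / (real m + 1) \<le> Q v'"
      "P v' - P u' \<le> real m + 1" "Q v' - Q u' \<le> real m + 1"
    unfolding multi_argmin_box_def by auto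
  define L where "L = 1 / (real m + 1)"
  have pos: "L > 0" by (simp add: L_def)
  note uv = uv[folded L_def] and uv' = uv'[folded L_def]
  have bds: "L \<le> P v' - P u" "P v' - P u \<le> 2 * (real m + 1)" "L \<le> Q v' - Q u" "Q v' - Q u \<le> 2 * (real m + 1)"
    "L \<le> P v - P u'" "P v - P u' \<le> 2 * (real m + 1)" "L \<le> Q v - Q u'" "Q v - Q u' \<le> 2 * (real m + 1)"
  proof -
    have a: "P v' \<le> of_rat p + (real m + 1)" "Q v' \<le> of_rat q + (real m + 1)"
      "P v \<le> of_rat p + (real m + 1)" "Q v \<le> of_rat q + (real m + 1)"
      using uv(1,3,5,6) uv'(1,3,5,6) by linarith+
    have b: "of_rat p - (real m + 1) \<le> P u'" "of_rat q - (real m + 1) \<le> Q u'"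
      "of_rat p - (real m + 1) \<le> P u" "of_rat q - (real m + 1) \<le> Q u"
      using uv(2,4,5,6) uv'(2,4,5,6) pos by linarith+
    show "L \<le> P v' - P u" using uv(1) uv'(2) by linarith
    show "L \<le> Q v' - Q u" using uv(3) uv'(4) by linarith
    show "L \<le> P v - P u'" using uv'(1) uv(2) by linarith
    show "L \<le> Q v - Q u'" using uv'(3) uv(4) by linarith
    show "P v' - P u \<le> 2 * (real m + 1)" using a(1) b(3) by (simp add: algebra_simps)
    show "Q v' - Q u \<le> 2 * (real m + 1)" using a(2) b(4) by (simp add: algebra_simps)
    show "P v - P u' \<le> 2 * (real m + 1)" using a(3) b(1) by (simp add: algebra_simps)
    show "Q v - Q u' \<le> 2 * (real m + 1)" using a(4) b(2) by (simp add: algebra_simps)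
  qed
  show ?thesis unfolding L_def[symmetric]
  proof (rule that[folded L_def, of "P v' - P u" "Q v' - Q u" "P v - P u'" "Q v - Q u'"])
    show "(P v' - P u) * (snd y - snd s) + (Q v' - Q u) * (fst y - fst s) \<le> 0"
      by (rule argmin_cross[OF dy ds u v'])
    show "(P v - P u') * (snd y - snd s) + (Q v - Q u') * (fst y - fst s) \<ge> 0"
      using argmin_cross[OF ds dy u' v] by (simp add: algebra_simps)
  qed (fact bds)+
qed

lemma ratio_bounds:
  fixes a b h t L K :: real
  assumes "a * h \<le> b * t" "0 < L" "L \<le> a" "b \<le> K" "0 \<le> t" "0 < K"
  shows "h \<le> K / L * t"
proof -
  have "L * h \<le> K * t"
  proof (cases "h \<le> 0")
    case True then show ?thesis using assms by (smt (verit) mult_nonneg_nonneg mult_nonneg_nonpos)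
  next
    case False
    then have "L * h \<le> a * h" using assms by (intro mult_right_mono) auto
    also have "\<dots> \<le> b * t" by fact
    also have "\<dots> \<le> K * t" using assms by (intro mult_right_mono) auto
    finally show ?thesis .
  qed
  then show ?thesis using assms by (simp add: field_simps)
qed

text \<open>\<open>K\<close> is the ratio of the coefficient bounds \<open>2 * (m + 1)\<close> and
  \<open>1 / (m + 1)\<close>. The two opposite inequalities bound the slope between any two points
  of a piece from both sides.\<close>

lemma multi_argmin_box_bilip:
  fixes m :: nat
  defines "K \<equiv> 2 * (real m + 1) * (real m + 1)"
  assumes "y \<in> multi_argmin_box P Q (p, q, m)" "s \<in> multi_argmin_box P Q (p, q, m)" 
  shows "fst s < fst y \<Longrightarrow> (fst y - fst s) / K \<le> snd s - snd y \<and> snd s - snd y \<le> K * (fst y - fst s)"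
    and "fst s = fst y \<Longrightarrow> snd s = snd y"
proof -
  obtain a b c d where 
    h: "a * (snd y - snd s) + b * (fst y - fst s) \<le> 0" "c * (snd y - snd s) + d * (fst y - fst s) \<ge> 0"
    and bd: "1 / (real m + 1) \<le> a" "a \<le> 2 * (real m + 1)" "1 / (real m + 1) \<le> b" "b \<le> 2 * (real m + 1)"
    "1 / (real m + 1) \<le> c" "c \<le> 2 * (real m + 1)" "1 / (real m + 1) \<le> d" "d \<le> 2 * (real m + 1)"
    by (rule multi_argmin_box_rel[OF assms(2,3)])
  define L where "L = 1 / (real m + 1)"
  have L: "L > 0" by (simp add: L_def)
  have KL: "2 * (real m + 1) / L = K" by (simp add: K_def L_def)
  show "snd s = snd y" if "fst s = fst y"
  proof -
    have "a * (snd y - snd s) \<le> 0" "c * (snd y - snd s) \<ge> 0" using h that by auto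
    moreover have "a > 0" "c > 0" using bd L unfolding L_def by linarith+
    ultimately show ?thesis by (simp add: mult_le_0_iff zero_le_mult_iff)
  qed
  show "(fst y - fst s) / K \<le> snd s - snd y \<and> snd s - snd y \<le> K * (fst y - fst s)" if t: "fst s < fst y"
  proof
    have "c * (snd s - snd y) \<le> d * (fst y - fst s)" using h(2) by (simp add: algebra_simps)
    from ratio_bounds[OF this L] bd t show "snd s - snd y \<le> K * (fst y - fst s)"
      unfolding KL[symmetric] L_def by simp
    have *: "b * (fst y - fst s) \<le> a * (snd s - snd y)" using h(1) by (simp add: algebra_simps)
    have "0 < b * (fst y - fst s)" using bd L t unfolding L_def by (intro mult_pos_pos) linarith+
    then have "0 < a * (snd s - snd y)" using * by linarith
    moreover have "a > 0" using bd L unfolding L_def by linarith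
    ultimately have "snd s - snd y > 0" by (simp add: zero_less_mult_iff)
    from ratio_bounds[OF * L] bd this have "fst y - fst s \<le> K * (snd s - snd y)"
      unfolding KL[symmetric] L_def by simp
    moreover have "K > 0" by (simp add: K_def)
    ultimately show "(fst y - fst s) / K \<le> snd s - snd y" by (simp add: field_simps)
  qed
qed

lemma multi_argmin_cover:
  obtains D where "\<And>i n. D i n \<in> Dfam" "{y. multi_argmin P Q y} \<subseteq> (\<Union>i. \<Union>n. D (i :: rat \<times> rat \<times> nat) (n::nat))"
proof -
  have "\<exists>D. (\<forall>n. D n \<in> Dfam) \<and> multi_argmin_box P Q i \<subseteq> (\<Union>n::nat. D n)" for i
  proof -
    obtain p q m where i: "i = (p, q, m)" by (cases i)
    have K: "2 * (real m + 1) * (real m + 1) \<ge> 1" by (smt (verit) mult_le_cancel_left1 of_nat_0_le_iff)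
    show ?thesis unfolding i
    proof (rule bilip_extend[OF K], goal_cases)
      case (1 y s) from multi_argmin_box_bilip(1)[OF this] show ?case .
    next
      case (2 y s) from multi_argmin_box_bilip(2)[OF this] show ?case .
    qed
  qed
  then obtain D where D: "\<And>i. (\<forall>n. D i n \<in> Dfam) \<and> multi_argmin_box P Q i \<subseteq> (\<Union>n::nat. D i n)" by metis
  show ?thesis
  proof (rule that)
    show "D i n \<in> Dfam" for i n using D by blast
    show "{y. multi_argmin P Q y} \<subseteq> (\<Union>i. \<Union>n. D i n)"
    proof
      fix y assume "y \<in> {y. multi_argmin P Q y}"
      then have "multi_argmin P Q y" by simp
      then obtain i where "y \<in> multi_argmin_box P Q i" using multi_argmin_in_box by metis
      then show "y \<in> (\<Union>i. \<Union>n. D i n)" using D[of i] by blast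
    qed
  qed
qed

text \<open>By the second part of \<open>multi_argmin_box_bilip\<close> each piece meets a vertical
  line at most once. This allows a generic choice of the second coordinate in
  \<open>diff_dense\<close>.\<close>

lemma multi_argmin_vertical_countable: "countable {s. multi_argmin P Q (t, s)}"
proof -
  have "{s. multi_argmin P Q (t, s)} \<subseteq> (\<Union>i. {s. (t, s) \<in> multi_argmin_box P Q i})"
    using multi_argmin_in_box by fast
  moreover have "countable {s. (t, s) \<in> multi_argmin_box P Q i}" for i
  proof -
    obtain p q m where i: "i = (p, q, m)" by (cases i)
    have "a = b" if "(t, a) \<in> multi_argmin_box P Q i" "(t, b) \<in> multi_argmin_box P Q i" for a b
      using multi_argmin_box_bilip(2)[OF that[unfolded i]] by simp
    then have "\<exists>a. {s. (t, s) \<in> multi_argmin_box P Q i} \<subseteq> {a}" by blast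
    then show ?thesis by (meson countable_insert countable_empty countable_subset)
  qed
  ultimately show ?thesis by (meson countable_UN countable_subset countableI_type)
qed

end

section \<open>Stability of well-posed minimization\<close>

context curve begin

text \<open>If the values on \<open>[R, \<infinity>)\<close> stay above the infimum at \<open>y\<close>, they do so
  uniformly near \<open>y\<close>, even when \<open>y\<close> is on the boundary of the domain.\<close>

lemma up_far:
  assumes d: "phiE P Q y1 y2 > -\<infinity>" and ne: "\<not> escape_up P Q y1 y2"
  shows "\<exists>\<eta>>0. \<exists>R. \<exists>\<rho>>0. \<forall>s1 s2. phiE P Q s1 s2 > -\<infinity> \<longrightarrow> \<bar>s1 - y1\<bar> < \<rho> \<longrightarrow> \<bar>s2 - y2\<bar> < \<rho> \<longrightarrow>
     (\<forall>u\<ge>R. phiR P Q y1 y2 + \<eta> \<le> ccost P Q s1 s2 u)"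
proof -
  \<comment> \<open>Case of a curve that never passes \<open>y1\<close>. Stated for arbitrary
    \<open>P\<close>, \<open>Q\<close> because it is applied again with the coordinates
    exchanged.\<close>
  have A: "\<exists>\<eta>>0. \<exists>R. \<exists>\<rho>>0. \<forall>s1 s2. phiE P Q s1 s2 > -\<infinity> \<longrightarrow> \<bar>s1 - y1\<bar> < \<rho> \<longrightarrow> \<bar>s2 - y2\<bar> < \<rho> \<longrightarrow>
     (\<forall>u\<ge>R. phiR P Q y1 y2 + \<eta> \<le> ccost P Q s1 s2 u)"
    if cu: "curve P Q" and d: "phiE P Q y1 y2 > -\<infinity>" and ne: "\<not> escape_up P Q y1 y2" and b: "\<And>u. P u \<le> y1"
    for P Q y1 y2
  proof -
    interpret c: curve P Q by fact
    obtain R e where R: "e > 0" "\<And>u. u \<ge> R \<Longrightarrow> phiR P Q y1 y2 + e \<le> ccost P Q y1 y2 u"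
      using ne unfolding escape_up_def by (meson not_le)
    define R' where "R' = max R (y1 + y2 + 1)"
    have Q': "Q u - y2 \<ge> 1" if "u \<ge> R'" for u
      using c.PQ[of u] b[of u] that unfolding R'_def by linarith
    \<comment> \<open>\<open>y1 - P u\<close> is at most \<open>y1 - P R' + 1\<close> for
      \<open>u \<ge> R'\<close>, so changing the second coordinate by less than
      \<open>\<rho>\<close> costs at most \<open>e / 2\<close>; the bound 1 keeps
      \<open>Q u - s2\<close> nonnegative.\<close>
    define \<rho> where "\<rho> = min 1 (e / (2 * (y1 - P R' + 1)))"
    have pp: "y1 - P R' + 1 > 0" using b[of R'] by linarith
    have "\<rho> > 0" using pp R(1) by (simp add: \<rho>_def)
    have pr: "(y1 - P R' + 1) * \<rho> \<le> e / 2"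
    proof -
      have "(y1 - P R' + 1) * \<rho> \<le> (y1 - P R' + 1) * (e / (2 * (y1 - P R' + 1)))"
        using pp by (intro mult_left_mono) (auto simp: \<rho>_def)
      also have "\<dots> = e / 2" using pp by (simp add: field_simps)
      finally show ?thesis .
    qed
    show ?thesis
    proof (rule exI[of _ "e / 2"], rule conjI[OF _ exI[of _ R']], goal_cases)
      case 1 show ?case using R(1) by simp
    next
      case 2 show ?case
      proof (rule exI[of _ \<rho>], intro conjI allI impI)
        show "\<rho> > 0" by fact
        fix s1 s2 u assume ds: "phiE P Q s1 s2 > -\<infinity>" and s: "\<bar>s1 - y1\<bar> < \<rho>" "\<bar>s2 - y2\<bar> < \<rho>" and u: "R' \<le> u"
        \<comment> \<open>A domain point cannot lie to the right of an upper bound of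
          \<open>P\<close>. Hence replacing \<open>s1\<close> by \<open>y1\<close> only lowers the
          cost, and the unbounded factor \<open>Q u - s2\<close> never multiplies an error
          term.\<close>
        have s1: "s1 \<le> y1"
        proof (rule ccontr)
          assume "\<not> ?thesis"
          then obtain v where "P v > s1 - (s1 - y1)" using c.dom_upper[OF ds, of "s1 - y1"] by auto
          then show False using b[of v] by simp
        qed
        have q: "Q u - s2 \<ge> 0" using Q'[OF u] s(2) unfolding \<rho>_def by linarith
        have p: "0 \<le> y1 - P u" "y1 - P u \<le> y1 - P R' + 1" using b[of u] c.P_mono[OF u] by auto
        have "ccost P Q s1 s2 u \<ge> (P u - y1) * (Q u - s2)"
          unfolding ccost_def using s1 q by (intro mult_right_mono) auto
        also have "(P u - y1) * (Q u - s2) = ccost P Q y1 y2 u + (y1 - P u) * (s2 - y2)"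
          unfolding ccost_def by (simp add: algebra_simps)
        moreover have "(y1 - P u) * (s2 - y2) \<ge> - ((y1 - P R' + 1) * \<rho>)"
        proof -
          have "\<bar>(y1 - P u) * (s2 - y2)\<bar> \<le> (y1 - P R' + 1) * \<rho>"
            unfolding abs_mult using p s(2) by (intro mult_mono) auto
          then show ?thesis by linarith
        qed
        moreover have "phiR P Q y1 y2 + e \<le> ccost P Q y1 y2 u" using R(2)[of u] u by (simp add: R'_def)
        ultimately show "phiR P Q y1 y2 + e / 2 \<le> ccost P Q s1 s2 u" using pr by linarith
      qed
    qed
  qed
  show ?thesis
  \<comment> \<open>Either some curve point strictly dominates \<open>y\<close>, and costs beyond it
    are uniformly positive near \<open>y\<close>, or one coordinate of the curve is bounded by that
    of \<open>y\<close>.\<close>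
  proof (cases "\<exists>w. y1 < P w \<and> y2 < Q w")
    case True
    then obtain w where w: "y1 < P w" "y2 < Q w" by blast
    define \<rho> where "\<rho> = min (P w - y1) (Q w - y2) / 2"
    have \<rho>: "\<rho> > 0" "2 * \<rho> \<le> P w - y1" "2 * \<rho> \<le> Q w - y2" using w by (auto simp: \<rho>_def)
    show ?thesis
    proof (rule exI[of _ "\<rho> * \<rho>"], rule conjI[OF _ exI[of _ w]], goal_cases)
      case 1 show ?case using \<rho> by simp
    next
      case 2 show ?case
      proof (rule exI[of _ \<rho>], intro conjI allI impI)
        show "\<rho> > 0" by fact
        fix s1 s2 u assume s: "\<bar>s1 - y1\<bar> < \<rho>" "\<bar>s2 - y2\<bar> < \<rho>" and u: "w \<le> u"
        have "\<rho> * \<rho> \<le> ccost P Q s1 s2 u" unfolding ccost_def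
          using \<rho> s P_mono[OF u] Q_mono[OF u] by (intro mult_mono) auto
        then show "phiR P Q y1 y2 + \<rho> * \<rho> \<le> ccost P Q s1 s2 u" using phiR_nonpos[OF d] by linarith
      qed
    qed
  next
    case False
    have "(\<forall>u. P u \<le> y1) \<or> (\<forall>u. Q u \<le> y2)"
    proof (rule ccontr)
      assume "\<not> ?thesis"
      then obtain u v where "P u > y1" "Q v > y2" by (auto simp: not_le)
      then have "P (max u v) > y1" "Q (max u v) > y2" using P_mono[of u "max u v"] Q_mono[of v "max u v"] by auto
      with False show False by blast
    qed
    then show ?thesis
    proof
      assume "\<forall>u. P u \<le> y1"
      then show ?thesis using A[OF curve_axioms d ne] by blast
    next
      assume b: "\<forall>u. Q u \<le> y2"
      have "\<exists>\<eta>>0. \<exists>R. \<exists>\<rho>>0. \<forall>s1 s2. phiE Q P s1 s2 > -\<infinity> \<longrightarrow> \<bar>s1 - y2\<bar> < \<rho> \<longrightarrow> \<bar>s2 - y1\<bar> < \<rho> \<longrightarrow>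
        (\<forall>u\<ge>R. phiR Q P y2 y1 + \<eta> \<le> ccost Q P s1 s2 u)"
        by (rule A[OF swap]) (use d ne b in \<open>simp_all add: phiE_swap[of Q P] escape_up_swap[of Q P]\<close>)
      then show ?thesis unfolding phiE_swap[of Q P] phiR_swap[of Q P] ccost_swap[of Q P] by blast
    qed
  qed
qed

lemma dn_far:
  assumes d: "phiE P Q y1 y2 > -\<infinity>" and ne: "\<not> escape_down P Q y1 y2"
  shows "\<exists>\<eta>>0. \<exists>R. \<exists>\<rho>>0. \<forall>s1 s2. phiE P Q s1 s2 > -\<infinity> \<longrightarrow> \<bar>s1 - y1\<bar> < \<rho> \<longrightarrow> \<bar>s2 - y2\<bar> < \<rho> \<longrightarrow>
     (\<forall>u\<le>R. phiR P Q y1 y2 + \<eta> \<le> ccost P Q s1 s2 u)"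
proof -
  interpret n: curve "reflect P" "reflect Q" by (rule neg)
  have d': "phiE (reflect P) (reflect Q) (-y1) (-y2) > -\<infinity>" using d by (simp only: phiE_neg)
  have ne': "\<not> escape_up (reflect P) (reflect Q) (-y1) (-y2)" using ne by (simp add: escape_up_neg)
  obtain \<eta> R \<rho> where h: "\<eta> > 0" "\<rho> > 0"
    "\<And>s1 s2 u. phiE (reflect P) (reflect Q) s1 s2 > -\<infinity> \<Longrightarrow> \<bar>s1 - (-y1)\<bar> < \<rho> \<Longrightarrow> \<bar>s2 - (-y2)\<bar> < \<rho> \<Longrightarrow> u \<ge> R \<Longrightarrow>
       phiR (reflect P) (reflect Q) (-y1) (-y2) + \<eta> \<le> ccost (reflect P) (reflect Q) s1 s2 u"
    using n.up_far[OF d' ne'] by metis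
  have "phiR P Q y1 y2 + \<eta> \<le> ccost P Q s1 s2 u"
    if "phiE P Q s1 s2 > -\<infinity>" "\<bar>s1 - y1\<bar> < \<rho>" "\<bar>s2 - y2\<bar> < \<rho>" "u \<le> -R" for s1 s2 u
    using h(3)[of "-s1" "-s2" "-u"] that unfolding phiE_neg phiR_neg ccost_neg by (simp add: abs_minus_commute)
  then show ?thesis using h(1,2) by (meson minus_le_iff)
qed

lemma well_posed_not_esc: assumes "well_posed P Q y1 y2 U" shows "\<not> escape_up P Q y1 y2" "\<not> escape_down P Q y1 y2"
proof -
  obtain \<eta> where "\<eta> > 0" and h: "\<forall>u. \<bar>u - U\<bar> \<ge> 1 \<longrightarrow> phiR P Q y1 y2 + \<eta> \<le> ccost P Q y1 y2 u"
    using assms unfolding well_posed_def by (meson zero_less_one)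
  have "\<forall>u\<ge>U+1. phiR P Q y1 y2 + \<eta> \<le> ccost P Q y1 y2 u" "\<forall>u\<le>U-1. phiR P Q y1 y2 + \<eta> \<le> ccost P Q y1 y2 u"
    using h by auto
  then show "\<not> escape_up P Q y1 y2" "\<not> escape_down P Q y1 y2"
    unfolding escape_up_def escape_down_def using \<open>\<eta> > 0\<close> by (meson not_le)+
qed

text \<open>\<open>up_far\<close> and \<open>dn_far\<close> confine near-minimizers of neighbouring
  domain points to the window between \<open>R2\<close> and \<open>R1\<close>; there the cost
  depends uniformly on the point, so they are near-minimizers at \<open>y\<close> as well.\<close>

lemma well_posed_stable:
  assumes well_posed: "well_posed P Q y1 y2 U" and "\<delta> > 0"
  shows "\<exists>\<rho>>0. \<forall>s1 s2 u. phiE P Q s1 s2 > -\<infinity> \<longrightarrow> \<bar>s1 - y1\<bar> < \<rho> \<longrightarrow> \<bar>s2 - y2\<bar> < \<rho> \<longrightarrow>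
     ccost P Q s1 s2 u < phiR P Q s1 s2 + \<rho> \<longrightarrow> \<bar>u - U\<bar> < \<delta>"
proof -
  have d: "phiE P Q y1 y2 > -\<infinity>" using well_posed unfolding well_posed_def by simp
  obtain \<eta>1 R1 \<rho>1 where u1: "\<eta>1 > 0" "\<rho>1 > 0" "\<And>s1 s2 u. phiE P Q s1 s2 > -\<infinity> \<Longrightarrow> \<bar>s1 - y1\<bar> < \<rho>1 \<Longrightarrow> \<bar>s2 - y2\<bar> < \<rho>1 \<Longrightarrow>
     u \<ge> R1 \<Longrightarrow> phiR P Q y1 y2 + \<eta>1 \<le> ccost P Q s1 s2 u"
    using up_far[OF d well_posed_not_esc(1)[OF well_posed]] by metis
  obtain \<eta>2 R2 \<rho>2 where u2: "\<eta>2 > 0" "\<rho>2 > 0" "\<And>s1 s2 u. phiE P Q s1 s2 > -\<infinity> \<Longrightarrow> \<bar>s1 - y1\<bar> < \<rho>2 \<Longrightarrow> \<bar>s2 - y2\<bar> < \<rho>2 \<Longrightarrow>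
     u \<le> R2 \<Longrightarrow> phiR P Q y1 y2 + \<eta>2 \<le> ccost P Q s1 s2 u"
    using dn_far[OF d well_posed_not_esc(2)[OF well_posed]] by metis
  obtain \<eta>3 where u3: "\<eta>3 > 0" "\<And>u. \<bar>u - U\<bar> \<ge> \<delta> \<Longrightarrow> phiR P Q y1 y2 + \<eta>3 \<le> ccost P Q y1 y2 u"
    using well_posed \<open>\<delta> > 0\<close> unfolding well_posed_def by meson
  define \<eta> where "\<eta> = min \<eta>1 (min \<eta>2 \<eta>3)"
  have "\<eta> > 0" using u1 u2 u3 by (simp add: \<eta>_def)
  \<comment> \<open>Bounds both coordinate distances to \<open>y\<close> at \<open>U\<close> and, by
    monotonicity, on the whole window between \<open>R2\<close> and \<open>R1\<close>.\<close>
  define C where "C = \<bar>P U - y1\<bar> + \<bar>Q U - y2\<bar> + \<bar>P R1 - y1\<bar> + \<bar>P R2 - y1\<bar> + \<bar>Q R1 - y2\<bar> + \<bar>Q R2 - y2\<bar> + 1"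
  have "C > 0" unfolding C_def by (smt (verit) abs_ge_zero)
  \<comment> \<open>Passing between costs at \<open>s\<close> and \<open>y\<close> loses at most 3/8
    of \<open>\<eta>\<close>, once for \<open>U\<close> and once for \<open>u\<close>; the tolerance
    \<open>\<rho>\<close> adds at most 1/8, which leaves the total below
    \<open>\<eta>\<close>.\<close>
  define \<rho> where "\<rho> = min (min \<rho>1 \<rho>2) (min 1 (\<eta> / (8 * C)))"
  have \<rho>: "\<rho> > 0" "\<rho> \<le> \<rho>1" "\<rho> \<le> \<rho>2" "\<rho> \<le> 1" "C * \<rho> \<le> \<eta> / 8"
  proof -
    show "\<rho> > 0" using u1 u2 \<open>\<eta> > 0\<close> \<open>C > 0\<close> by (simp add: \<rho>_def)
    have "C * \<rho> \<le> C * (\<eta> / (8 * C))" using \<open>C > 0\<close> by (intro mult_left_mono) (auto simp: \<rho>_def)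
    then show "C * \<rho> \<le> \<eta> / 8" using \<open>C > 0\<close> by (simp add: field_simps)
  qed (auto simp: \<rho>_def)
  have "C \<ge> 1" unfolding C_def by (smt (verit) abs_ge_zero)
  then have \<rho>8: "\<rho> \<le> \<eta> / 8" using \<rho>(1,5) by (smt (verit) mult_le_cancel_right1)
  have near: "\<bar>ccost P Q s1 s2 u - ccost P Q y1 y2 u\<bar> \<le> 3 * (C * \<rho>)"
    if s: "\<bar>s1 - y1\<bar> < \<rho>" "\<bar>s2 - y2\<bar> < \<rho>" and "\<bar>P u - y1\<bar> \<le> C" "\<bar>Q u - y2\<bar> \<le> C" for s1 s2 u
  proof -
    have e: "ccost P Q s1 s2 u - ccost P Q y1 y2 u = - (P u - y1) * (s2 - y2) - (Q u - y2) * (s1 - y1) + (s1 - y1) * (s2 - y2)"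
      unfolding ccost_def by (simp add: algebra_simps)
    have "\<bar>(P u - y1) * (s2 - y2)\<bar> \<le> C * \<rho>" unfolding abs_mult using that by (intro mult_mono) auto
    moreover have "\<bar>(Q u - y2) * (s1 - y1)\<bar> \<le> C * \<rho>" unfolding abs_mult using that by (intro mult_mono) auto
    moreover have "\<bar>(s1 - y1) * (s2 - y2)\<bar> \<le> C * \<rho>" unfolding abs_mult using that \<rho>(4) \<open>C \<ge> 1\<close> by (intro mult_mono) auto
    ultimately show ?thesis unfolding e by linarith
  qed
  show ?thesis
  proof (rule exI[of _ \<rho>], intro conjI allI impI)
    show "\<rho> > 0" by fact
    fix s1 s2 u assume ds: "phiE P Q s1 s2 > -\<infinity>" and s: "\<bar>s1 - y1\<bar> < \<rho>" "\<bar>s2 - y2\<bar> < \<rho>"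
      and u: "ccost P Q s1 s2 u < phiR P Q s1 s2 + \<rho>"
    have "ccost P Q s1 s2 U \<le> ccost P Q y1 y2 U + 3 * (C * \<rho>)"
      using near[OF s, of U] unfolding C_def by (smt (verit) abs_ge_zero)
    then have "ccost P Q s1 s2 u < phiR P Q y1 y2 + 4 * (\<eta> / 8)"
      using u phiR_le[OF ds, of U] well_posed \<rho>(5) \<rho>8 unfolding well_posed_def by linarith
    then have lt: "ccost P Q s1 s2 u < phiR P Q y1 y2 + \<eta> / 2" by simp
    have "u < R1" using u1(3)[OF ds, of u] s \<rho> lt \<open>\<eta> > 0\<close> by (smt (verit) \<eta>_def field_sum_of_halves)
    have "R2 < u" using u2(3)[OF ds, of u] s \<rho> lt \<open>\<eta> > 0\<close> by (smt (verit) \<eta>_def field_sum_of_halves)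
    have "P R2 \<le> P u" "P u \<le> P R1" "Q R2 \<le> Q u" "Q u \<le> Q R1"
      using \<open>u < R1\<close> \<open>R2 < u\<close> P_mono Q_mono by auto
    then have "\<bar>P u - y1\<bar> \<le> C" "\<bar>Q u - y2\<bar> \<le> C" unfolding C_def by linarith+
    from near[OF s this] have "ccost P Q y1 y2 u \<le> ccost P Q s1 s2 u + 3 * (\<eta> / 8)" using \<rho>(5) by linarith
    with lt have "ccost P Q y1 y2 u < phiR P Q y1 y2 + \<eta>" using \<open>\<eta> > 0\<close> by linarith
    then show "\<bar>u - U\<bar> < \<delta>" using u3(2)[of u] unfolding \<eta>_def by linarith
  qed
qed

end

section \<open>Maximal monotone sets as curves\<close>

lemma uncountable_ex: "uncountable A \<Longrightarrow> \<exists>x. x \<in> A"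
  by (cases "A = {}") auto

lemma cost_commute: "cost x y = cost y x"
  by (simp add: cost_def algebra_simps)

lemma cost_cases:
  "cost x y \<ge> 0 \<longleftrightarrow> (fst x \<le> fst y \<and> snd x \<le> snd y) \<or> (fst y \<le> fst x \<and> snd y \<le> snd x)"
  unfolding cost_def zero_le_mult_iff by auto

lemma maximal_insert:
  assumes "maximal_monotone G" "\<And>z. z \<in> G \<Longrightarrow> cost x z \<ge> 0"
  shows "x \<in> G"
proof (rule ccontr)
  assume "x \<notin> G"
  have m: "monotone_set G" using assms(1) by (simp add: maximal_monotone_def)
  have "monotone_set (insert x G)"
    unfolding monotone_set_def
  proof (intro ballI)
    fix r s assume "r \<in> insert x G" "s \<in> insert x G"
    moreover have "cost x x = 0" by (simp add: cost_def)
    ultimately show "cost r s \<ge> 0"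
      using assms(2) m cost_commute unfolding monotone_set_def by (metis insertE order_refl)
  qed
  then show False using \<open>x \<notin> G\<close> assms(1) unfolding maximal_monotone_def by blast
qed

text \<open>Minty's surjectivity theorem in one dimension: on the line \<open>x\<^sub>1 + x\<^sub>2 = u\<close>, each point of
  \<open>G\<close> leaves a compact interval of monotonically related points, and these intervals meet pairwise.\<close>

lemma minty_point:
  assumes G: "maximal_monotone G"
  obtains p where "(p, u - p) \<in> G"
proof -
  have m: "monotone_set G" using G by (simp add: maximal_monotone_def)
  have ne: "G \<noteq> {}"
  proof
    assume "G = {}"
    then have "G \<subset> {(0,0)}" "monotone_set {(0,0)}" by (auto simp: monotone_set_def cost_def)
    then show False using G unfolding maximal_monotone_def by blast
  qed
  define L where "L z = min (fst z) (u - snd z)" for z :: pt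
  define R where "R z = max (fst z) (u - snd z)" for z :: pt
  have LR: "L z \<le> R w" if "z \<in> G" "w \<in> G" for z w
  proof -
    have "cost z w \<ge> 0" using m that by (simp add: monotone_set_def)
    then show ?thesis unfolding cost_cases L_def R_def by auto
  qed
  define p where "p = Sup (L ` G)"
  obtain w where "w \<in> G" using ne by blast
  have bdd: "bdd_above (L ` G)" using LR[OF _ \<open>w \<in> G\<close>] by (auto intro!: bdd_aboveI[where M="R w"])
  have "(p, u - p) \<in> G"
  proof (rule maximal_insert[OF G])
    fix z assume z: "z \<in> G"
    have 1: "L z \<le> p" unfolding p_def using z bdd by (simp add: cSUP_upper)
    have 2: "p \<le> R z" unfolding p_def using LR[OF _ z] ne by (intro cSUP_least) auto
    show "cost (p, u - p) z \<ge> 0" using 1 2 unfolding cost_cases L_def R_def by (auto simp: min_def max_def split: if_splits)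
  qed
  then show ?thesis by (rule that)
qed

text \<open>A monotone set is totally ordered by the sum of coordinates, so the point with sum
  \<open>u\<close> given by \<open>minty_point\<close> is unique and moves monotonically with
  \<open>u\<close>.\<close>

lemma maximal_curve:
  assumes G: "maximal_monotone G"
  obtains P Q where "curve P Q" "G = range (\<lambda>u. (P u, Q u))"
proof -
  have m: "monotone_set G" using G by (simp add: maximal_monotone_def)
  have ord: "fst x \<le> fst y \<and> snd x \<le> snd y" if "x \<in> G" "y \<in> G" "fst x + snd x \<le> fst y + snd y" for x y
  proof -
    have "cost x y \<ge> 0" using m that by (simp add: monotone_set_def)
    then show ?thesis using that(3) unfolding cost_cases by auto
  qed
  have "\<forall>u. \<exists>p. (p, u - p) \<in> G" using minty_point[OF G] by metis
  then obtain P where P: "\<And>u. (P u, u - P u) \<in> G" by metis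
  define Q where "Q u = u - P u" for u
  have PQ: "(P u, Q u) \<in> G" for u using P by (simp add: Q_def)
  have "curve P Q"
  proof
    have "P u \<le> P v \<and> Q u \<le> Q v" if "u \<le> v" for u v
      using ord[OF PQ[of u] PQ[of v]] that by (simp add: Q_def)
    then show "mono P" "mono Q" by (auto simp: mono_def)
    show "P u + Q u = u" for u by (simp add: Q_def)
  qed
  moreover have "G = range (\<lambda>u. (P u, Q u))"
  proof
    show "range (\<lambda>u. (P u, Q u)) \<subseteq> G" using PQ by auto
    show "G \<subseteq> range (\<lambda>u. (P u, Q u))"
    proof
      fix x assume x: "x \<in> G"
      let ?u = "fst x + snd x"
      have s: "P ?u + Q ?u = ?u" by (simp add: Q_def)
      have "fst x \<le> P ?u" "P ?u \<le> fst x" using ord[OF x PQ[of ?u]] ord[OF PQ[of ?u] x] s by auto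
      then have "x = (P ?u, Q ?u)" by (auto simp: prod_eq_iff Q_def)
      then show "x \<in> range (\<lambda>u. (P u, Q u))" by blast
    qed
  qed
  ultimately show ?thesis by (rule that)
qed

text \<open>A point has cost minus a square against the curve point with the same coordinate sum, so
  being related to it means coinciding with it. Surjectivity of the sum suffices for this, which
  lets perturbed curves compete in the dual problem.\<close>

lemma range_maximal:
  assumes "mono P" "mono Q" "surj (\<lambda>u::real. P u + Q u :: real)"
  shows "range (\<lambda>u. (P u, Q u)) \<in> MM"
  unfolding MM_def mem_Collect_eq maximal_monotone_def
proof (intro conjI notI)
  have "cost (P u, Q u) (P v, Q v) \<ge> 0" for u v
    using monoD[OF assms(1), of u v] monoD[OF assms(1), of v u] monoD[OF assms(2), of u v] monoD[OF assms(2), of v u]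
    unfolding cost_cases by (cases "u \<le> v") auto
  then show "monotone_set (range (\<lambda>u. (P u, Q u)))" by (auto simp: monotone_set_def)
  assume "\<exists>H. range (\<lambda>u. (P u, Q u)) \<subset> H \<and> monotone_set H"
  then obtain H x where H: "range (\<lambda>u. (P u, Q u)) \<subseteq> H" "monotone_set H" "x \<in> H" "x \<notin> range (\<lambda>u. (P u, Q u))"
    by blast
  obtain u where u: "P u + Q u = fst x + snd x" using surjD[OF assms(3), of "fst x + snd x"] by auto
  have "cost x (P u, Q u) \<ge> 0" using H by (auto simp: monotone_set_def)
  moreover have e: "snd x - Q u = - (fst x - P u)" using u by linarith
  ultimately have "fst x - P u = 0" unfolding cost_def
    by (smt (verit) fst_conv snd_conv mult_eq_0_iff not_real_square_gt_zero mult_minus_right)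
  then have "x = (P u, Q u)" using e by (simp add: prod_eq_iff)
  then show False using H(4) by blast
qed

lemma phiG_range: "phiG (range (\<lambda>u. (P u, Q u))) y = phiE P Q (fst y) (snd y)"
  unfolding phiG_def phiE_def ccost_def cost_def by (simp add: image_image)

lemma phi_real_range: "phi_real (range (\<lambda>u. (P u, Q u))) y = phiR P Q (fst y) (snd y)"
  unfolding phi_real_def phiR_def phiG_range ..

context curve begin

definition "G = range (\<lambda>u. (P u, Q u))"

lemma phi_real_G: "phi_real G = (\<lambda>y. phiR P Q (fst y) (snd y))"
  unfolding G_def phi_real_range[abs_def] ..

lemma dom_G: "dom_phi G = {y. phiE P Q (fst y) (snd y) > -\<infinity>}"
  unfolding dom_phi_def G_def phiG_range ..

lemma mem_G_iff: "y \<in> G \<longleftrightarrow> P (fst y + snd y) = fst y"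
proof
  assume "y \<in> G" then show "P (fst y + snd y) = fst y" using PQ by (auto simp: G_def)
next
  assume a: "P (fst y + snd y) = fst y"
  then have "Q (fst y + snd y) = snd y" using PQ[of "fst y + snd y"] by linarith
  then have "y = (P (fst y + snd y), Q (fst y + snd y))" using a by (simp add: prod_eq_iff)
  then show "y \<in> G" unfolding G_def by blast
qed

lemma E_G_curve: "E_G G = {y. on_segment P Q (fst y) (snd y)}"
proof -
  have E: "y \<in> E_i G i \<longleftrightarrow> y \<in> G \<and> (\<exists>x\<in>G. x \<noteq> y \<and> coord i x = coord i y)" for y i
  proof
    assume "y \<in> E_i G i"
    then obtain a b where "y \<in> G" "a \<in> G" "b \<in> G" "coord i a = coord i y" "coord i b = coord i y" "a \<noteq> b"
      unfolding E_i_def T_set_def E_at_def by auto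
    then show "y \<in> G \<and> (\<exists>x\<in>G. x \<noteq> y \<and> coord i x = coord i y)" by metis
  next
    assume "y \<in> G \<and> (\<exists>x\<in>G. x \<noteq> y \<and> coord i x = coord i y)"
    then obtain x where x: "y \<in> G" "x \<in> G" "x \<noteq> y" "coord i x = coord i y" by blast
    then have "x \<in> E_at G i (coord i y)" "y \<in> E_at G i (coord i y)" by (simp_all add: E_at_def)
    then show "y \<in> E_i G i" unfolding E_i_def T_set_def using x(3) by blast
  qed
  have u: "(P u, Q u) \<noteq> y \<longleftrightarrow> u \<noteq> fst y + snd y" if "y \<in> G" for u y
  proof -
    obtain v where v: "y = (P v, Q v)" using \<open>y \<in> G\<close> by (auto simp: G_def)
    then show ?thesis using PQ[of u] PQ[of v] by auto
  qed
  have G: "(\<exists>x\<in>G. H x) \<longleftrightarrow> (\<exists>u. H (P u, Q u))" for H by (auto simp: G_def)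
  have m: "y \<in> G \<longleftrightarrow> P (fst y + snd y) = fst y \<and> Q (fst y + snd y) = snd y" for y
    using mem_G_iff[of y] PQ[of "fst y + snd y"] by auto
  have "y \<in> E_G G \<longleftrightarrow> on_segment P Q (fst y) (snd y)" for y
  proof (cases "y \<in> G")
    case True
    have "y \<in> E_G G \<longleftrightarrow> (\<exists>u. u \<noteq> fst y + snd y \<and> P u = fst y) \<or> (\<exists>u. u \<noteq> fst y + snd y \<and> Q u = snd y)"
      unfolding E_G_def Un_iff E G u[OF True] by (simp add: True coord_def)
    then show ?thesis using True unfolding on_segment_def m by blast
  next
    case False
    then show ?thesis unfolding E_G_def Un_iff E on_segment_def m by blast
  qed
  then show ?thesis by blast
qed

lemma ccost_shift:
  "ccost P Q (y1 + h1) (y2 + h2) u = ccost P Q y1 y2 u + h1 * (y2 - Q u) + h2 * (y1 - P u) + h1 * h2"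
  unfolding ccost_def by (simp add: algebra_simps)

end

section \<open>Differentiability of the dual function\<close>

context curve begin

text \<open>Envelope argument: testing with the fixed \<open>U\<close> bounds the increment from
  above; near-minimizers at \<open>s\<close>, which stability places within \<open>e / 4\<close> of
  \<open>U\<close>, bound it from below. The gradient is that of the cost in \<open>y\<close> at
  frozen \<open>U\<close>.\<close>

lemma gderiv_well_posed:
  assumes int: "y \<in> interior (dom_phi G)" and well_posed: "well_posed P Q (fst y) (snd y) U"
  shows "GDERIV (phi_real G) y :> (snd y - Q U, fst y - P U)"
  unfolding gderiv_def has_derivative_at_alt phi_real_G
proof (intro conjI allI impI)
  show "bounded_linear (\<lambda>h. inner h (snd y - Q U, fst y - P U))" by (rule bounded_linear_inner_left)
  fix e :: real assume "e > 0"
  obtain \<rho> where "\<rho> > 0" and \<rho>: "\<And>s1 s2 u. phiE P Q s1 s2 > -\<infinity> \<Longrightarrow> \<bar>s1 - fst y\<bar> < \<rho> \<Longrightarrow> \<bar>s2 - snd y\<bar> < \<rho> \<Longrightarrow>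
     ccost P Q s1 s2 u < phiR P Q s1 s2 + \<rho> \<Longrightarrow> \<bar>u - U\<bar> < e / 4"
    using well_posed_stable[OF well_posed, of "e/4"] \<open>e > 0\<close> by auto
  obtain r where "r > 0" and r: "ball y r \<subseteq> dom_phi G" using int by (auto simp: mem_interior)
  define d where "d = min (min \<rho> r) (e / 2)"
  have "d > 0" using \<open>\<rho> > 0\<close> \<open>r > 0\<close> \<open>e > 0\<close> by (simp add: d_def)
  show "\<exists>d>0. \<forall>s. norm (s - y) < d \<longrightarrow> norm (phiR P Q (fst s) (snd s) - phiR P Q (fst y) (snd y) -
     inner (s - y) (snd y - Q U, fst y - P U)) \<le> e * norm (s - y)"
  proof (intro exI[of _ d] conjI allI impI \<open>d > 0\<close>)
    fix s assume s: "norm (s - y) < d"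
    define h1 where "h1 = fst s - fst y" 
    define h2 where "h2 = snd s - snd y" 
    have h: "\<bar>h1\<bar> \<le> norm (s - y)" "\<bar>h2\<bar> \<le> norm (s - y)"
      using norm_fst_le[of "fst (s - y)" "snd (s - y)"] norm_snd_le[of "snd (s - y)" "fst (s - y)"]
      unfolding prod.collapse by (simp_all add: h1_def h2_def)
    have se: "fst s = fst y + h1" "snd s = snd y + h2" by (auto simp: h1_def h2_def)
    have in_eq: "inner (s - y) (snd y - Q U, fst y - P U) = h1 * (snd y - Q U) + h2 * (fst y - P U)"
      by (simp add: inner_prod_def h1_def h2_def)
    have ds: "phiE P Q (fst s) (snd s) > -\<infinity>"
      using r s by (auto simp: d_def dom_G dist_norm norm_minus_commute subset_iff)
    have hh: "\<bar>h1 * h2\<bar> \<le> e / 2 * norm (s - y)"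
      unfolding abs_mult using h s \<open>d > 0\<close> by (intro mult_mono) (auto simp: d_def)
    have U: "ccost P Q (fst y) (snd y) U = phiR P Q (fst y) (snd y)" using well_posed by (simp add: well_posed_def)
    have dy: "phiE P Q (fst y) (snd y) > -\<infinity>" using well_posed by (simp add: well_posed_def)
    have "phiR P Q (fst s) (snd s) \<le> ccost P Q (fst s) (snd s) U" by (rule phiR_le[OF ds])
    also have "\<dots> = phiR P Q (fst y) (snd y) + h1 * (snd y - Q U) + h2 * (fst y - P U) + h1 * h2"
      unfolding se ccost_shift U ..
    finally have up: "phiR P Q (fst s) (snd s) - phiR P Q (fst y) (snd y) - (h1 * (snd y - Q U) + h2 * (fst y - P U)) \<le> e * norm (s - y)"
      using hh \<open>e > 0\<close> by (smt (verit) field_sum_of_halves distrib_right mult_nonneg_nonneg norm_ge_zero)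
    \<comment> \<open>The infimum at \<open>s\<close> may not be attained, hence the slack
      \<open>\<sigma>\<close>, removed at the end.\<close>
    have lo: "phiR P Q (fst s) (snd s) + \<sigma> - phiR P Q (fst y) (snd y) - (h1 * (snd y - Q U) + h2 * (fst y - P U)) \<ge> - (e * norm (s - y))"
      if \<sigma>: "0 < \<sigma>" for \<sigma>
    proof -
      obtain u where u: "ccost P Q (fst s) (snd s) u < phiR P Q (fst s) (snd s) + min \<sigma> \<rho>"
        by (rule phiR_near[OF ds, of "min \<sigma> \<rho>"]) (use \<open>\<rho> > 0\<close> \<sigma> in auto)
      have "\<bar>fst s - fst y\<bar> < \<rho>" "\<bar>snd s - snd y\<bar> < \<rho>" using h s by (auto simp: d_def h1_def h2_def)
      then have uU: "\<bar>u - U\<bar> < e / 4" using \<rho>[OF ds] u by auto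
      have q: "\<bar>h1 * (Q U - Q u)\<bar> \<le> norm (s - y) * (e / 4)" "\<bar>h2 * (P U - P u)\<bar> \<le> norm (s - y) * (e / 4)"
        unfolding abs_mult using h uU Q_lip'[of U u] P_lip'[of U u] by (intro mult_mono; linarith)+
      have "ccost P Q (fst s) (snd s) u = ccost P Q (fst y) (snd y) u + h1 * (snd y - Q u) + h2 * (fst y - P u) + h1 * h2"
        unfolding se ccost_shift ..
      also have "\<dots> = ccost P Q (fst y) (snd y) u + (h1 * (snd y - Q U) + h2 * (fst y - P U)) + h1 * (Q U - Q u) + h2 * (P U - P u) + h1 * h2"
        by (simp add: algebra_simps)
      finally have "phiR P Q (fst s) (snd s) + \<sigma> - phiR P Q (fst y) (snd y) - (h1 * (snd y - Q U) + h2 * (fst y - P U))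
          \<ge> h1 * (Q U - Q u) + h2 * (P U - P u) + h1 * h2"
        using u phiR_le[OF dy, of u] by linarith
      moreover have "norm (s - y) * (e / 4) + norm (s - y) * (e / 4) + e / 2 * norm (s - y) = e * norm (s - y)" by (simp add: algebra_simps)
      ultimately show ?thesis using q hh by linarith
    qed
    have "phiR P Q (fst s) (snd s) - phiR P Q (fst y) (snd y) - (h1 * (snd y - Q U) + h2 * (fst y - P U)) \<ge> - (e * norm (s - y))"
      by (rule field_le_epsilon) (use lo in \<open>fastforce simp: algebra_simps\<close>)
    with up show "norm (phiR P Q (fst s) (snd s) - phiR P Q (fst y) (snd y) -
     inner (s - y) (snd y - Q U, fst y - P U)) \<le> e * norm (s - y)"
      unfolding in_eq by (simp add: abs_le_iff)
  qed
qed

text \<open>Converse to the envelope formula: the cost at a near-minimizer \<open>u\<close> lies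
  above \<open>phiR\<close> near \<open>y\<close> and almost touches it at \<open>y\<close>, so its
  gradient in \<open>y\<close> is close to \<open>w\<close>.\<close>

lemma gderiv_near:
  assumes int: "y \<in> interior (dom_phi G)" and D: "GDERIV (phi_real G) y :> w" and "e > 0"
  shows "\<exists>\<sigma>>0. \<forall>u. ccost P Q (fst y) (snd y) u < phiR P Q (fst y) (snd y) + \<sigma> \<longrightarrow>
     \<bar>snd y - Q u - fst w\<bar> < e \<and> \<bar>fst y - P u - snd w\<bar> < e"
proof -
  have "\<exists>d>0. \<forall>s. norm (s - y) < d \<longrightarrow> norm (phiR P Q (fst s) (snd s) - phiR P Q (fst y) (snd y) -
     inner (s - y) w) \<le> e / 2 * norm (s - y)"
    using D \<open>e > 0\<close> unfolding gderiv_def has_derivative_at_alt phi_real_G by (meson half_gt_zero)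
  then obtain d where "d > 0" and d: "\<And>s. norm (s - y) < d \<Longrightarrow> norm (phiR P Q (fst s) (snd s) - phiR P Q (fst y) (snd y) -
     inner (s - y) w) \<le> e / 2 * norm (s - y)" by blast
  obtain r where "r > 0" and r: "ball y r \<subseteq> dom_phi G" using int by (auto simp: mem_interior)
  define \<tau> where "\<tau> = min d r / 2"
  have \<tau>: "\<tau> > 0" "\<tau> < d" "\<tau> < r" using \<open>d > 0\<close> \<open>r > 0\<close> by (auto simp: \<tau>_def)
  have key: "h1 * (fst w - (snd y - Q u)) + h2 * (snd w - (fst y - P u)) \<le> \<sigma> + h1 * h2 + e / 2 * \<tau>"
    if u: "ccost P Q (fst y) (snd y) u < phiR P Q (fst y) (snd y) + \<sigma>" and n: "norm (h1, h2) = \<tau>" for u h1 h2 \<sigma>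
  proof -
    define s where "s = y + (h1, h2)"
    have sn: "norm (s - y) = \<tau>" using n by (simp add: s_def)
    then have "s \<in> ball y r" using \<tau> by (simp add: dist_norm norm_minus_commute)
    then have ds: "phiE P Q (fst s) (snd s) > -\<infinity>" using r by (auto simp: dom_G)
    have "\<bar>phiR P Q (fst s) (snd s) - phiR P Q (fst y) (snd y) - (h1 * fst w + h2 * snd w)\<bar> \<le> e / 2 * \<tau>"
      using d[of s] sn \<tau> by (simp add: s_def inner_prod_def)
    moreover have "phiR P Q (fst s) (snd s) \<le> ccost P Q (fst y) (snd y) u + h1 * (snd y - Q u) + h2 * (fst y - P u) + h1 * h2"
      using phiR_le[OF ds, of u] by (simp add: s_def ccost_shift)
    ultimately have "h1 * fst w + h2 * snd w - (h1 * (snd y - Q u) + h2 * (fst y - P u)) \<le> \<sigma> + h1 * h2 + e / 2 * \<tau>"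
      using u by linarith
    then show ?thesis by (simp add: algebra_simps)
  qed
  \<comment> \<open>Only axis directions are tested, so that the product \<open>h1 * h2\<close>
    vanishes; the errors \<open>e / 4\<close> and \<open>e / 2\<close> add up to less than
    \<open>e\<close>.\<close>
  have nrm: "norm (\<tau>, 0::real) = \<tau>" "norm (-\<tau>, 0::real) = \<tau>" "norm (0::real, \<tau>) = \<tau>" "norm (0::real, -\<tau>) = \<tau>"
    using \<tau> by (auto simp: norm_Pair)
  show ?thesis
  proof (intro exI[of _ "\<tau> * (e / 4)"] conjI allI impI)
    show "\<tau> * (e / 4) > 0" using \<tau> \<open>e > 0\<close> by simp
    fix u assume u: "ccost P Q (fst y) (snd y) u < phiR P Q (fst y) (snd y) + \<tau> * (e / 4)"
    have b: "\<bar>x\<bar> < e" if "\<tau> * x \<le> \<tau> * (e/4) + e / 2 * \<tau>" "- \<tau> * x \<le> \<tau> * (e/4) + e / 2 * \<tau>" for x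
    proof -
      have "\<tau> * (e/4) + e / 2 * \<tau> = \<tau> * (3 / 4 * e)" by (simp add: algebra_simps)
      then have "\<tau> * x \<le> \<tau> * (3 / 4 * e)" "\<tau> * (- x) \<le> \<tau> * (3 / 4 * e)" using that by auto
      then have "x \<le> 3 / 4 * e" "- x \<le> 3 / 4 * e" using \<tau>(1) by (metis mult_le_cancel_left_pos)+
      then show ?thesis using \<open>e > 0\<close> by linarith
    qed
    have "\<bar>fst w - (snd y - Q u)\<bar> < e" by (rule b) (use key[OF u nrm(1)] key[OF u nrm(2)] in auto)
    moreover have "\<bar>snd w - (fst y - P u)\<bar> < e" by (rule b) (use key[OF u nrm(3)] key[OF u nrm(4)] in auto)
    ultimately show "\<bar>snd y - Q u - fst w\<bar> < e" "\<bar>fst y - P u - snd w\<bar> < e" by linarith+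
  qed
qed

section \<open>Points of differentiability near a domain point\<close>

lemma nonconst:
  assumes "phiE P Q y1 y2 > -\<infinity>" "\<not> on_segment P Q y1 y2"
  obtains u v where "P u < P v"
proof (rule ccontr)
  assume "\<not> thesis"
  then have c: "P u = P 0" for u using that by (metis linorder_neqE)
  have "y1 = P 0"
  proof (rule ccontr)
    assume "y1 \<noteq> P 0"
    then consider "y1 - P 0 > 0" | "P 0 - y1 > 0" by linarith
    then show False
    proof cases
      case 1
      obtain u where "y1 - (y1 - P 0) < P u" using dom_upper[OF assms(1) 1] by blast
      then show False using c[of u] by simp
    next
      case 2
      obtain u where "P u < y1 + (P 0 - y1)" using dom_lower[OF assms(1) 2] by blast
      then show False using c[of u] by simp
    qed
  qed
  then have "P (y1 + y2) = y1" "Q (y1 + y2) = y2" "P (y1 + y2 + 1) = y1"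
    using c[of "y1 + y2"] c[of "y1+y2+1"] PQ[of "y1 + y2"] by auto
  then show False using assms(2) unfolding on_segment_def by (metis add_cancel_right_right zero_neq_one)
qed

text \<open>\<open>y\<close> may lie on the boundary of the domain. As \<open>P\<close> is not
  constant, values strictly between two values of \<open>P\<close> still exist arbitrarily close to
  \<open>y1\<close>.\<close>

lemma near_inside:
  assumes d: "phiE P Q y1 y2 > -\<infinity>" and n: "\<not> on_segment P Q y1 y2" and "r > 0"
  obtains a b where "a < b" "\<And>t. t \<in> {a<..<b} \<Longrightarrow> \<bar>t - y1\<bar> < r \<and> (\<exists>u v. P u < t \<and> t < P v)"
proof -
  obtain u v where uv: "P u < P v" using nonconst[OF d n] .
  obtain u' where u': "P u' < y1 + r" using dom_lower[OF d \<open>r > 0\<close>] by blast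
  obtain v' where v': "P v' > y1 - r" using dom_upper[OF d \<open>r > 0\<close>] by blast
  define w1 where "w1 = min u u'" define w2 where "w2 = max v v'"
  have w: "P w1 \<le> P u" "P w1 \<le> P u'" "P v \<le> P w2" "P v' \<le> P w2"
    by (auto simp: w1_def w2_def intro: P_mono)
  show ?thesis
  proof (rule that[of "max (P w1) (y1 - r)" "min (P w2) (y1 + r)"])
    show "max (P w1) (y1 - r) < min (P w2) (y1 + r)" using uv u' v' w \<open>r > 0\<close> by auto
    show "\<bar>t - y1\<bar> < r \<and> (\<exists>u v. P u < t \<and> t < P v)" if "t \<in> {max (P w1) (y1 - r)<..<min (P w2) (y1 + r)}" for t
      using that by auto
  qed
qed

text \<open>A value taken twice is taken on an interval and hence at a rational parameter: the
  positions of vertical segments are countable.\<close>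

lemma rat_level:
  assumes "P u = t" "P v = t" "u \<noteq> v" shows "t \<in> range (\<lambda>q::rat. P (of_rat q))"
proof -
  have *: "t \<in> range (\<lambda>q::rat. P (of_rat q))" if "P u = t" "P v = t" "u < v" for u v
  proof -
    obtain q where "u < of_rat q" "of_rat q < v" using of_rat_dense[OF \<open>u < v\<close>] by blast
    then have "P (of_rat q) = t" using P_mono[of u "of_rat q"] P_mono[of "of_rat q" v] that by simp
    then show ?thesis by blast
  qed
  show ?thesis using *[of u v] *[of v u] assms by (cases "u < v") auto
qed

end

text \<open>Generic choice: \<open>t\<close> avoids the countably many positions of vertical
  segments, then \<open>s\<close> avoids those of horizontal segments and the countably many double
  minimizers over \<open>t\<close>. The point lies in an open box of the domain, so its minimization
  is well posed.\<close>

lemma (in curve) diff_dense: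
  assumes d: "phiE P Q y1 y2 > -\<infinity>" and n: "\<not> on_segment P Q y1 y2" and "r > 0"
  obtains s where "s \<in> diff_pts G" "\<bar>fst s - y1\<bar> < r" "\<bar>snd s - y2\<bar> < r"
proof -
  interpret sw: curve Q P by (rule swap)
  obtain a b where "a < b" and ab: "\<And>t. t \<in> {a<..<b} \<Longrightarrow> \<bar>t - y1\<bar> < r \<and> (\<exists>u v. P u < t \<and> t < P v)"
    using near_inside[OF d n \<open>r > 0\<close>] by blast
  have "uncountable ({a<..<b} - range (\<lambda>q::rat. P (of_rat q)))"
    using \<open>a < b\<close> by (intro uncountable_minus_countable) (auto simp: uncountable_open_interval)
  then obtain t where t: "t \<in> {a<..<b}" "t \<notin> range (\<lambda>q::rat. P (of_rat q))"
    using uncountable_ex by fast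
  have d': "phiE Q P y2 y1 > -\<infinity>" and n': "\<not> on_segment Q P y2 y1" using d n by (simp_all add: phiE_swap[of Q P] on_segment_swap[of Q P])
  obtain a' b' where "a' < b'" and ab': "\<And>t. t \<in> {a'<..<b'} \<Longrightarrow> \<bar>t - y2\<bar> < r \<and> (\<exists>u v. Q u < t \<and> t < Q v)"
    using sw.near_inside[OF d' n' \<open>r > 0\<close>] by blast
  have "uncountable ({a'<..<b'} - (range (\<lambda>q::rat. Q (of_rat q)) \<union> {s. multi_argmin P Q (t, s)}))"
    using \<open>a' < b'\<close> multi_argmin_vertical_countable by (intro uncountable_minus_countable) (auto simp: uncountable_open_interval)
  then obtain s where s: "s \<in> {a'<..<b'}" "s \<notin> range (\<lambda>q::rat. Q (of_rat q))" "\<not> multi_argmin P Q (t, s)"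
    using uncountable_ex by fast
  obtain u0 u1 where u: "P u0 < t" "t < P u1" using ab[OF t(1)] by blast
  obtain v0 v1 where v: "Q v0 < s" "s < Q v1" using ab'[OF s(1)] by blast
  note bx = box_dom[OF u v]
  have nE: "\<not> on_segment P Q t s" using rat_level[of _ t "t+s"] sw.rat_level[of _ s "t+s"] t(2) s(2) unfolding on_segment_def by metis
  obtain U where U: "ccost P Q t s U = phiR P Q t s" using no_escape_attained[OF bx] by blast
  have well_posed: "well_posed P Q t s U"
  proof (rule well_posed_I[OF bx U])
    fix u assume "ccost P Q t s u = phiR P Q t s"
    then show "u = U" using s(3) U nE bx(1) unfolding multi_argmin_def by (metis fst_conv linorder_neqE snd_conv)
  qed
  have "(t, s) \<in> interior (dom_phi G)"
  proof (rule interiorI)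
    show "open ({P u0<..<P u1} \<times> {Q v0<..<Q v1})" by (intro open_Times) auto
    show "(t, s) \<in> {P u0<..<P u1} \<times> {Q v0<..<Q v1}" using u v by auto
    show "{P u0<..<P u1} \<times> {Q v0<..<Q v1} \<subseteq> dom_phi G" using box_dom(1) by (auto simp: dom_G)
  qed
  then have "(t, s) \<in> diff_pts G" using gderiv_well_posed[of "(t,s)" U] well_posed unfolding diff_pts_def by auto
  then show ?thesis using that ab[OF t(1)] ab'[OF s(1)] by force
qed

text \<open>On the boundary, the clause \<open>y \<in> closure (diff_pts G)\<close> in
  \<open>grad_at\<close> provides a sequence whose gradients must converge to both candidates. This
  makes the description operator in \<open>grad_phi\<close> meaningful.\<close>

lemma grad_at_unique:
  assumes "grad_at G y v" "grad_at G y w" shows "v = w"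
proof (cases "y \<in> interior (dom_phi G)")
  case True
  then have "y \<notin> rel_frontier (dom_phi G)"
    using interior_subset_rel_interior unfolding rel_frontier_def by blast
  then have "GDERIV (phi_real G) y :> v" "GDERIV (phi_real G) y :> w" using assms unfolding grad_at_def by auto
  then have "(\<lambda>h. inner h v) = (\<lambda>h. inner h w)" unfolding gderiv_def by (rule has_derivative_unique)
  then have "inner (v - w) v = inner (v - w) w" by meson
  then have "inner (v - w) (v - w) = 0" by (simp add: inner_diff_right)
  then show ?thesis by simp
next
  case False
  then have c: "y \<in> closure (diff_pts G)" using assms(1) unfolding grad_at_def by blast
  then obtain s where s: "\<And>n. s n \<in> diff_pts G" "s \<longlonglongrightarrow> y" unfolding closure_sequential by blast
  have "\<exists>w. s n \<in> interior (dom_phi G) \<and> GDERIV (phi_real G) (s n) :> w" for n using s(1)[of n] unfolding diff_pts_def by blast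
  then obtain g where g: "\<And>n. s n \<in> interior (dom_phi G) \<and> GDERIV (phi_real G) (s n) :> g n" by metis
  have "g \<longlonglongrightarrow> v" "g \<longlonglongrightarrow> w" using assms False g s(2) unfolding grad_at_def by blast+
  then show ?thesis by (rule LIMSEQ_unique)
qed

text \<open>On the boundary, the gradient at a nearby interior point is read off from a
  near-minimizer there (\<open>gderiv_near\<close>), and these near-minimizers converge to
  \<open>U\<close> by \<open>well_posed_stable\<close>.\<close>

lemma (in curve) well_posed_grad_at:
  assumes well_posed: "well_posed P Q (fst y) (snd y) U" and n: "\<not> on_segment P Q (fst y) (snd y)"
  shows "grad_at G y (snd y - Q U, fst y - P U)"
proof (cases "y \<in> interior (dom_phi G)")
  case True then show ?thesis using gderiv_well_posed[OF True well_posed] unfolding grad_at_def by blast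
next
  case False
  have d: "phiE P Q (fst y) (snd y) > -\<infinity>" using well_posed by (simp add: well_posed_def)
  have yd: "y \<in> dom_phi G" using d by (simp add: dom_G)
  have cl: "y \<in> closure (diff_pts G)"
    unfolding closure_approachable
  proof (intro allI impI)
    fix e :: real assume "e > 0"
    then obtain s where s: "s \<in> diff_pts G" "\<bar>fst s - fst y\<bar> < e / 2" "\<bar>snd s - snd y\<bar> < e / 2"
      using diff_dense[OF d n, of "e/2"] by auto
    have "dist s y \<le> \<bar>fst s - fst y\<bar> + \<bar>snd s - snd y\<bar>"
      unfolding dist_prod_def dist_real_def by (rule order_trans[OF sqrt_sum_squares_le_sum_abs]) simp
    then show "\<exists>s\<in>diff_pts G. dist s y < e" using s by (intro bexI[of _ s]) auto
  qed
  then have "interior (dom_phi G) \<noteq> {}" unfolding diff_pts_def by auto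
  \<comment> \<open>After subtraction of the product \<open>k\<close>, the dual function is an
    infimum of affine functions of the point, hence concave with convex domain.\<close>
  moreover have "convex (dom_phi G)"
  proof (rule convexI)
    fix x z :: pt and a b :: real assume x: "x \<in> dom_phi G" and z: "z \<in> dom_phi G" and ab: "0 \<le> a" "0 \<le> b" "a + b = 1"
    define k where "k s = fst s * snd s" for s :: pt
    define m where "m = a * (phiR P Q (fst x) (snd x) - k x) + b * (phiR P Q (fst z) (snd z) - k z)"
    have "m + k (a *\<^sub>R x + b *\<^sub>R z) \<le> ccost P Q (fst (a *\<^sub>R x + b *\<^sub>R z)) (snd (a *\<^sub>R x + b *\<^sub>R z)) u" for u
    proof -
      have "a * (phiR P Q (fst x) (snd x) - k x) \<le> a * (ccost P Q (fst x) (snd x) u - k x)"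
        using x ab phiR_le[of P Q "fst x" "snd x" u] by (intro mult_left_mono) (auto simp: dom_G)
      moreover have "b * (phiR P Q (fst z) (snd z) - k z) \<le> b * (ccost P Q (fst z) (snd z) u - k z)"
        using z ab phiR_le[of P Q "fst z" "snd z" u] by (intro mult_left_mono) (auto simp: dom_G)
      moreover have "ccost P Q (fst s) (snd s) u - k s = P u * Q u - P u * snd s - Q u * fst s" for s
        unfolding ccost_def k_def by (simp add: algebra_simps)
      moreover have "a * (P u * Q u - P u * snd x - Q u * fst x) + b * (P u * Q u - P u * snd z - Q u * fst z) =
         (a + b) * (P u * Q u) - P u * snd (a *\<^sub>R x + b *\<^sub>R z) - Q u * fst (a *\<^sub>R x + b *\<^sub>R z)"
        by (simp add: algebra_simps)
      ultimately show ?thesis using ab(3) unfolding m_def by (smt (verit) mult_cancel_right1)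
    qed
    then show "a *\<^sub>R x + b *\<^sub>R z \<in> dom_phi G" unfolding dom_G using phiE_gt_MInf_I by blast
  qed
  ultimately have "rel_interior (dom_phi G) = interior (dom_phi G)" by (simp add: rel_interior_nonempty_interior)
  then have fr: "y \<in> rel_frontier (dom_phi G)"
    using False yd closure_subset unfolding rel_frontier_def by blast
  have "w \<longlonglongrightarrow> (snd y - Q U, fst y - P U)"
    if g: "\<forall>n. s n \<in> interior (dom_phi G) \<and> GDERIV (phi_real G) (s n) :> w n" and s: "s \<longlonglongrightarrow> y" for s w
  proof -
    have "\<exists>u. ccost P Q (fst (s n)) (snd (s n)) u < phiR P Q (fst (s n)) (snd (s n)) + 1 / (real n + 1) \<and>
       \<bar>snd (s n) - Q u - fst (w n)\<bar> < 1 / (real n + 1) \<and> \<bar>fst (s n) - P u - snd (w n)\<bar> < 1 / (real n + 1)" for n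
    proof -
      have ds: "phiE P Q (fst (s n)) (snd (s n)) > -\<infinity>" using g interior_subset by (fastforce simp: dom_G)
      obtain \<sigma> where \<sigma>: "\<sigma> > 0" "\<forall>u. ccost P Q (fst (s n)) (snd (s n)) u < phiR P Q (fst (s n)) (snd (s n)) + \<sigma> \<longrightarrow>
        \<bar>snd (s n) - Q u - fst (w n)\<bar> < 1 / (real n + 1) \<and> \<bar>fst (s n) - P u - snd (w n)\<bar> < 1 / (real n + 1)"
        using gderiv_near[of "s n" "w n" "1 / (real n + 1)"] g by auto
      obtain u where "ccost P Q (fst (s n)) (snd (s n)) u < phiR P Q (fst (s n)) (snd (s n)) + min \<sigma> (1 / (real n + 1))"
        by (rule phiR_near[OF ds, of "min \<sigma> (1 / (real n + 1))"]) (use \<sigma>(1) in auto)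
      then show ?thesis using \<sigma>(2) by (intro exI[of _ u]) auto
    qed
    then obtain u where u: "\<And>n. ccost P Q (fst (s n)) (snd (s n)) (u n) < phiR P Q (fst (s n)) (snd (s n)) + 1 / (real n + 1)"
      "\<And>n. \<bar>snd (s n) - Q (u n) - fst (w n)\<bar> < 1 / (real n + 1)" "\<And>n. \<bar>fst (s n) - P (u n) - snd (w n)\<bar> < 1 / (real n + 1)"
      by metis
    have inv0: "(\<lambda>n. 1 / (real n + 1)) \<longlonglongrightarrow> 0" using LIMSEQ_inverse_real_of_nat by (simp add: inverse_eq_divide add.commute)
    have s1: "(\<lambda>n. fst (s n)) \<longlonglongrightarrow> fst y" and s2: "(\<lambda>n. snd (s n)) \<longlonglongrightarrow> snd y" using s by (auto intro: tendsto_intros)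
    have "u \<longlonglongrightarrow> U"
    proof (rule LIMSEQ_I)
      fix \<delta> :: real assume "\<delta> > 0"
      obtain \<rho> where "\<rho> > 0" and \<rho>: "\<And>s1 s2 u. phiE P Q s1 s2 > -\<infinity> \<Longrightarrow> \<bar>s1 - fst y\<bar> < \<rho> \<Longrightarrow> \<bar>s2 - snd y\<bar> < \<rho> \<Longrightarrow>
        ccost P Q s1 s2 u < phiR P Q s1 s2 + \<rho> \<Longrightarrow> \<bar>u - U\<bar> < \<delta>"
        using well_posed_stable[OF well_posed \<open>\<delta> > 0\<close>] by metis
      have "\<forall>\<^sub>F n in sequentially. \<bar>fst (s n) - fst y\<bar> < \<rho>" using tendstoD[OF s1 \<open>\<rho> > 0\<close>] by (simp add: dist_real_def)
      moreover have "\<forall>\<^sub>F n in sequentially. \<bar>snd (s n) - snd y\<bar> < \<rho>" using tendstoD[OF s2 \<open>\<rho> > 0\<close>] by (simp add: dist_real_def)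
      moreover have "\<forall>\<^sub>F n in sequentially. 1 / (real n + 1) < \<rho>" using order_tendstoD(2)[OF inv0 \<open>\<rho> > 0\<close>] .
      ultimately have "\<forall>\<^sub>F n in sequentially. norm (u n - U) < \<delta>"
      proof eventually_elim
        case (elim n)
        have ds: "phiE P Q (fst (s n)) (snd (s n)) > -\<infinity>" using g interior_subset by (fastforce simp: dom_G)
        show ?case using \<rho>[OF ds elim(1,2), of "u n"] u(1)[of n] elim(3) by simp
      qed
      then show "\<exists>no. \<forall>n\<ge>no. norm (u n - U) < \<delta>" by (simp add: eventually_sequentially)
    qed
    have Pu: "(\<lambda>n. P (u n)) \<longlonglongrightarrow> P U" and Qu: "(\<lambda>n. Q (u n)) \<longlonglongrightarrow> Q U"
      using P_cont[of UNIV] Q_cont[of UNIV] \<open>u \<longlonglongrightarrow> U\<close>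
      by (auto intro: continuous_on_tendsto_compose[where s=UNIV])
    have "(\<lambda>n. snd (s n) - Q (u n) - fst (w n)) \<longlonglongrightarrow> 0"
      by (rule tendsto_rabs_zero_cancel, rule tendsto_sandwich[OF _ _ tendsto_const inv0]) (use u(2) in \<open>auto intro!: always_eventually less_imp_le\<close>)
    then have "(\<lambda>n. snd (s n) - Q (u n) - (snd (s n) - Q (u n) - fst (w n))) \<longlonglongrightarrow> snd y - Q U - 0"
      by (intro tendsto_intros s2 Qu)
    then have w1: "(\<lambda>n. fst (w n)) \<longlonglongrightarrow> snd y - Q U" by simp
    have "(\<lambda>n. fst (s n) - P (u n) - snd (w n)) \<longlonglongrightarrow> 0"
      by (rule tendsto_rabs_zero_cancel, rule tendsto_sandwich[OF _ _ tendsto_const inv0]) (use u(3) in \<open>auto intro!: always_eventually less_imp_le\<close>)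
    then have "(\<lambda>n. fst (s n) - P (u n) - (fst (s n) - P (u n) - snd (w n))) \<longlonglongrightarrow> fst y - P U - 0"
      by (intro tendsto_intros s1 Pu)
    then have w2: "(\<lambda>n. snd (w n)) \<longlonglongrightarrow> fst y - P U" by simp
    show ?thesis using tendsto_Pair[OF w1 w2] by simp
  qed
  then show ?thesis unfolding grad_at_def using yd fr cl by blast
qed

lemma (in curve) well_posed_Dc:
  assumes "well_posed P Q (fst y) (snd y) U" "\<not> on_segment P Q (fst y) (snd y)"
  shows "y \<in> dom_grad G" "Dc_phi G y = (P U, Q U)"
proof -
  note g = well_posed_grad_at[OF assms]
  have "y \<in> dom_phi G" using assms(1) by (simp add: well_posed_def dom_G)
  then show "y \<in> dom_grad G" unfolding dom_grad_def using g by blast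
  have "grad_phi G y = (snd y - Q U, fst y - P U)" unfolding grad_phi_def
    using g grad_at_unique by (intro the_equality)
  then show "Dc_phi G y = (P U, Q U)" by (simp add: Dc_phi_def)
qed

section \<open>First-order optimality of the dual maximizer\<close>

lemma phiE_rat:
  assumes "continuous_on UNIV P" "continuous_on UNIV Q"
  shows "phiE P Q y1 y2 = (INF q::rat. ereal (ccost P Q y1 y2 (of_rat q)))"
proof (rule antisym)
  show "phiE P Q y1 y2 \<le> (INF q::rat. ereal (ccost P Q y1 y2 (of_rat q)))"
    unfolding phiE_def by (intro INF_greatest INF_lower) simp
  have c: "continuous_on UNIV (ccost P Q y1 y2)" unfolding ccost_def by (intro continuous_intros assms)
  show "(INF q::rat. ereal (ccost P Q y1 y2 (of_rat q))) \<le> phiE P Q y1 y2"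
    unfolding phiE_def
  proof (rule INF_greatest, rule ereal_le_epsilon2)
    fix u :: real and e :: real assume "0 < e"
    have "isCont (ccost P Q y1 y2) u" using c by (simp add: continuous_on_eq_continuous_at)
    then obtain d where "d > 0" and d: "\<And>v. dist v u < d \<Longrightarrow> dist (ccost P Q y1 y2 v) (ccost P Q y1 y2 u) < e"
      using \<open>0 < e\<close> unfolding continuous_at_eps_delta by blast
    obtain q where q: "u < of_rat q" "of_rat q < u + d" using of_rat_dense[of u "u+d"] \<open>d > 0\<close> by auto
    then have "ccost P Q y1 y2 (of_rat q) \<le> ccost P Q y1 y2 u + e" using d[of "of_rat q"] by (auto simp: dist_real_def)
    then have "ereal (ccost P Q y1 y2 (of_rat q)) \<le> ereal (ccost P Q y1 y2 u) + ereal e" by simp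
    then show "(INF q::rat. ereal (ccost P Q y1 y2 (of_rat q))) \<le> ereal (ccost P Q y1 y2 u) + ereal e"
      by (rule INF_lower2[rotated]) simp
  qed
qed

lemma phiE_measurable:
  assumes "continuous_on UNIV P" "continuous_on UNIV Q"
    and [measurable]: "f \<in> borel_measurable N" "g \<in> borel_measurable N"
  shows "(\<lambda>w. phiE P Q (f w) (g w)) \<in> borel_measurable N"
  unfolding phiE_rat[OF assms(1,2)] ccost_def by measurable

lemma phiR_measurable:
  assumes "continuous_on UNIV P" "continuous_on UNIV Q" "f \<in> borel_measurable N" "g \<in> borel_measurable N"
  shows "(\<lambda>w. phiR P Q (f w) (g w)) \<in> borel_measurable N"
  unfolding phiR_def using phiE_measurable[OF assms] by measurable

text \<open>The dual problem seen through two real variables, so that exchange of coordinates and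
  reflection give instances again. Competitors need only \<open>P' + Q'\<close> onto, since a
  perturbation destroys the normalization; \<open>atomless\<close> is what
  \<open>no_escape_bdd\<close> draws from D-regularity.\<close>

locale dual_max = curve P Q + prob_space N for P Q and N :: "'a measure" +
  fixes Y1 Y2 :: "'a \<Rightarrow> real"
  assumes Y1[measurable]: "Y1 \<in> borel_measurable N" and Y2[measurable]: "Y2 \<in> borel_measurable N"
    and sq1: "integrable N (\<lambda>w. (Y1 w)\<^sup>2)" and sq2: "integrable N (\<lambda>w. (Y2 w)\<^sup>2)"
    and dom: "AE w in N. phiE P Q (Y1 w) (Y2 w) > -\<infinity>"
    and intph: "integrable N (\<lambda>w. phiR P Q (Y1 w) (Y2 w))"
    and dual_max: "\<And>P' Q'. mono P' \<Longrightarrow> mono Q' \<Longrightarrow> surj (\<lambda>u. P' u + Q' u) \<Longrightarrow>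
       AE w in N. phiE P' Q' (Y1 w) (Y2 w) > -\<infinity> \<Longrightarrow> integrable N (\<lambda>w. phiR P' Q' (Y1 w) (Y2 w)) \<Longrightarrow>
       (\<integral>w. phiR P' Q' (Y1 w) (Y2 w) \<partial>N) \<le> (\<integral>w. phiR P Q (Y1 w) (Y2 w) \<partial>N)"
    and atomless: "\<And>p q. AE w in N. \<not> (Y1 w = p \<and> Y2 w = q)"
begin

lemma dual_max_swap: "dual_max Q P N Y2 Y1"
proof -
  interpret sw: curve Q P by (rule swap)
  show ?thesis
  proof
    show "AE w in N. phiE Q P (Y2 w) (Y1 w) > -\<infinity>" using dom by (simp add: phiE_swap[of Q P])
    show "integrable N (\<lambda>w. phiR Q P (Y2 w) (Y1 w))" using intph by (simp add: phiR_swap[of Q P])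
    show "AE w in N. \<not> (Y2 w = p \<and> Y1 w = q)" for p q using atomless[of q p] by (simp add: conj_commute)
    fix P' Q' :: "real \<Rightarrow> real"
    assume "mono P'" "mono Q'" "surj (\<lambda>u. P' u + Q' u)" "AE w in N. phiE P' Q' (Y2 w) (Y1 w) > -\<infinity>"
      "integrable N (\<lambda>w. phiR P' Q' (Y2 w) (Y1 w))"
    then show "(\<integral>w. phiR P' Q' (Y2 w) (Y1 w) \<partial>N) \<le> (\<integral>w. phiR Q P (Y2 w) (Y1 w) \<partial>N)"
      unfolding phiR_swap[of P' Q'] phiE_swap[of P' Q'] phiR_swap[of Q P]
      by (intro dual_max) (simp_all add: add.commute)
  qed (use sq1 sq2 in auto)
qed

lemma dual_max_neg: "dual_max (reflect P) (reflect Q) N (\<lambda>w. - Y1 w) (\<lambda>w. - Y2 w)"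
proof -
  interpret n: curve "reflect P" "reflect Q" by (rule neg)
  show ?thesis
  proof
    show "AE w in N. phiE (reflect P) (reflect Q) (- Y1 w) (- Y2 w) > -\<infinity>" using dom by (simp add: phiE_neg)
    show "integrable N (\<lambda>w. phiR (reflect P) (reflect Q) (- Y1 w) (- Y2 w))" using intph by (simp add: phiR_neg)
    show "AE w in N. \<not> (- Y1 w = p \<and> - Y2 w = q)" for p q
      using atomless[of "-p" "-q"] by eventually_elim auto
    fix P' Q' :: "real \<Rightarrow> real"
    assume m: "mono P'" "mono Q'" and s: "surj (\<lambda>u. P' u + Q' u)"
      and d: "AE w in N. phiE P' Q' (- Y1 w) (- Y2 w) > -\<infinity>" "integrable N (\<lambda>w. phiR P' Q' (- Y1 w) (- Y2 w))"
    have e1: "phiE P' Q' (- y1) (- y2) = phiE (reflect P') (reflect Q') y1 y2" for y1 y2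
      using phiE_neg[of P' Q' "-y1" "-y2"] by simp
    have e2: "phiR P' Q' (- y1) (- y2) = phiR (reflect P') (reflect Q') y1 y2" for y1 y2
      using phiR_neg[of P' Q' "-y1" "-y2"] by simp
    have "surj (\<lambda>u. reflect P' u + reflect Q' u)"
      unfolding surj_def
    proof
      fix x obtain u where "P' u + Q' u = - x" using surjD[OF s, of "-x"] by metis
      then show "\<exists>u. x = reflect P' u + reflect Q' u" by (intro exI[of _ "-u"]) (simp add: reflect_def)
    qed
    moreover have "mono (reflect P')" "mono (reflect Q')" using m by (auto simp: reflect_def mono_def)
    ultimately show "(\<integral>w. phiR P' Q' (- Y1 w) (- Y2 w) \<partial>N) \<le> (\<integral>w. phiR (reflect P) (reflect Q) (- Y1 w) (- Y2 w) \<partial>N)"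
      using d unfolding e1 e2 phiR_neg by (intro dual_max)
  qed (use sq1 sq2 in auto)
qed

lemma intY2: "integrable N Y2"
  using square_integrable_imp_integrable[OF Y2 sq2] .

text \<open>Fatou applied to the difference quotients along \<open>P + \<epsilon>\<kappa>\<close>. The integrable lower bound
  \<open>- B\<close> is available because \<open>\<kappa>\<close> vanishes far down the curve.\<close>

lemma first_order_condition:
  fixes \<kappa> :: "real \<Rightarrow> real"
  assumes \<kappa>c: "continuous_on UNIV \<kappa>" and \<kappa>0: "\<And>u. 0 \<le> \<kappa> u" and \<kappa>1: "\<And>u. \<kappa> u \<le> 1" and \<kappa>N: "\<And>u. u \<le> N0 \<Longrightarrow> \<kappa> u = 0"
    and \<epsilon>0: "\<epsilon>0 > 0" and m: "\<And>\<epsilon>. 0 \<le> \<epsilon> \<Longrightarrow> \<epsilon> \<le> \<epsilon>0 \<Longrightarrow> mono (\<lambda>u. P u + \<epsilon> * \<kappa> u)"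
  defines "B \<equiv> \<lambda>w. \<bar>Y2 w\<bar> + \<bar>Q N0\<bar>"
  obtains H where "H \<in> borel_measurable N" "(\<integral>\<^sup>+w. H w \<partial>N) \<le> (\<integral>\<^sup>+w. ennreal (B w) \<partial>N)"
    "\<And>w g \<eta>. phiE P Q (Y1 w) (Y2 w) > -\<infinity> \<Longrightarrow> \<eta> > 0 \<Longrightarrow>
       (\<And>u. ccost P Q (Y1 w) (Y2 w) u < phiR P Q (Y1 w) (Y2 w) + \<eta> \<Longrightarrow> g \<le> \<kappa> u * (Q u - Y2 w)) \<Longrightarrow>
       ennreal (g + B w) \<le> H w"
proof -
  define \<epsilon> where "\<epsilon> n = \<epsilon>0 / (real n + 1)" for n
  have \<epsilon>: "\<epsilon> n > 0" "\<epsilon> n \<le> \<epsilon>0" for n using \<epsilon>0 by (auto simp: \<epsilon>_def field_simps)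
  have \<epsilon>lim: "\<epsilon> \<longlonglongrightarrow> 0"
  proof -
    have "(\<lambda>n. \<epsilon>0 * inverse (real (Suc n))) \<longlonglongrightarrow> \<epsilon>0 * 0" by (intro tendsto_intros LIMSEQ_inverse_real_of_nat)
    then show ?thesis by (simp add: \<epsilon>_def[abs_def] inverse_eq_divide add.commute)
  qed
  define Pk where "Pk n = (\<lambda>u. P u + \<epsilon> n * \<kappa> u)" for n
  have Pkc: "continuous_on UNIV (Pk n)" for n unfolding Pk_def by (intro continuous_intros P_cont \<kappa>c)
  have Pkm: "mono (Pk n)" for n unfolding Pk_def using m \<epsilon>[of n] by simp
  \<comment> \<open>The bump moves the coordinate sum by at most \<open>\<epsilon> n\<close>, so the
    intermediate value theorem on an interval of that length below \<open>x\<close> applies.\<close>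
  have Pks: "\<exists>u. Pk n u + Q u = x" for n x
  proof -
    have e: "Pk n u + Q u = u + \<epsilon> n * \<kappa> u" for u using PQ[of u] by (simp add: Pk_def)
    have "\<exists>u. x - \<epsilon> n \<le> u \<and> u \<le> x \<and> u + \<epsilon> n * \<kappa> u = x"
    proof (rule IVT')
      show "x - \<epsilon> n + \<epsilon> n * \<kappa> (x - \<epsilon> n) \<le> x" using \<epsilon>(1)[of n] \<kappa>1[of "x - \<epsilon> n"] mult_left_mono[of "\<kappa> (x - \<epsilon> n)" 1 "\<epsilon> n"] by simp
      show "x \<le> x + \<epsilon> n * \<kappa> x" using \<epsilon>(1)[of n] \<kappa>0[of x] by simp
      show "x - \<epsilon> n \<le> x" using \<epsilon>(1)[of n] by simp
      show "continuous_on {x - \<epsilon> n..x} (\<lambda>u. u + \<epsilon> n * \<kappa> u)"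
        by (intro continuous_intros continuous_on_subset[OF \<kappa>c]) auto
    qed
    then show ?thesis unfolding e by blast
  qed
  have crvk: "ccost (Pk n) Q y1 y2 u = ccost P Q y1 y2 u + \<epsilon> n * (\<kappa> u * (Q u - y2))" for n y1 y2 u
    unfolding ccost_def Pk_def by (simp add: algebra_simps)
  have \<kappa>B: "\<kappa> u * (Q u - Y2 w) \<ge> - B w" for u w
  proof (cases "u \<le> N0")
    case True then show ?thesis using \<kappa>N by (simp add: B_def)
  next
    case False
    then have "Q u - Y2 w \<ge> - B w" using Q_mono[of N0 u] unfolding B_def by linarith
    moreover have "B w \<ge> 0" by (simp add: B_def)
    ultimately show ?thesis using \<kappa>0[of u] \<kappa>1[of u]
      by (smt (verit) mult_left_le_one_le mult_nonneg_nonneg minus_mult_right)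
  qed
  have crvkB: "ccost (Pk n) Q (Y1 w) (Y2 w) u \<ge> ccost P Q (Y1 w) (Y2 w) u - \<epsilon> n * B w" for n w u
    unfolding crvk using mult_left_mono[OF \<kappa>B[of w u], of "\<epsilon> n"] \<epsilon>(1)[of n] by simp
  have dk: "phiE (Pk n) Q (Y1 w) (Y2 w) > -\<infinity>" and phk: "phiR P Q (Y1 w) (Y2 w) - \<epsilon> n * B w \<le> phiR (Pk n) Q (Y1 w) (Y2 w)"
    if "phiE P Q (Y1 w) (Y2 w) > -\<infinity>" for n w
  proof -
    have "phiR P Q (Y1 w) (Y2 w) - \<epsilon> n * B w \<le> ccost (Pk n) Q (Y1 w) (Y2 w) u" for u
      using crvkB[of w u n] phiR_le[OF that, of u] by linarith
    then show "phiE (Pk n) Q (Y1 w) (Y2 w) > -\<infinity>" "phiR P Q (Y1 w) (Y2 w) - \<epsilon> n * B w \<le> phiR (Pk n) Q (Y1 w) (Y2 w)"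
      by (rule phiE_gt_MInf_I, rule phiR_greatest)
  qed
  have phk0: "phiR (Pk n) Q y1 y2 \<le> 0" if "phiE (Pk n) Q y1 y2 > -\<infinity>" for n y1 y2
  proof -
    obtain u where "Pk n u + Q u = y1 + y2" using Pks by blast
    then have e: "Q u - y2 = - (Pk n u - y1)" by linarith
    have "ccost (Pk n) Q y1 y2 u \<le> 0" unfolding ccost_def e mult_minus_right by simp
    then show ?thesis using phiR_le[OF that, of u] by linarith
  qed
  have intB: "integrable N B" unfolding B_def using intY2 by simp
  have mk[measurable]: "(\<lambda>w. phiR (Pk n) Q (Y1 w) (Y2 w)) \<in> borel_measurable N" for n
    by (rule phiR_measurable[OF Pkc Q_cont Y1 Y2])
  have intk: "integrable N (\<lambda>w. phiR (Pk n) Q (Y1 w) (Y2 w))" for n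
  proof (rule Bochner_Integration.integrable_bound)
    show "integrable N (\<lambda>w. \<bar>phiR P Q (Y1 w) (Y2 w)\<bar> + \<epsilon> n * B w)" using intph intB by simp
    show "AE w in N. norm (phiR (Pk n) Q (Y1 w) (Y2 w)) \<le> norm (\<bar>phiR P Q (Y1 w) (Y2 w)\<bar> + \<epsilon> n * B w)"
      using dom
    proof eventually_elim
      case (elim w)
      show ?case using phk[OF elim, of n] phk0[OF dk[OF elim], of n] by simp
    qed
  qed measurable
  have le: "(\<integral>w. phiR (Pk n) Q (Y1 w) (Y2 w) \<partial>N) \<le> (\<integral>w. phiR P Q (Y1 w) (Y2 w) \<partial>N)" for n
  proof (rule dual_max[OF Pkm mQ _ _ intk])
    show "surj (\<lambda>u. Pk n u + Q u)" unfolding surj_def using Pks[of n] by metis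
    show "AE w in N. phiE (Pk n) Q (Y1 w) (Y2 w) > -\<infinity>" using dom by eventually_elim (rule dk)
  qed
  \<comment> \<open>Difference quotient of the dual value, shifted by \<open>B\<close> to be
    nonnegative for Fatou; optimality bounds its integral by that of \<open>B\<close>.\<close>
  define f where "f n w = (phiR (Pk n) Q (Y1 w) (Y2 w) - phiR P Q (Y1 w) (Y2 w)) / \<epsilon> n + B w" for n w
  have intf: "integrable N (f n)" for n unfolding f_def using intk intph intB by simp
  have mf[measurable]: "f n \<in> borel_measurable N" for n using intf by (rule borel_measurable_integrable)
  have f0: "AE w in N. 0 \<le> f n w" for n
    using dom
  proof eventually_elim
    case (elim w)
    have "- (\<epsilon> n * B w) / \<epsilon> n \<le> (phiR (Pk n) Q (Y1 w) (Y2 w) - phiR P Q (Y1 w) (Y2 w)) / \<epsilon> n"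
      using phk[OF elim, of n] \<epsilon>(1)[of n] by (intro divide_right_mono) auto
    then show ?case unfolding f_def using \<epsilon>(1)[of n] by simp
  qed
  have fB: "(\<integral>\<^sup>+w. ennreal (f n w) \<partial>N) \<le> (\<integral>\<^sup>+w. ennreal (B w) \<partial>N)" for n
  proof -
    have "(\<integral>w. f n w \<partial>N) = ((\<integral>w. phiR (Pk n) Q (Y1 w) (Y2 w) \<partial>N) - (\<integral>w. phiR P Q (Y1 w) (Y2 w) \<partial>N)) / \<epsilon> n + (\<integral>w. B w \<partial>N)"
      unfolding f_def using intk intph intB by simp
    also have "\<dots> \<le> (\<integral>w. B w \<partial>N)" using le[of n] \<epsilon>(1)[of n] by (simp add: divide_nonpos_pos)
    finally show ?thesis
      using nn_integral_eq_integral[OF intf f0] nn_integral_eq_integral[OF intB] by (simp add: B_def ennreal_leI)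
  qed
  define H where "H w = liminf (\<lambda>n. ennreal (f n w))" for w
  show ?thesis
  proof (rule that[of H])
    show "H \<in> borel_measurable N" unfolding H_def by measurable
    have "(\<integral>\<^sup>+w. H w \<partial>N) \<le> liminf (\<lambda>n. \<integral>\<^sup>+w. ennreal (f n w) \<partial>N)"
      unfolding H_def by (rule nn_integral_liminf) measurable
    also have "\<dots> \<le> liminf (\<lambda>n::nat. \<integral>\<^sup>+w. ennreal (B w) \<partial>N)" by (intro Liminf_mono always_eventually allI fB)
    also have "\<dots> = (\<integral>\<^sup>+w. ennreal (B w) \<partial>N)" by (simp add: Liminf_const)
    finally show "(\<integral>\<^sup>+w. H w \<partial>N) \<le> (\<integral>\<^sup>+w. ennreal (B w) \<partial>N)" .
    fix w and g \<eta> :: real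
    assume d: "phiE P Q (Y1 w) (Y2 w) > -\<infinity>" and "\<eta> > 0"
      and g: "\<And>u. ccost P Q (Y1 w) (Y2 w) u < phiR P Q (Y1 w) (Y2 w) + \<eta> \<Longrightarrow> g \<le> \<kappa> u * (Q u - Y2 w)"
    obtain v where v: "ccost P Q (Y1 w) (Y2 w) v < phiR P Q (Y1 w) (Y2 w) + \<eta> / 4"
      by (rule phiR_near[OF d, of "\<eta> / 4"]) (use \<open>\<eta> > 0\<close> in auto)
    \<comment> \<open>Once \<open>\<epsilon> n * C < \<eta> / 4\<close>, near-minimizers of the
      perturbed cost are \<open>\<eta>\<close>-minimizers of the original one: the excess at
      \<open>v\<close>, the bump at \<open>v\<close>, and the tolerance together with the lower
      bound \<open>- B\<close> each contribute less than \<open>\<eta> / 4\<close>.\<close>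
    define C where "C = \<bar>\<kappa> v * (Q v - Y2 w)\<bar> + B w + 1"
    have "C > 0" by (simp add: C_def B_def add_nonneg_pos)
    have "\<forall>\<^sub>F n in sequentially. \<epsilon> n < \<eta> / (4 * C)"
      using \<epsilon>lim \<open>\<eta> > 0\<close> \<open>C > 0\<close> by (intro order_tendstoD(2)) auto
    then have "\<forall>\<^sub>F n in sequentially. ennreal (g + B w) \<le> ennreal (f n w)"
    proof eventually_elim
      case (elim n)
      have eC: "\<epsilon> n * C < \<eta> / 4" using elim \<open>C > 0\<close> by (simp add: field_simps)
      have "g + B w \<le> f n w + \<sigma>" if \<sigma>: "0 < \<sigma>" for \<sigma>
      proof -
        define s where "s = min \<sigma> 1"
        obtain u where u: "ccost (Pk n) Q (Y1 w) (Y2 w) u < phiR (Pk n) Q (Y1 w) (Y2 w) + \<epsilon> n * s"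
          by (rule phiR_near[OF dk[OF d, of n], of "\<epsilon> n * s"]) (use \<epsilon>(1)[of n] \<sigma> in \<open>auto simp: s_def\<close>)
        have "phiR (Pk n) Q (Y1 w) (Y2 w) \<le> ccost P Q (Y1 w) (Y2 w) v + \<epsilon> n * (\<kappa> v * (Q v - Y2 w))"
          using phiR_le[OF dk[OF d], of n v] unfolding crvk .
        moreover have "\<epsilon> n * (\<kappa> v * (Q v - Y2 w)) \<le> \<epsilon> n * C"
          using \<epsilon>(1)[of n] unfolding C_def B_def by (intro mult_left_mono) auto
        moreover have "\<epsilon> n * s + \<epsilon> n * B w \<le> \<epsilon> n * C"
        proof -
          have "\<epsilon> n * (s + B w) \<le> \<epsilon> n * C" using \<epsilon>(1)[of n] unfolding C_def s_def by (intro mult_left_mono) auto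
          then show ?thesis by (simp add: algebra_simps)
        qed
        ultimately have "ccost P Q (Y1 w) (Y2 w) u < phiR P Q (Y1 w) (Y2 w) + \<eta>"
          using u crvkB[of w u n] v eC \<open>\<eta> > 0\<close> by linarith
        then have gu: "g \<le> \<kappa> u * (Q u - Y2 w)" by (rule g)
        have "\<epsilon> n * (g - s) \<le> \<epsilon> n * (\<kappa> u * (Q u - Y2 w)) - \<epsilon> n * s"
          using mult_left_mono[OF gu, of "\<epsilon> n"] \<epsilon>(1)[of n] by (simp add: algebra_simps)
        also have "\<dots> \<le> phiR (Pk n) Q (Y1 w) (Y2 w) - phiR P Q (Y1 w) (Y2 w)"
          using u phiR_le[OF d, of u] unfolding crvk by linarith
        finally have "g - s \<le> (phiR (Pk n) Q (Y1 w) (Y2 w) - phiR P Q (Y1 w) (Y2 w)) / \<epsilon> n"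
          using \<epsilon>(1)[of n] by (simp add: field_simps)
        then show ?thesis unfolding f_def s_def by linarith
      qed
      then have "g + B w \<le> f n w" by (rule field_le_epsilon)
      then show ?case by (rule ennreal_leI)
    qed
    then show "ennreal (g + B w) \<le> H w" unfolding H_def by (rule Liminf_bounded)
  qed
qed

end

section \<open>Minimizing sequences do not escape\<close>

context curve begin

text \<open>A point left of \<open>sup P\<close> is strictly dominated by a curve point, which
  excludes escape. If \<open>P\<close> reached \<open>y1\<close>, the cost would vanish far out, so
  \<open>y\<close> would be on the curve together with other points of equal first coordinate, hence
  on a segment.\<close>

lemma esc_facts:
  assumes d: "phiE P Q y1 y2 > -\<infinity>" and n: "\<not> on_segment P Q y1 y2" and e: "escape_up P Q y1 y2" and bdd: "bdd_above (range P)"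
  shows "y1 = (SUP u. P u)" "\<And>u. P u < y1"
proof -
  define b where "b = (SUP u. P u)"
  have Pb: "P u \<le> b" for u unfolding b_def using bdd by (intro cSUP_upper) auto
  have "y1 \<le> b"
  proof (rule ccontr)
    assume "\<not> ?thesis"
    then obtain u where "P u > y1 - (y1 - b)" using dom_upper[OF d, of "y1 - b"] by auto
    then show False using Pb[of u] by simp
  qed
  moreover have "\<not> y1 < b"
  proof
    assume "y1 < b"
    then obtain w0 where w0: "y1 < P w0" unfolding b_def using less_cSUP_iff[OF _ bdd, of y1] by auto
    define w where "w = max w0 (y2 + b + 1)"
    have "y1 < P w" using w0 P_mono[of w0 w] by (simp add: w_def)
    moreover have "y2 < Q w" using PQ[of w] Pb[of w] by (simp add: w_def)
    ultimately show False using inside_up[OF _ _ d] e by blast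
  qed
  ultimately have yb: "y1 = b" by simp
  then show "y1 = (SUP u. P u)" by (simp add: b_def)
  show "P u < y1" for u
  proof (rule ccontr)
    assume "\<not> P u < y1"
    then have c: "P v = y1" if "u \<le> v" for v using P_mono[OF that] Pb[of v] yb by simp
    have "0 \<le> phiR P Q y1 y2 + \<sigma>" if \<sigma>: "0 < \<sigma>" for \<sigma>
    proof -
      obtain v where "v \<ge> u" "ccost P Q y1 y2 v < phiR P Q y1 y2 + \<sigma>" using e \<open>0 < \<sigma>\<close> unfolding escape_up_def by meson
      then show ?thesis using c[of v] by (simp add: ccost_def)
    qed
    then have "0 \<le> phiR P Q y1 y2" by (rule field_le_epsilon)
    then have z: "phiR P Q y1 y2 = 0" using phiR_nonpos[OF d] by simp
    have "P (max u (y1 + y2) + 1) = y1" by (rule c) auto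
    moreover have "max u (y1 + y2) + 1 \<noteq> y1 + y2" by linarith
    ultimately show False using n phiR_zero_on_curve[OF d z] unfolding on_segment_def by blast
  qed
qed

text \<open>On the asymptote the costs for heights \<open>s\<close> and \<open>s'\<close> differ by
  \<open>(P u - b) * (s - s')\<close>, which tends to 0 at the upper end: a sequence escaping for
  one height has the same limit value for any other.\<close>

lemma esc_ph_const:
  assumes d: "phiE P Q b s > -\<infinity>" "phiE P Q b s' > -\<infinity>" and e: "escape_up P Q b s"
    and b: "b = (SUP u. P u)" and bdd: "bdd_above (range P)"
  shows "phiR P Q b s' \<le> phiR P Q b s"
proof (rule field_le_epsilon)
  fix e :: real assume "e > 0"
  have Pb: "P u \<le> b" for u unfolding b using bdd by (intro cSUP_upper) auto
  define h where "h = \<bar>s - s'\<bar> + 1"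
  have "h > 0" by (simp add: h_def add_nonneg_pos)
  have "b - e / (2 * h) < (SUP u. P u)" using b \<open>e > 0\<close> \<open>h > 0\<close> by simp
  then obtain R where R: "b - e / (2 * h) < P R" using less_cSUP_iff[OF _ bdd] by auto
  obtain u where u: "u \<ge> R" "ccost P Q b s u < phiR P Q b s + e / 2" using \<open>e > 0\<close> assms(3) unfolding escape_up_def by (meson half_gt_zero)
  have "\<bar>(P u - b) * (s - s')\<bar> \<le> e / (2 * h) * h"
    unfolding abs_mult using R P_mono[OF u(1)] Pb[of u] \<open>h > 0\<close> by (intro mult_mono) (auto simp: h_def)
  also have "\<dots> = e / 2" using \<open>h > 0\<close> by simp
  finally have "\<bar>(P u - b) * (s - s')\<bar> \<le> e / 2" .
  moreover have "ccost P Q b s' u = ccost P Q b s u + (P u - b) * (s - s')" unfolding ccost_def by (simp add: algebra_simps)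
  ultimately show "phiR P Q b s' \<le> phiR P Q b s + e" using phiR_le[OF d(2), of u] u(2) by linarith
qed

end

text \<open>Lying strictly to the right of the curve, \<open>y\<close> cannot be above any curve
  point if minimizing sequences go down, so its height is \<open>inf Q\<close>. On a vertical
  asymptote this leaves a single exceptional point.\<close>

lemma (in curve) escape_down_point:
  assumes d: "phiE P Q y1 y2 > -\<infinity>" and e: "escape_down P Q y1 y2" and P: "\<And>u. P u < y1"
  shows "y2 = (INF u. Q u)"
proof -
  interpret n: curve "reflect P" "reflect Q" by (rule neg)
  interpret sw: curve Q P by (rule swap)
  have d': "phiE (reflect P) (reflect Q) (-y1) (-y2) > -\<infinity>" using d by (simp only: phiE_neg)
  have e': "escape_up (reflect P) (reflect Q) (-y1) (-y2)" using e by (simp add: escape_up_neg)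
  have Q: "y2 \<le> Q u" for u
  proof (rule ccontr)
    assume "\<not> ?thesis"
    then have "- y1 < reflect P (-u)" "- y2 < reflect Q (-u)" using P[of u] by (auto simp: reflect_def)
    from n.inside_up[OF this d'] e' show False by blast
  qed
  then have bdd: "bdd_below (range Q)" by (intro bdd_belowI[of _ y2]) auto
  have "y2 \<le> (INF u. Q u)" using Q by (intro cINF_greatest) auto
  moreover have "(INF u. Q u) \<le> y2"
  proof (rule field_le_epsilon)
    fix \<sigma> :: real assume "\<sigma> > 0"
    have "phiE Q P y2 y1 > -\<infinity>" using d by (simp add: phiE_swap[of Q P])
    then obtain u where "Q u < y2 + \<sigma>" using sw.dom_lower \<open>\<sigma> > 0\<close> by blast
    then show "(INF u. Q u) \<le> y2 + \<sigma>" using cINF_lower[OF bdd, of u] by auto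
  qed
  ultimately show ?thesis by simp
qed

context dual_max begin

text \<open>Pushing the upper end of the curve outwards would increase the dual value at an infinite rate
  if the minimizing sequences of a non-null set of points escaped along a vertical asymptote.\<close>

lemma no_escape_bdd:
  assumes bdd: "bdd_above (range P)"
  shows "AE w in N. \<not> on_segment P Q (Y1 w) (Y2 w) \<longrightarrow> \<not> escape_up P Q (Y1 w) (Y2 w)"
proof -
  define b where "b = (SUP u. P u)"
  have Pb: "P u \<le> b" for u unfolding b_def using bdd by (intro cSUP_upper) auto
  define V where "V s \<longleftrightarrow> phiE P Q b s > -\<infinity> \<and> \<not> on_segment P Q b s \<and> escape_up P Q b s" for s
  define A where "A s \<longleftrightarrow> V s \<and> (\<exists>u. ccost P Q b s u = phiR P Q b s)" for s
  \<comment> \<open>The lower of two escaping points on the asymptote would undercut the higher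
    one's value at the latter's minimizer, against \<open>esc_ph_const\<close>. So at most one point
    both escapes and attains its minimum, a null event.\<close>
  have A1: False if "A s" "V s'" "s' < s" for s s'
  proof -
    obtain u where u: "ccost P Q b s u = phiR P Q b s" using \<open>A s\<close> by (auto simp: A_def)
    have Vs: "V s" using \<open>A s\<close> by (simp add: A_def)
    have "phiR P Q b s \<le> phiR P Q b s'"
      using esc_ph_const[of b s' s] that(2) Vs bdd by (auto simp: V_def b_def)
    moreover have "ccost P Q b s' u = ccost P Q b s u + (P u - b) * (s - s')" unfolding ccost_def by (simp add: algebra_simps)
    moreover have "P u < b" using esc_facts(2)[of b s u] Vs bdd by (auto simp: V_def)
    then have "(P u - b) * (s - s') < 0" using \<open>s' < s\<close> by (intro mult_neg_pos) auto
    ultimately show False using phiR_le[of P Q b s' u] that(2) u by (auto simp: V_def)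
  qed
  have "\<exists>s0. \<forall>s. A s \<longrightarrow> s = s0"
  proof (cases "\<exists>s. A s")
    case True
    then obtain s0 where "A s0" by blast
    then show ?thesis using A1 unfolding A_def by (metis linorder_neqE)
  qed blast
  then obtain s0 where s0: "\<And>s. A s \<Longrightarrow> s = s0" by blast
  \<comment> \<open>Pushes the upper end to the right; being nondecreasing, it keeps the curve
    monotone for every \<open>\<epsilon> \<ge> 0\<close>.\<close>
  define \<kappa> where "\<kappa> u = max 0 (min 1 u)" for u :: real
  obtain H where H[measurable]: "H \<in> borel_measurable N" and HB: "(\<integral>\<^sup>+w. H w \<partial>N) \<le> (\<integral>\<^sup>+w. ennreal (\<bar>Y2 w\<bar> + \<bar>Q 0\<bar>) \<partial>N)"
    and Hg: "\<And>w g \<eta>. phiE P Q (Y1 w) (Y2 w) > -\<infinity> \<Longrightarrow> \<eta> > 0 \<Longrightarrow>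
       (\<And>u. ccost P Q (Y1 w) (Y2 w) u < phiR P Q (Y1 w) (Y2 w) + \<eta> \<Longrightarrow> g \<le> \<kappa> u * (Q u - Y2 w)) \<Longrightarrow>
       ennreal (g + (\<bar>Y2 w\<bar> + \<bar>Q 0\<bar>)) \<le> H w"
  proof (rule first_order_condition[of \<kappa> 0 1])
    show "continuous_on UNIV \<kappa>" unfolding \<kappa>_def by (intro continuous_intros)
    show "mono (\<lambda>u. P u + \<epsilon> * \<kappa> u)" if "0 \<le> \<epsilon>" for \<epsilon>
      using that by (intro monoI add_mono P_mono mult_left_mono) (auto simp: \<kappa>_def)
  qed (auto simp: \<kappa>_def)
  have "(\<integral>\<^sup>+w. ennreal (\<bar>Y2 w\<bar> + \<bar>Q 0\<bar>) \<partial>N) < \<infinity>"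
    using nn_integral_eq_integral[of N "\<lambda>w. \<bar>Y2 w\<bar> + \<bar>Q 0\<bar>"] intY2 by simp
  then have "(\<integral>\<^sup>+w. H w \<partial>N) \<noteq> \<infinity>" using HB by auto
  from nn_integral_noteq_infinite[OF H this] have "AE w in N. H w \<noteq> \<infinity>" .
  with dom atomless[of b s0] atomless[of b "INF u. Q u"] show ?thesis
  proof eventually_elim
    case (elim w)
    show ?case
    proof (intro impI notI)
      assume nE: "\<not> on_segment P Q (Y1 w) (Y2 w)" and es: "escape_up P Q (Y1 w) (Y2 w)"
      have y: "Y1 w = b" and Plt: "\<And>u. P u < Y1 w" using esc_facts[OF elim(1) nE es bdd] by (auto simp: b_def)
      have na: "ccost P Q (Y1 w) (Y2 w) u \<noteq> phiR P Q (Y1 w) (Y2 w)" for u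
      proof
        assume "ccost P Q (Y1 w) (Y2 w) u = phiR P Q (Y1 w) (Y2 w)"
        then have "A (Y2 w)" unfolding A_def V_def using y nE es elim(1) by auto
        then show False using s0 elim(2) y by blast
      qed
      have nd: "\<not> escape_down P Q (Y1 w) (Y2 w)" using escape_down_point[OF elim(1) _ Plt] elim(3) y by blast
      then obtain R0 e0 where R0: "e0 > 0" "\<And>u. u \<le> R0 \<Longrightarrow> phiR P Q (Y1 w) (Y2 w) + e0 \<le> ccost P Q (Y1 w) (Y2 w) u"
        unfolding escape_down_def by (meson not_le)
      \<comment> \<open>Near-minimizers avoid \<open>{R0..R}\<close> because the minimum is not
        attained, and lie above \<open>R0\<close> because nothing escapes downward. Beyond
        \<open>R\<close> the derivative is at least any given \<open>g\<close>, since
        \<open>Q u = u - P u \<ge> u - b\<close>.\<close>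
      have Hr: "ennreal (g + (\<bar>Y2 w\<bar> + \<bar>Q 0\<bar>)) \<le> H w" for g
      proof -
        define R where "R = max 1 (b + \<bar>g\<bar> + Y2 w)"
        have "\<exists>\<eta>>0. \<forall>u\<in>{R0..R}. phiR P Q (Y1 w) (Y2 w) + \<eta> \<le> ccost P Q (Y1 w) (Y2 w) u"
          using na phiR_le[OF elim(1)] by (intro compact_gap) (auto simp: order_less_le eq_commute)
        then obtain \<eta> where \<eta>: "\<eta> > 0" "\<forall>u\<in>{R0..R}. phiR P Q (Y1 w) (Y2 w) + \<eta> \<le> ccost P Q (Y1 w) (Y2 w) u" by blast
        show ?thesis
        proof (rule Hg[OF elim(1), of "min \<eta> e0"])
          show "min \<eta> e0 > 0" using \<eta> R0 by simp
          fix u assume u: "ccost P Q (Y1 w) (Y2 w) u < phiR P Q (Y1 w) (Y2 w) + min \<eta> e0"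
          have "\<not> u \<le> R0" using R0(2)[of u] u by linarith
          moreover have "u \<notin> {R0..R}" using \<eta>(2) u by force
          ultimately have "R \<le> u" by auto
          then have "\<kappa> u = 1" "g \<le> Q u - Y2 w" using PQ[of u] Pb[of u] by (auto simp: R_def \<kappa>_def)
          then show "g \<le> \<kappa> u * (Q u - Y2 w)" by simp
        qed
      qed
      have "H w = \<infinity>"
      proof (rule ccontr)
        assume "H w \<noteq> \<infinity>"
        then obtain h where h: "h \<ge> 0" "H w = ennreal h" by (cases "H w") auto
        have "ennreal (h + 1) \<le> ennreal h" using Hr[of "h + 1 - (\<bar>Y2 w\<bar> + \<bar>Q 0\<bar>)"] h by simp
        then show False using h(1) by (simp add: ennreal_le_iff)
      qed
      then show False using elim(4) by simp
    qed
  qed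
qed

end

text \<open>With both components unbounded above, every point is strictly dominated by a curve point
  and nothing escapes upward; otherwise \<open>no_escape_bdd\<close> applies to the bounded
  component.\<close>

lemma (in dual_max) no_escape_up:
  "AE w in N. \<not> on_segment P Q (Y1 w) (Y2 w) \<longrightarrow> \<not> escape_up P Q (Y1 w) (Y2 w)"
proof -
  consider "bdd_above (range P)" | "bdd_above (range Q)" | "\<not> bdd_above (range P)" "\<not> bdd_above (range Q)" by argo
  then show ?thesis
  proof cases
    case 1 then show ?thesis by (rule no_escape_bdd)
  next
    case 2
    interpret sw: dual_max Q P N Y2 Y1 by (rule dual_max_swap)
    show ?thesis using sw.no_escape_bdd[OF 2] by (simp add: on_segment_swap[of Q P] escape_up_swap[of Q P])
  next
    case 3
    from dom show ?thesis
    proof eventually_elim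
      case (elim w)
      obtain u v where "Y1 w < P u" "Y2 w < Q v"
        using 3 unfolding bdd_above_def by (metis not_le rangeE)
      then have "Y1 w < P (max u v)" "Y2 w < Q (max u v)"
        using P_mono[of u "max u v"] Q_mono[of v "max u v"] by auto
      then show ?case using inside_up[OF _ _ elim] by blast
    qed
  qed
qed

lemma (in dual_max) no_escape_dn:
  "AE w in N. \<not> on_segment P Q (Y1 w) (Y2 w) \<longrightarrow> \<not> escape_down P Q (Y1 w) (Y2 w)"
proof -
  interpret n: dual_max "reflect P" "reflect Q" N "\<lambda>w. - Y1 w" "\<lambda>w. - Y2 w" by (rule dual_max_neg)
  show ?thesis using n.no_escape_up by (simp add: on_segment_neg escape_up_neg)
qed

section \<open>Off the segments the minimizer has the martingale property\<close>

text \<open>No flat piece of \<open>f\<close> continues to the right of \<open>u\<close>: for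
  \<open>f = P\<close>, no vertical segment goes on upward from that curve point.
  \<open>decr_at\<close> is the downward counterpart.\<close>

definition incr_at :: "(real \<Rightarrow> real) \<Rightarrow> real \<Rightarrow> bool" where
  "incr_at f u \<longleftrightarrow> (\<forall>v>u. f u < f v)"

definition decr_at :: "(real \<Rightarrow> real) \<Rightarrow> real \<Rightarrow> bool" where
  "decr_at f u \<longleftrightarrow> (\<forall>v<u. f v < f u)"

lemma incr_at_refl: "incr_at (reflect f) u \<longleftrightarrow> decr_at f (- u)"
  unfolding incr_at_def decr_at_def reflect_def
  by (metis minus_minus neg_less_iff_less)

lemma incr_at_rat:
  assumes "mono f"
  shows "incr_at f u \<longleftrightarrow> (\<forall>q::rat. u < of_rat q \<longrightarrow> f u < f (of_rat q))"
proof
  assume r: "\<forall>q::rat. u < of_rat q \<longrightarrow> f u < f (of_rat q)"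
  show "incr_at f u" unfolding incr_at_def
  proof (intro allI impI)
    fix v assume "u < v"
    then obtain q where q: "u < of_rat q" "of_rat q < v" using of_rat_dense by blast
    then have "f u < f (of_rat q)" using r by simp
    also have "\<dots> \<le> f v" using q assms by (simp add: monoD)
    finally show "f u < f v" .
  qed
qed (auto simp: incr_at_def)

lemma ennreal_le_eps:
  assumes "\<And>e. e > 0 \<Longrightarrow> ennreal (x - e) \<le> h" shows "ennreal x \<le> h"
proof (cases h)
  case (real r)
  have "x \<le> r + e" if "e > 0" for e
    using assms[OF that] real by (simp add: ennreal_le_iff)
  then have "x \<le> r" by (rule field_le_epsilon)
  then show ?thesis using real by (simp add: ennreal_leI)
qed simp

locale dual_argmin = dual_max P Q N Y1 Y2 for P Q and N :: "'a measure" and Y1 Y2 +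
  fixes U :: "'a \<Rightarrow> real"
  assumes U[measurable]: "U \<in> borel_measurable N"
    and WPU: "AE w in N. \<not> on_segment P Q (Y1 w) (Y2 w) \<longrightarrow> well_posed P Q (Y1 w) (Y2 w) (U w)"
begin

lemma dual_argmin_swap: "dual_argmin Q P N Y2 Y1 U"
proof -
  interpret sw: dual_max Q P N Y2 Y1 by (rule dual_max_swap)
  show ?thesis by unfold_locales (use WPU in \<open>simp_all add: on_segment_swap[of Q P] well_posed_swap[of Q P]\<close>)
qed

lemma dual_argmin_neg: "dual_argmin (reflect P) (reflect Q) N (\<lambda>w. - Y1 w) (\<lambda>w. - Y2 w) (\<lambda>w. - U w)"
proof -
  interpret n: dual_max "reflect P" "reflect Q" N "\<lambda>w. - Y1 w" "\<lambda>w. - Y2 w" by (rule dual_max_neg)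
  show ?thesis by unfold_locales (use WPU in \<open>simp_all add: on_segment_neg well_posed_neg\<close>)
qed

end

lemma (in curve) on_segment_rat:
  "on_segment P Q y1 y2 \<longleftrightarrow> P (y1 + y2) = y1 \<and> Q (y1 + y2) = y2 \<and>
     (\<exists>q::rat. of_rat q \<noteq> y1 + y2 \<and> (P (of_rat q) = y1 \<or> Q (of_rat q) = y2))"
proof
  have X: "\<exists>q::rat. of_rat q \<noteq> v \<and> f (of_rat q) = f v" if "mono f" "u \<noteq> v" "f u = f v" for f :: "real \<Rightarrow> real" and u v
  proof -
    have "min u v < max u v" using \<open>u \<noteq> v\<close> by linarith
    then obtain q where "min u v < of_rat q" "of_rat q < max u v" using of_rat_dense by blast
    moreover from this have "f (min u v) \<le> f (of_rat q)" "f (of_rat q) \<le> f (max u v)"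
      by (auto intro!: monoD[OF that(1)])
    moreover have "f (min u v) = f v" "f (max u v) = f v" using that(3) by (auto simp: min_def max_def)
    moreover have "of_rat q \<noteq> v" using calculation(1,2) by (auto simp: min_def max_def split: if_splits)
    ultimately show ?thesis by (intro exI[of _ q]) auto
  qed
  assume a: "on_segment P Q y1 y2"
  then show "P (y1 + y2) = y1 \<and> Q (y1 + y2) = y2 \<and>
     (\<exists>q::rat. of_rat q \<noteq> y1 + y2 \<and> (P (of_rat q) = y1 \<or> Q (of_rat q) = y2))"
    unfolding on_segment_def using X[OF mP, of _ "y1+y2"] X[OF mQ, of _ "y1+y2"] by metis
next
  assume "P (y1 + y2) = y1 \<and> Q (y1 + y2) = y2 \<and>
     (\<exists>q::rat. of_rat q \<noteq> y1 + y2 \<and> (P (of_rat q) = y1 \<or> Q (of_rat q) = y2))"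
  then show "on_segment P Q y1 y2" unfolding on_segment_def by blast
qed

lemma (in curve) on_segment_measurable[measurable (raw)]:
  assumes [measurable]: "f \<in> borel_measurable N" "g \<in> borel_measurable N"
  shows "Measurable.pred N (\<lambda>w. on_segment P Q (f w) (g w))"
  unfolding on_segment_rat by measurable

lemma (in curve) incr_at_sets: "{u. incr_at P u} \<in> sets borel"
proof -
  have "Measurable.pred borel (\<lambda>u. \<forall>q::rat. u < of_rat q \<longrightarrow> P u < P (of_rat q))" by measurable
  then show ?thesis unfolding incr_at_rat[OF mP] by (simp add: pred_def)
qed

lemma (in curve) decr_at_sets: "{u. decr_at P u} \<in> sets borel"
proof -
  interpret n: curve "reflect P" "reflect Q" by (rule neg)
  have "{u. decr_at P u} = (\<lambda>u. - u) -` {u. incr_at (reflect P) u} \<inter> space borel"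
    by (auto simp: incr_at_refl)
  also have "\<dots> \<in> sets borel" using n.incr_at_sets by (intro measurable_sets[of _ borel borel]) auto
  finally show ?thesis .
qed

context dual_argmin begin

text \<open>The perturbation bumps the curve to the right near the parameters in \<open>K\<close>. The one-sided distance
  \<open>d\<close> lets \<open>\<kappa>\<close> rise at any rate but fall only as fast as \<open>P\<close> grows, so that the
  perturbed curve stays monotone. As \<open>K\<close> contains no parameter followed by a vertical segment,
  the segments of the curve contribute nothing in the limit.\<close>

lemma upper_bound_compact:
  assumes K: "compact K" "K \<subseteq> {u. incr_at P u}"
  defines "g \<equiv> \<lambda>w. if \<not> on_segment P Q (Y1 w) (Y2 w) \<and> U w \<in> K then Q (U w) - Y2 w else 0"
  shows "(\<integral>w. g w \<partial>N) \<le> 0"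
proof (cases "K = {}")
  case True then show ?thesis by (simp add: g_def)
next
  case False
  \<comment> \<open>One-sided distance: a point \<open>s\<close> to the right of \<open>u\<close> is
    measured by the parameter, a point to the left only by the growth of \<open>P\<close>. Hence
    \<open>d\<close> increases at most as fast as \<open>P\<close> (\<open>dP\<close>).\<close>
  define r where "r u s = max 0 (s - u) + max 0 (P u - P s)" for u s
  define d where "d u = (INF s\<in>K. r u s)" for u
  have bdd: "bdd_below (r u ` K)" for u by (rule bdd_belowI[of _ 0]) (auto simp: r_def)
  have d_le: "d u \<le> r u s" if "s \<in> K" for u s unfolding d_def using that bdd by (intro cINF_lower)
  have att: "\<exists>s\<in>K. d u = r u s" for u
  proof -
    have "continuous_on K (r u)" unfolding r_def by (intro continuous_intros P_cont)
    then obtain s where s: "s \<in> K" "\<forall>t\<in>K. r u s \<le> r u t"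
      using continuous_attains_inf[OF K(1) False] by blast
    then have "r u s \<le> d u" unfolding d_def using False by (intro cINF_greatest) auto
    then show ?thesis using d_le[OF s(1), of u] s(1) by (intro bexI[of _ s]) auto
  qed
  have d0: "0 \<le> d u" for u using att[of u] by (auto simp: r_def)
  have dP: "d v \<le> d u + (P v - P u)" if "u \<le> v" for u v
  proof -
    obtain s where "s \<in> K" "d u = r u s" using att by blast
    then show ?thesis using d_le[of s v] that P_mono[OF that] by (auto simp: r_def)
  qed
  have dU: "d u \<le> d v + (v - u)" if "u \<le> v" for u v
  proof -
    obtain s where "s \<in> K" "d v = r v s" using att by blast
    then show ?thesis using d_le[of s u] that P_mono[OF that] by (auto simp: r_def)
  qed
  have dc: "continuous_on UNIV d"
  proof -
    have "1-lipschitz_on UNIV d"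
    proof (rule lipschitz_onI)
      show "dist (d x) (d y) \<le> 1 * dist x y" for x y
        using dP[of x y] dU[of x y] dP[of y x] dU[of y x] P_lip[of x y] P_lip[of y x]
        by (cases "x \<le> y") (auto simp: dist_real_def)
    qed simp
    then show ?thesis by (rule lipschitz_on_continuous_on)
  qed
  \<comment> \<open>A point beyond \<open>s\<close> on a flat piece of \<open>P\<close> would also
    have distance 0; \<open>incr_at\<close> on \<open>K\<close> excludes this.\<close>
  have dK: "d u = 0 \<longleftrightarrow> u \<in> K" for u
  proof
    assume "u \<in> K" then show "d u = 0" using d_le[of u u] d0[of u] by (simp add: r_def)
  next
    assume "d u = 0"
    then obtain s where s: "s \<in> K" "r u s = 0" using att[of u] by auto
    then have "s \<le> u" "P u \<le> P s" by (auto simp: r_def max_def split: if_splits)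
    moreover have "P s < P u" if "s < u" using K(2) s(1) that by (auto simp: incr_at_def)
    ultimately have "s = u" by force
    then show "u \<in> K" using s by simp
  qed
  obtain k0 where k0: "k0 \<in> K" "\<And>s. s \<in> K \<Longrightarrow> k0 \<le> s"
    using compact_attains_inf[OF K(1) False] by blast
  \<comment> \<open>Below \<open>k0 - 1\<close> the distance is at least 1, so
    \<open>\<kappa> m\<close> vanishes there for every \<open>m\<close>, and one bound
    \<open>B\<close> serves all \<open>m\<close>.\<close>
  define N0 where "N0 = k0 - 1"
  define B where "B w = \<bar>Y2 w\<bar> + \<bar>Q N0\<bar>" for w
  define \<kappa> where "\<kappa> m u = max 0 (1 - (real m + 1) * d u)" for m u
  have \<kappa>c: "continuous_on UNIV (\<kappa> m)" for m unfolding \<kappa>_def by (intro continuous_intros dc)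
  have \<kappa>b: "0 \<le> \<kappa> m u" "\<kappa> m u \<le> 1" for m u using d0[of u] by (auto simp: \<kappa>_def)
  have "\<exists>H. H \<in> borel_measurable N \<and> (\<integral>\<^sup>+w. H w \<partial>N) \<le> (\<integral>\<^sup>+w. ennreal (B w) \<partial>N) \<and>
    (\<forall>w c \<eta>. phiE P Q (Y1 w) (Y2 w) > -\<infinity> \<longrightarrow> \<eta> > 0 \<longrightarrow>
       (\<forall>u. ccost P Q (Y1 w) (Y2 w) u < phiR P Q (Y1 w) (Y2 w) + \<eta> \<longrightarrow> c \<le> \<kappa> m u * (Q u - Y2 w)) \<longrightarrow>
       ennreal (c + B w) \<le> H w)" for m
  proof (rule first_order_condition[of "\<kappa> m" N0 "1 / (real m + 1)"], goal_cases)
    case 1 show ?case by (rule \<kappa>c)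
  next
    case 2 show ?case by (rule \<kappa>b)
  next
    case 3 show ?case by (rule \<kappa>b)
  next
    case (4 u)
    obtain s where "s \<in> K" "d u = r u s" using att by blast
    then have "d u \<ge> 1" using 4 k0(2)[of s] by (auto simp: r_def N0_def max_def)
    then have "(real m + 1) * d u \<ge> 1" using mult_mono[of 1 "real m + 1" 1 "d u"] by simp
    then show ?case by (simp add: \<kappa>_def)
  next
    case 5 show ?case by simp
  next
    case (6 \<epsilon>)
    show ?case
    proof (rule monoI)
      fix u v :: real assume "u \<le> v"
      \<comment> \<open>By \<open>dP\<close> the bump falls at most \<open>m + 1\<close> times as
        fast as \<open>P\<close> grows, which is where the bound \<open>1 / (m + 1)\<close> on
        \<open>\<epsilon>\<close> comes from.\<close>
      have "\<kappa> m u - \<kappa> m v \<le> (real m + 1) * (P v - P u)"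
      proof -
        have "(real m + 1) * d v \<le> (real m + 1) * (d u + (P v - P u))" using dP[OF \<open>u \<le> v\<close>] by (intro mult_left_mono) auto
        then have "(real m + 1) * d v \<le> (real m + 1) * d u + (real m + 1) * (P v - P u)" by (simp add: algebra_simps)
        moreover have "0 \<le> (real m + 1) * (P v - P u)" using P_mono[OF \<open>u \<le> v\<close>] by simp
        ultimately show ?thesis unfolding \<kappa>_def by linarith
      qed
      then have "\<epsilon> * (\<kappa> m u - \<kappa> m v) \<le> \<epsilon> * ((real m + 1) * (P v - P u))" using 6 by (intro mult_left_mono) auto
      also have "\<dots> = (\<epsilon> * (real m + 1)) * (P v - P u)" by simp
      also have "\<dots> \<le> 1 * (P v - P u)" using 6 P_mono[OF \<open>u \<le> v\<close>] by (intro mult_right_mono) (auto simp: field_simps)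
      finally show "P u + \<epsilon> * \<kappa> m u \<le> P v + \<epsilon> * \<kappa> m v" by (simp add: algebra_simps)
    qed
  next
    case (7 H)
    show ?case unfolding B_def by (rule exI[of _ H]) (use 7 in blast)
  qed
  then obtain H where H[measurable]: "\<And>m. H m \<in> borel_measurable N" and HB: "\<And>m. (\<integral>\<^sup>+w. H m w \<partial>N) \<le> (\<integral>\<^sup>+w. ennreal (B w) \<partial>N)"
    and Hg: "\<And>m w c \<eta>. phiE P Q (Y1 w) (Y2 w) > -\<infinity> \<Longrightarrow> \<eta> > 0 \<Longrightarrow>
       (\<And>u. ccost P Q (Y1 w) (Y2 w) u < phiR P Q (Y1 w) (Y2 w) + \<eta> \<Longrightarrow> c \<le> \<kappa> m u * (Q u - Y2 w)) \<Longrightarrow>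
       ennreal (c + B w) \<le> H m w"
    by metis
  \<comment> \<open>A point of a segment has value 0 and cost
    \<open>(P v - P u) * (Q v - Q u)\<close>. Only parameters well below \<open>v\<close> could make
    the derivative less than \<open>- e\<close>; if the bump is positive there, both factors are
    bounded below and \<open>u\<close> is no near-minimizer.\<close>
  have seg: "ennreal (0 + B w) \<le> liminf (\<lambda>m. H m w)" if sg: "on_segment P Q (Y1 w) (Y2 w)" for w
  proof (rule ennreal_le_eps)
    fix e :: real assume "e > 0"
    define v where "v = Y1 w + Y2 w"
    have v: "P v = Y1 w" "Q v = Y2 w" using sg by (auto simp: on_segment_def v_def)
    \<comment> \<open>If \<open>P\<close> grows between \<open>v - e\<close> and \<open>v\<close>,
      that growth serves as \<open>\<delta>\<close>. Otherwise \<open>incr_at\<close> keeps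
      \<open>K\<close> off the parameters from \<open>v - e\<close> up to but not including
      \<open>v\<close>, and the largest point \<open>s1\<close> of \<open>K\<close> below them
      leaves a gap \<open>P v - P s1\<close>, half of which survives subtraction of
      \<open>d u\<close>.\<close>
    obtain \<delta> where "\<delta> > 0" and \<delta>: "\<And>u. u \<le> v - e \<Longrightarrow> d u < \<delta> \<Longrightarrow> \<delta> \<le> P v - P u"
    proof (cases "P (v - e) < P v")
      case True
      then show ?thesis using that[of "P v - P (v - e)"] P_mono by fastforce
    next
      case Pe: False
      define K' where "K' = K \<inter> {..v - e}"
      have KK: "s \<in> K'" if "s \<in> K" "s < v" for s
      proof -
        have "P s < P v" using K(2) that by (auto simp: incr_at_def)
        then show ?thesis using Pe P_mono[of "v - e" s] that by (cases "v - e \<le> s") (auto simp: K'_def)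
      qed
      show ?thesis
      proof (cases "K' = {}")
        case True
        show ?thesis
        proof (rule that[OF \<open>e > 0\<close>])
          fix u assume u: "u \<le> v - e" "d u < e"
          obtain s where "s \<in> K" "d u = r u s" using att by blast
          moreover have "v \<le> s" using KK[of s] True \<open>s \<in> K\<close> by force
          ultimately show "e \<le> P v - P u" using u by (auto simp: r_def)
        qed
      next
        case False
        have "compact K'" unfolding K'_def by (intro compact_Int_closed K) auto
        then obtain s1 where s1: "s1 \<in> K'" "\<And>s. s \<in> K' \<Longrightarrow> s \<le> s1" using compact_attains_sup[OF _ False] by blast
        have "P s1 < P v" using s1(1) K(2) \<open>e > 0\<close> by (auto simp: K'_def incr_at_def)
        show ?thesis
        proof (rule that[of "min e ((P v - P s1) / 2)"])
          show "0 < min e ((P v - P s1) / 2)" using \<open>e > 0\<close> \<open>P s1 < P v\<close> by simp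
          fix u assume u: "u \<le> v - e" "d u < min e ((P v - P s1) / 2)"
          obtain s where s: "s \<in> K" "d u = r u s" using att by blast
          have "s < v"
          proof (rule ccontr)
            assume "\<not> s < v" then show False using s(2) u by (auto simp: r_def)
          qed
          then have "P s \<le> P s1" using P_mono[OF s1(2)[OF KK[OF s(1)]]] by simp
          moreover have "P u - P s \<le> d u" unfolding s(2) r_def by simp
          moreover have "min e ((P v - P s1) / 2) \<le> (P v - P s1) / 2" by (rule min.cobounded2)
          ultimately show "min e ((P v - P s1) / 2) \<le> P v - P u" using u(2) by argo
        qed
      qed
    qed
    have "\<forall>\<^sub>F m in sequentially. 1 / (real m + 1) < \<delta>"
      using LIMSEQ_inverse_real_of_nat order_tendstoD(2)[OF _ \<open>\<delta> > 0\<close>] by (simp add: inverse_eq_divide add.commute)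
    then have "\<forall>\<^sub>F m in sequentially. ennreal (- e + B w) \<le> H m w"
    proof eventually_elim
      case (elim m)
      show ?case
      proof (rule Hg[of w "e * \<delta>"])
        show "phiE P Q (Y1 w) (Y2 w) > -\<infinity>" by (rule on_segment_phe[OF sg])
        show "e * \<delta> > 0" using \<open>e > 0\<close> \<open>\<delta> > 0\<close> by simp
        fix u assume u: "ccost P Q (Y1 w) (Y2 w) u < phiR P Q (Y1 w) (Y2 w) + e * \<delta>"
        have cu: "ccost P Q (Y1 w) (Y2 w) u = (P v - P u) * (Q v - Q u)" unfolding ccost_def v by (simp add: algebra_simps)
        have *: "- e \<le> \<kappa> m u * (Q u - Y2 w)" if "Q v - Q u \<le> e"
        proof -
          have "\<kappa> m u * (Q v - Q u) \<le> \<kappa> m u * e" using that \<kappa>b[of m u] by (intro mult_left_mono) auto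
          also have "\<dots> \<le> 1 * e" using \<kappa>b[of m u] \<open>e > 0\<close> by (intro mult_right_mono) auto
          finally show ?thesis unfolding v(2)[symmetric] by (simp add: algebra_simps)
        qed
        show "- e \<le> \<kappa> m u * (Q u - Y2 w)"
        proof (cases "\<kappa> m u = 0 \<or> Q v - Q u \<le> e")
          case True then show ?thesis using * \<open>e > 0\<close> by auto
        next
          case False
          then have k: "\<kappa> m u > 0" "Q v - Q u > e" using \<kappa>b(1)[of m u] by auto
          have "u < v" using k(2) \<open>e > 0\<close> Q_mono[of v u] by (cases "u < v") auto
          then have "u \<le> v - e" using Q_lip[of u v] k(2) by simp
          moreover have "d u < \<delta>"
          proof -
            have "(real m + 1) * d u < 1" using k(1) by (auto simp: \<kappa>_def)
            then have "d u < 1 / (real m + 1)" by (simp add: field_simps)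
            then show ?thesis using elim by simp
          qed
          ultimately have "\<delta> \<le> P v - P u" by (rule \<delta>)
          then have "\<delta> * e \<le> (P v - P u) * (Q v - Q u)" using k(2) \<open>e > 0\<close> \<open>\<delta> > 0\<close> by (intro mult_mono) auto
          then show ?thesis using u unfolding cu on_segment_ph[OF sg] by (simp add: mult.commute)
        qed
      qed
    qed
    then have "ennreal (- e + B w) \<le> liminf (\<lambda>m. H m w)" by (rule Liminf_bounded)
    then show "ennreal (0 + B w - e) \<le> liminf (\<lambda>m. H m w)" by (simp add: algebra_simps)
  qed
  \<comment> \<open>Off the segments, \<open>\<kappa> m\<close> at the minimizer is 1 on
    \<open>K\<close> and eventually 0 elsewhere, so the limit is the integrand
    \<open>g\<close>.\<close>
  have nseg: "ennreal (g w + B w) \<le> liminf (\<lambda>m. H m w)"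
    if sg: "\<not> on_segment P Q (Y1 w) (Y2 w)" and well_posed: "well_posed P Q (Y1 w) (Y2 w) (U w)" for w
  proof -
    have dm: "phiE P Q (Y1 w) (Y2 w) > -\<infinity>" using well_posed by (simp add: well_posed_def)
    have Hm: "ennreal (\<kappa> m (U w) * (Q (U w) - Y2 w) + B w) \<le> H m w" for m
    proof (rule ennreal_le_eps)
      fix e :: real assume "e > 0"
      have "continuous_on UNIV (\<lambda>u. \<kappa> m u * (Q u - Y2 w))" by (intro continuous_intros \<kappa>c Q_cont)
      then have "isCont (\<lambda>u. \<kappa> m u * (Q u - Y2 w)) (U w)" by (simp add: continuous_on_eq_continuous_at)
      then obtain \<delta> where "\<delta> > 0" and \<delta>: "\<And>u. dist u (U w) < \<delta> \<Longrightarrow>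
         dist (\<kappa> m u * (Q u - Y2 w)) (\<kappa> m (U w) * (Q (U w) - Y2 w)) < e"
        using \<open>e > 0\<close> unfolding continuous_at_eps_delta by blast
      obtain \<eta> where "\<eta> > 0" and \<eta>: "\<And>u. \<bar>u - U w\<bar> \<ge> \<delta> \<Longrightarrow> phiR P Q (Y1 w) (Y2 w) + \<eta> \<le> ccost P Q (Y1 w) (Y2 w) u"
        using well_posed \<open>\<delta> > 0\<close> unfolding well_posed_def by blast
      have "ennreal ((\<kappa> m (U w) * (Q (U w) - Y2 w) - e) + B w) \<le> H m w"
      proof (rule Hg[OF dm \<open>\<eta> > 0\<close>])
        fix u assume "ccost P Q (Y1 w) (Y2 w) u < phiR P Q (Y1 w) (Y2 w) + \<eta>"
        then have "\<bar>u - U w\<bar> < \<delta>" using \<eta>[of u] by linarith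
        then show "\<kappa> m (U w) * (Q (U w) - Y2 w) - e \<le> \<kappa> m u * (Q u - Y2 w)"
          using \<delta>[of u] unfolding dist_real_def by linarith
      qed
      then show "ennreal (\<kappa> m (U w) * (Q (U w) - Y2 w) + B w - e) \<le> H m w" by (simp add: algebra_simps)
    qed
    have "\<forall>\<^sub>F m in sequentially. \<kappa> m (U w) * (Q (U w) - Y2 w) = g w"
    proof (cases "U w \<in> K")
      case True
      then show ?thesis using sg dK[of "U w"] by (simp add: \<kappa>_def g_def)
    next
      case False
      then have "d (U w) > 0" using dK[of "U w"] d0[of "U w"] by auto
      then have "\<forall>\<^sub>F m in sequentially. 1 / (real m + 1) < d (U w)"
        using LIMSEQ_inverse_real_of_nat order_tendstoD(2) by (simp add: inverse_eq_divide add.commute)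
      then show ?thesis
        by eventually_elim (use False in \<open>auto simp: \<kappa>_def g_def field_simps\<close>)
    qed
    then have "\<forall>\<^sub>F m in sequentially. ennreal (g w + B w) \<le> H m w"
    proof eventually_elim
      case (elim m) then show ?case using Hm[of m] by simp
    qed
    then show ?thesis by (rule Liminf_bounded)
  qed
  have [measurable]: "K \<in> sets borel" using K(1) by (simp add: compact_imp_closed)
  have [measurable]: "g \<in> borel_measurable N" unfolding g_def by measurable
  have intB: "integrable N B" unfolding B_def using intY2 by simp
  obtain k1 where k1: "\<And>s. s \<in> K \<Longrightarrow> s \<le> k1" using compact_attains_sup[OF K(1) False] by blast
  have gB: "0 \<le> g w + B w" for w
    using Q_mono[of N0 "U w"] k0(2)[of "U w"] by (auto simp: g_def B_def N0_def)
  have intg: "integrable N g"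
  proof (rule Bochner_Integration.integrable_bound)
    show "integrable N (\<lambda>w. \<bar>Y2 w\<bar> + (\<bar>Q k0\<bar> + \<bar>Q k1\<bar>))" using intY2 by simp
    show "AE w in N. norm (g w) \<le> norm (\<bar>Y2 w\<bar> + (\<bar>Q k0\<bar> + \<bar>Q k1\<bar>))"
    proof (intro AE_I2)
      fix w
      show "norm (g w) \<le> norm (\<bar>Y2 w\<bar> + (\<bar>Q k0\<bar> + \<bar>Q k1\<bar>))"
        using Q_mono[of k0 "U w"] Q_mono[of "U w" k1] k0(2)[of "U w"] k1[of "U w"] by (auto simp: g_def)
    qed
  qed measurable
  have "(\<integral>\<^sup>+w. ennreal (g w + B w) \<partial>N) \<le> (\<integral>\<^sup>+w. liminf (\<lambda>m. H m w) \<partial>N)"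
  proof (rule nn_integral_mono_AE)
    show "AE w in N. ennreal (g w + B w) \<le> liminf (\<lambda>m. H m w)"
      using WPU
    proof eventually_elim
      case (elim w)
      show ?case
      proof (cases "on_segment P Q (Y1 w) (Y2 w)")
        case True then show ?thesis using seg[OF True] by (simp add: g_def)
      next
        case False then show ?thesis using nseg elim by blast
      qed
    qed
  qed
  also have "\<dots> \<le> liminf (\<lambda>m. \<integral>\<^sup>+w. H m w \<partial>N)" by (rule nn_integral_liminf) measurable
  also have "\<dots> \<le> liminf (\<lambda>m::nat. \<integral>\<^sup>+w. ennreal (B w) \<partial>N)" by (intro Liminf_mono always_eventually allI HB)
  also have "\<dots> = (\<integral>\<^sup>+w. ennreal (B w) \<partial>N)" by (simp add: Liminf_const)
  also have "(\<integral>\<^sup>+w. ennreal (B w) \<partial>N) = ennreal (\<integral>w. B w \<partial>N)"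
    by (rule nn_integral_eq_integral[OF intB]) (simp add: B_def)
  finally have "ennreal (\<integral>w. g w + B w \<partial>N) \<le> ennreal (\<integral>w. B w \<partial>N)"
    using nn_integral_eq_integral[of N "\<lambda>w. g w + B w"] intg intB gB by simp
  moreover have "0 \<le> (\<integral>w. B w \<partial>N)" by (rule integral_nonneg_AE) (simp add: B_def)
  ultimately have "(\<integral>w. g w + B w \<partial>N) \<le> (\<integral>w. B w \<partial>N)" by (simp add: ennreal_le_iff)
  then show ?thesis using intg intB by simp
qed

end

context dual_argmin begin

definition off_segment :: "real set \<Rightarrow> 'a \<Rightarrow> bool" where
  "off_segment A w \<longleftrightarrow> \<not> on_segment P Q (Y1 w) (Y2 w) \<and> U w \<in> A"

lemma off_segment_measurable[measurable (raw)]: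
  assumes [measurable]: "A \<in> sets borel"
  shows "Measurable.pred N (off_segment A)"
  unfolding off_segment_def by measurable

lemma integrable_off_segment:
  assumes A: "A \<in> sets borel" "A \<subseteq> {-c..c}"
  shows "integrable N (\<lambda>w. if off_segment A w then Q (U w) - Y2 w else 0)"
proof (rule Bochner_Integration.integrable_bound)
  note A(1)[measurable]
  show "integrable N (\<lambda>w. \<bar>Y2 w\<bar> + (\<bar>Q (-c)\<bar> + \<bar>Q c\<bar>))" using intY2 by simp
  show "AE w in N. norm (if off_segment A w then Q (U w) - Y2 w else 0) \<le> norm (\<bar>Y2 w\<bar> + (\<bar>Q (-c)\<bar> + \<bar>Q c\<bar>))"
  proof (intro AE_I2)
    fix w
    show "norm (if off_segment A w then Q (U w) - Y2 w else 0) \<le> norm (\<bar>Y2 w\<bar> + (\<bar>Q (-c)\<bar> + \<bar>Q c\<bar>))"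
      using Q_mono[of "-c" "U w"] Q_mono[of "U w" c] A(2) by (auto simp: off_segment_def)
  qed
  show "(\<lambda>w. if off_segment A w then Q (U w) - Y2 w else 0) \<in> borel_measurable N" by measurable
qed

text \<open>Inner regularity carries \<open>upper_bound_compact\<close> over to Borel sets.\<close>

lemma upper_bound_borel:
  assumes A: "A \<in> sets borel" "A \<subseteq> {-c..c}" "A \<subseteq> {u. incr_at P u}"
  shows "(\<integral>w. (if off_segment A w then Q (U w) - Y2 w else 0) \<partial>N) \<le> 0"
proof (rule field_le_epsilon)
  fix e :: real assume "e > 0"
  define h where "h w = (if off_segment {-c..c} w then Q (U w) - Y2 w else 0)" for w
  have inth: "integrable N h" unfolding h_def by (rule integrable_off_segment) auto
  then have [measurable]: "h \<in> borel_measurable N" by (rule borel_measurable_integrable)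
  \<comment> \<open>Law of \<open>U\<close> weighted by the size of the integrand, so that the
    difference of the masses of \<open>A\<close> and \<open>K\<close> bounds the loss in passing
    from \<open>A\<close> to \<open>K\<close>.\<close>
  define \<mu> where "\<mu> = distr (density N (\<lambda>w. ennreal \<bar>h w\<bar>)) borel U"
  have \<mu>: "emeasure \<mu> X = ennreal (\<integral>w. \<bar>h w\<bar> * indicator X (U w) \<partial>N)"
    and \<mu>i: "integrable N (\<lambda>w. \<bar>h w\<bar> * indicator X (U w))" if "X \<in> sets borel" for X
  proof -
    note that[measurable]
    show i: "integrable N (\<lambda>w. \<bar>h w\<bar> * indicator X (U w))"
    proof (rule Bochner_Integration.integrable_bound)
      show "AE w in N. norm (\<bar>h w\<bar> * indicator X (U w)) \<le> norm (h w)" by (auto simp: indicator_def)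
    qed (use inth in measurable)
    have "emeasure \<mu> X = (\<integral>\<^sup>+w. ennreal \<bar>h w\<bar> * indicator (U -` X \<inter> space N) w \<partial>N)"
      unfolding \<mu>_def by (subst emeasure_distr) (auto simp: emeasure_density)
    also have "\<dots> = (\<integral>\<^sup>+w. ennreal (\<bar>h w\<bar> * indicator X (U w)) \<partial>N)"
      by (intro nn_integral_cong) (auto simp: indicator_def)
    also have "\<dots> = ennreal (\<integral>w. \<bar>h w\<bar> * indicator X (U w) \<partial>N)"
      by (rule nn_integral_eq_integral[OF i]) simp
    finally show "emeasure \<mu> X = ennreal (\<integral>w. \<bar>h w\<bar> * indicator X (U w) \<partial>N)" .
  qed
  have s: "sets \<mu> = sets borel" by (simp add: \<mu>_def)
  have sp: "space \<mu> = UNIV" by (simp add: \<mu>_def)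
  have "emeasure \<mu> (space \<mu>) \<noteq> \<infinity>" unfolding sp by (subst \<mu>) auto
  from inner_regular[OF s this, of A] A(1)
  have IR: "emeasure \<mu> A = (SUP K \<in> {K. K \<subseteq> A \<and> compact K}. emeasure \<mu> K)" by simp
  define a where "a = (\<integral>w. \<bar>h w\<bar> * indicator A (U w) \<partial>N)"
  have "\<exists>K. compact K \<and> K \<subseteq> A \<and> a \<le> (\<integral>w. \<bar>h w\<bar> * indicator K (U w) \<partial>N) + e"
  proof (rule ccontr)
    assume "\<not> ?thesis"
    then have c: "(\<integral>w. \<bar>h w\<bar> * indicator K (U w) \<partial>N) + e < a" if "compact K" "K \<subseteq> A" for K
      using that by (meson not_le)
    have "0 < a - e" using c[of "{}"] by simp
    have "emeasure \<mu> K \<le> ennreal (a - e)" if "compact K" "K \<subseteq> A" for K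
      using c[OF that] that by (subst \<mu>) (auto intro!: ennreal_leI compact_imp_closed borel_closed)
    then have "emeasure \<mu> A \<le> ennreal (a - e)" unfolding IR by (intro SUP_least) auto
    then have "ennreal a \<le> ennreal (a - e)" using \<mu>[OF A(1)] by (simp add: a_def)
    then show False using \<open>0 < a - e\<close> \<open>e > 0\<close> by (simp add: ennreal_le_iff)
  qed
  then obtain K where K: "compact K" "K \<subseteq> A" "a \<le> (\<integral>w. \<bar>h w\<bar> * indicator K (U w) \<partial>N) + e" by blast
  have Kb: "K \<in> sets borel" using K(1) by (simp add: compact_imp_closed)
  have K0: "(\<integral>w. (if off_segment K w then Q (U w) - Y2 w else 0) \<partial>N) \<le> 0"
    unfolding off_segment_def by (rule upper_bound_compact) (use K A in auto)
  have iA: "integrable N (\<lambda>w. if off_segment A w then Q (U w) - Y2 w else 0)" using A by (intro integrable_off_segment)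
  have iK: "integrable N (\<lambda>w. if off_segment K w then Q (U w) - Y2 w else 0)" using K A Kb by (intro integrable_off_segment[of K c]) auto
  have "(\<integral>w. (if off_segment A w then Q (U w) - Y2 w else 0) \<partial>N) \<le>
     (\<integral>w. (if off_segment K w then Q (U w) - Y2 w else 0) + (\<bar>h w\<bar> * indicator A (U w) - \<bar>h w\<bar> * indicator K (U w)) \<partial>N)"
  proof (rule integral_mono)
    show "integrable N (\<lambda>w. (if off_segment K w then Q (U w) - Y2 w else 0) + (\<bar>h w\<bar> * indicator A (U w) - \<bar>h w\<bar> * indicator K (U w)))"
      by (rule Bochner_Integration.integrable_add[OF iK Bochner_Integration.integrable_diff[OF \<mu>i[OF A(1)] \<mu>i[OF Kb]]])
    fix w
    have "U w \<in> K \<Longrightarrow> U w \<in> A" "U w \<in> A \<Longrightarrow> U w \<in> {-c..c}" using K(2) A(2) by auto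
    then show "(if off_segment A w then Q (U w) - Y2 w else 0) \<le>
      (if off_segment K w then Q (U w) - Y2 w else 0) + (\<bar>h w\<bar> * indicator A (U w) - \<bar>h w\<bar> * indicator K (U w))"
      unfolding off_segment_def h_def
      by (cases "U w \<in> K"; cases "U w \<in> A"; cases "on_segment P Q (Y1 w) (Y2 w)") simp_all
  qed (rule iA)
  also have "\<dots> = (\<integral>w. (if off_segment K w then Q (U w) - Y2 w else 0) \<partial>N) + (a - (\<integral>w. \<bar>h w\<bar> * indicator K (U w) \<partial>N))"
    unfolding a_def using iK \<mu>i[OF A(1)] \<mu>i[OF Kb] by simp
  finally show "(\<integral>w. (if off_segment A w then Q (U w) - Y2 w else 0) \<partial>N) \<le> 0 + e" using K0 K(3) by linarith
qed

end

text \<open>A vertical piece hangs below \<open>U\<close>. Sliding down along it cannot lower the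
  cost, which fixes the side of \<open>y\<close> horizontally; the strictly negative minimum then
  fixes it vertically.\<close>

lemma (in curve) vertical_top:
  assumes d: "phiE P Q y1 y2 > -\<infinity>" and n: "\<not> on_segment P Q y1 y2" and U: "ccost P Q y1 y2 U = phiR P Q y1 y2"
    and u: "\<not> decr_at P U"
  shows "P U < y1 \<and> y2 < Q U"
proof -
  obtain u where "u < U" "\<not> P u < P U" using u by (auto simp: decr_at_def)
  then have u: "u < U" "P u = P U" using P_mono[of u U] by auto
  then have q: "Q u < Q U" using PQ[of u] PQ[of U] by linarith
  have "ccost P Q y1 y2 U \<le> ccost P Q y1 y2 u" using phiR_le[OF d, of u] U by simp
  then have "(P U - y1) * (Q U - Q u) \<le> 0" unfolding ccost_def u(2) by (simp add: algebra_simps)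
  then have le: "P U \<le> y1" using q by (simp add: mult_le_0_iff)
  have ne: "U \<noteq> y1 + y2 \<or> phiR P Q y1 y2 < 0"
  proof (rule ccontr)
    assume c: "\<not> ?thesis"
    then have "phiR P Q y1 y2 = 0" using phiR_nonpos[OF d] by simp
    from phiR_zero_on_curve[OF d this] c u show False using n unfolding on_segment_def by (metis less_irrefl)
  qed
  have "ccost P Q y1 y2 U < 0" using ne ccost_neg_off_segment[OF d n U] U by auto
  then show ?thesis using le unfolding ccost_def by (simp add: mult_less_0_iff)
qed

lemma (in curve) vertical_bottom:
  assumes d: "phiE P Q y1 y2 > -\<infinity>" and n: "\<not> on_segment P Q y1 y2" and U: "ccost P Q y1 y2 U = phiR P Q y1 y2"
    and u: "\<not> incr_at P U"
  shows "y1 < P U"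
proof -
  interpret m: curve "reflect P" "reflect Q" by (rule neg)
  have "\<not> decr_at (reflect P) (- U)" using u incr_at_refl[of "reflect P" U] by (simp add: reflect_def[abs_def])
  moreover have "ccost (reflect P) (reflect Q) (- y1) (- y2) (- U) = phiR (reflect P) (reflect Q) (- y1) (- y2)"
    using U by (simp add: ccost_neg phiR_neg)
  ultimately have "reflect P (- U) < - y1"
    using m.vertical_top[of "-y1" "-y2" "-U"] d n by (simp add: phiE_neg on_segment_neg)
  then show ?thesis by (simp add: reflect_def)
qed

context dual_argmin begin

lemma lower_bound_borel:
  assumes A: "A \<in> sets borel" "A \<subseteq> {-c..c}" "A \<subseteq> {u. decr_at P u}"
  shows "0 \<le> (\<integral>w. (if off_segment A w then Q (U w) - Y2 w else 0) \<partial>N)"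
proof -
  interpret n: dual_argmin "reflect P" "reflect Q" N "\<lambda>w. - Y1 w" "\<lambda>w. - Y2 w" "\<lambda>w. - U w" by (rule dual_argmin_neg)
  have o: "n.off_segment (uminus ` A) w \<longleftrightarrow> off_segment A w" for w
    unfolding n.off_segment_def off_segment_def on_segment_neg by (auto simp: image_iff)
  have "uminus ` A = uminus -` A \<inter> space borel" by (force simp: image_iff)
  then have b: "uminus ` A \<in> sets borel" using A(1) measurable_sets[of "uminus :: real \<Rightarrow> real" borel borel A] by simp
  have "(\<integral>w. (if n.off_segment (uminus ` A) w then reflect Q (- U w) - - Y2 w else 0) \<partial>N) \<le> 0"
    using A by (intro n.upper_bound_borel[OF b, of c]) (auto simp: incr_at_refl)
  also have "(\<lambda>w. if n.off_segment (uminus ` A) w then reflect Q (- U w) - - Y2 w else 0) = (\<lambda>w. - (if off_segment A w then Q (U w) - Y2 w else 0))"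
    unfolding o by (auto simp: reflect_def)
  finally show ?thesis by simp
qed

lemma well_posed_facts: "AE w in N. \<not> on_segment P Q (Y1 w) (Y2 w) \<longrightarrow>
   phiE P Q (Y1 w) (Y2 w) > -\<infinity> \<and> ccost P Q (Y1 w) (Y2 w) (U w) = phiR P Q (Y1 w) (Y2 w)"
  using WPU by eventually_elim (auto simp: well_posed_def)

text \<open>Parameters with \<open>incr_at\<close> but not \<open>decr_at\<close> are the upper ends
  of vertical segments. The integrand is strictly positive there by \<open>vertical_top\<close>,
  while \<open>upper_bound_borel\<close> makes its integral nonpositive.\<close>

lemma no_top: "AE w in N. \<not> on_segment P Q (Y1 w) (Y2 w) \<longrightarrow> incr_at P (U w) \<longrightarrow> decr_at P (U w)"
proof -
  have "AE w in N. \<not> on_segment P Q (Y1 w) (Y2 w) \<longrightarrow> U w \<in> {-real n..real n} \<longrightarrow> incr_at P (U w) \<longrightarrow> decr_at P (U w)" for n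
  proof -
    define A where "A = {- real n..real n} \<inter> ({u. incr_at P u} - {u. decr_at P u})"
    have A: "A \<in> sets borel" unfolding A_def using incr_at_sets decr_at_sets by auto
    have Ac: "A \<subseteq> {- real n..real n}" by (auto simp: A_def)
    define h where "h w = (if off_segment A w then Q (U w) - Y2 w else 0)" for w
    have pos: "AE w in N. off_segment A w \<longrightarrow> Q (U w) - Y2 w > 0"
      using well_posed_facts
    proof eventually_elim
      case (elim w)
      then show ?case using vertical_top[of "Y1 w" "Y2 w" "U w"] by (auto simp: off_segment_def A_def)
    qed
    have h0: "AE w in N. 0 \<le> h w" using pos by eventually_elim (auto simp: h_def)
    have ih: "integrable N h" unfolding h_def by (rule integrable_off_segment[OF A Ac])
    have "(\<integral>w. h w \<partial>N) \<le> 0" unfolding h_def by (rule upper_bound_borel[OF A Ac]) (auto simp: A_def)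
    then have "(\<integral>w. h w \<partial>N) = 0" using integral_nonneg_AE[OF h0] by simp
    then have "AE w in N. h w = 0" using integral_nonneg_eq_0_iff_AE[OF ih h0] by simp
    with pos show ?thesis
      by eventually_elim (auto simp: h_def off_segment_def A_def split: if_splits)
  qed
  then have "AE w in N. \<forall>n. \<not> on_segment P Q (Y1 w) (Y2 w) \<longrightarrow> U w \<in> {-real n..real n} \<longrightarrow> incr_at P (U w) \<longrightarrow> decr_at P (U w)"
    unfolding AE_all_countable by blast
  then show ?thesis
  proof eventually_elim
    case (elim w)
    obtain n :: nat where "\<bar>U w\<bar> \<le> real n" using real_arch_simple by blast
    then show ?case using elim by (auto simp: abs_le_iff minus_le_iff)
  qed
qed

end

text \<open>A minimizer inside a vertical segment would put \<open>y\<close> strictly on both sides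
  of it by \<open>vertical_top\<close> and \<open>vertical_bottom\<close>; upper ends are excluded
  by \<open>no_top\<close> and lower ends by its reflection.\<close>

lemma (in dual_argmin) no_vertical:
  "AE w in N. \<not> on_segment P Q (Y1 w) (Y2 w) \<longrightarrow> incr_at P (U w) \<and> decr_at P (U w)"
proof -
  interpret n: dual_argmin "reflect P" "reflect Q" N "\<lambda>w. - Y1 w" "\<lambda>w. - Y2 w" "\<lambda>w. - U w" by (rule dual_argmin_neg)
  have i: "incr_at (reflect P) (- u) \<longleftrightarrow> decr_at P u" for u by (simp add: incr_at_refl)
  have d: "decr_at (reflect P) (- u) \<longleftrightarrow> incr_at P u" for u
    using incr_at_refl[of "reflect P" u] by (simp add: reflect_def[abs_def])
  from no_top n.no_top well_posed_facts show ?thesis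
  proof eventually_elim
    case (elim w)
    show ?case
    proof
      assume nE: "\<not> on_segment P Q (Y1 w) (Y2 w)"
      have "incr_at P (U w) \<or> decr_at P (U w)"
        using vertical_top[of "Y1 w" "Y2 w" "U w"] vertical_bottom[of "Y1 w" "Y2 w" "U w"] elim(3) nE by fastforce
      then show "incr_at P (U w) \<and> decr_at P (U w)"
        using elim(1,2) nE unfolding on_segment_neg i d by blast
    qed
  qed
qed

text \<open>Up to a null event \<open>A\<close> may be replaced by its part with
  \<open>incr_at\<close>, where the upper bound holds, and by its part with \<open>decr_at\<close>,
  where the lower bound holds.\<close>

lemma (in dual_argmin) martingale_bounded:
  assumes A: "A \<in> sets borel" "A \<subseteq> {-c..c}"
  shows "(\<integral>w. (if off_segment A w then Q (U w) - Y2 w else 0) \<partial>N) = 0"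
proof (rule antisym)
  define I where "I = A \<inter> {u. incr_at P u}"
  define D where "D = A \<inter> {u. decr_at P u}"
  have sI: "I \<in> sets borel" and sD: "D \<in> sets borel" using A(1) incr_at_sets decr_at_sets by (auto simp: I_def D_def)
  have eq: "(\<integral>w. (if off_segment A w then Q (U w) - Y2 w else 0) \<partial>N) = (\<integral>w. (if off_segment C w then Q (U w) - Y2 w else 0) \<partial>N)"
    if "C = I \<or> C = D" for C
  proof (rule integral_cong_AE)
    have [measurable]: "C \<in> sets borel" using that sI sD by blast
    show "(\<lambda>w. if off_segment C w then Q (U w) - Y2 w else 0) \<in> borel_measurable N" by measurable
    show "AE w in N. (if off_segment A w then Q (U w) - Y2 w else 0) = (if off_segment C w then Q (U w) - Y2 w else 0)"
      using no_vertical
    proof eventually_elim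
      case (elim w)
      then have "off_segment C w \<longleftrightarrow> off_segment A w" using that by (auto simp: off_segment_def I_def D_def)
      then show ?case by simp
    qed
  next
    note A(1)[measurable]
    show "(\<lambda>w. if off_segment A w then Q (U w) - Y2 w else 0) \<in> borel_measurable N" by measurable
  qed
  have "(\<integral>w. (if off_segment I w then Q (U w) - Y2 w else 0) \<partial>N) \<le> 0" by (rule upper_bound_borel[OF sI, of c]) (use A(2) in \<open>auto simp: I_def\<close>)
  then show "(\<integral>w. (if off_segment A w then Q (U w) - Y2 w else 0) \<partial>N) \<le> 0" using eq[of I] by simp
  have "0 \<le> (\<integral>w. (if off_segment D w then Q (U w) - Y2 w else 0) \<partial>N)" by (rule lower_bound_borel[OF sD, of c]) (use A(2) in \<open>auto simp: D_def\<close>)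
  then show "0 \<le> (\<integral>w. (if off_segment A w then Q (U w) - Y2 w else 0) \<partial>N)" using eq[of D] by simp
qed

section \<open>Martingale pairs and weak duality\<close>

lemma vimage_subalgebra:
  assumes "prob_space N" "V \<in> measurable N borel"
  shows "finite_measure_subalgebra N (vimage_algebra (space N) V borel)"
proof -
  interpret prob_space N by fact
  show ?thesis
  proof
    show "subalgebra N (vimage_algebra (space N) V borel)"
      unfolding subalgebra_def using assms(2) by (auto simp: sets_vimage_algebra2 measurable_def)
  qed
qed

lemma vimage_measurable:
  assumes "V \<in> measurable N borel" "h \<in> borel_measurable borel"
  shows "(\<lambda>w. h (V w)) \<in> borel_measurable (vimage_algebra (space N) V borel)"
  using assms by (intro measurable_compose[OF measurable_vimage_algebra1]) (auto simp: measurable_def)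

lemma cond_exp_vimage_iff:
  fixes f :: "'a \<Rightarrow> real" and g :: "'b::topological_space \<Rightarrow> real"
  assumes N: "prob_space N" and V[measurable]: "V \<in> measurable N borel" and f: "integrable N f"
    and g[measurable]: "g \<in> borel_measurable borel" and gV: "integrable N (\<lambda>w. g (V w))"
  shows "(AE w in N. real_cond_exp N (vimage_algebra (space N) V borel) f w = g (V w)) \<longleftrightarrow>
    (\<forall>A\<in>sets borel. (\<integral>w. indicator A (V w) * (f w - g (V w)) \<partial>N) = 0)"
proof -
  let ?F = "vimage_algebra (space N) V borel"
  interpret finite_measure_subalgebra N ?F by (rule vimage_subalgebra[OF N V])
  have fm[measurable]: "f \<in> borel_measurable N" using f by (rule borel_measurable_integrable)
  have i: "integrable N (\<lambda>w. indicator A (V w) * k w)" if [measurable]: "A \<in> sets borel" and k: "integrable N k" for A and k :: "'a \<Rightarrow> real"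
  proof (rule Bochner_Integration.integrable_bound[OF k])
    have [measurable]: "k \<in> borel_measurable N" using k by (rule borel_measurable_integrable)
    show "(\<lambda>w. indicator A (V w) * k w) \<in> borel_measurable N" by measurable
    show "AE w in N. norm (indicator A (V w) * k w) \<le> norm (k w)" by (auto simp: indicator_def)
  qed
  have split: "(\<integral>w. indicator A (V w) * (f w - g (V w)) \<partial>N) =
     (\<integral>w. indicator A (V w) * f w \<partial>N) - (\<integral>w. indicator A (V w) * g (V w) \<partial>N)" if "A \<in> sets borel" for A
    using i[OF that f] i[OF that gV] by (simp add: right_diff_distrib)
  show ?thesis
  proof
    assume L: "AE w in N. real_cond_exp N ?F f w = g (V w)"
    show "\<forall>A\<in>sets borel. (\<integral>w. indicator A (V w) * (f w - g (V w)) \<partial>N) = 0"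
    proof
      fix A :: "'b set" assume A[measurable]: "A \<in> sets borel"
      have mA: "(\<lambda>w. indicator A (V w) :: real) \<in> borel_measurable ?F" by (rule vimage_measurable[OF V]) measurable
      have "(\<integral>w. indicator A (V w) * f w \<partial>N) = (\<integral>w. indicator A (V w) * real_cond_exp N ?F f w \<partial>N)"
        by (rule real_cond_exp_intg(2)[OF i[OF A f] mA fm, symmetric])
      also have "\<dots> = (\<integral>w. indicator A (V w) * g (V w) \<partial>N)"
        by (rule integral_cong_AE) (use L in auto)
      finally show "(\<integral>w. indicator A (V w) * (f w - g (V w)) \<partial>N) = 0" using split[OF A] by simp
    qed
  next
    assume R: "\<forall>A\<in>sets borel. (\<integral>w. indicator A (V w) * (f w - g (V w)) \<partial>N) = 0"
    show "AE w in N. real_cond_exp N ?F f w = g (V w)"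
    proof (rule real_cond_exp_charact[OF _ f gV vimage_measurable[OF V g]])
      fix A assume "A \<in> sets ?F"
      then obtain B where B: "B \<in> sets borel" "A = V -` B \<inter> space N"
        using measurable_space[OF V] by (auto simp: sets_vimage_algebra2)
      have e: "(\<integral>w\<in>A. k w \<partial>N) = (\<integral>w. indicator B (V w) * k w \<partial>N)" for k :: "'a \<Rightarrow> real"
        unfolding set_lebesgue_integral_def B(2) by (rule Bochner_Integration.integral_cong) (auto simp: indicator_def)
      show "(\<integral>w\<in>A. f w \<partial>N) = (\<integral>w\<in>A. g (V w) \<partial>N)" unfolding e using R split[OF B(1)] B(1) by simp
    qed
  qed
qed

text \<open>Vanishing against indicators means that the conditional expectation of \<open>f\<close>
  is zero, which can then be tested with any Borel \<open>h\<close> whose product with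
  \<open>f\<close> is integrable.\<close>

lemma integral_orthogonal:
  fixes f :: "'a \<Rightarrow> real" and h :: "'b::topological_space \<Rightarrow> real"
  assumes N: "prob_space N" and V[measurable]: "V \<in> measurable N borel" and f: "integrable N f"
    and o: "\<And>A. A \<in> sets borel \<Longrightarrow> (\<integral>w. indicator A (V w) * f w \<partial>N) = 0"
    and h: "h \<in> borel_measurable borel" and i: "integrable N (\<lambda>w. h (V w) * f w)"
  shows "(\<integral>w. h (V w) * f w \<partial>N) = 0"
proof -
  let ?F = "vimage_algebra (space N) V borel"
  interpret finite_measure_subalgebra N ?F by (rule vimage_subalgebra[OF N V])
  have fm: "f \<in> borel_measurable N" using f by (rule borel_measurable_integrable)
  have z: "AE w in N. real_cond_exp N ?F f w = 0"
    using cond_exp_vimage_iff[OF N V f borel_measurable_const[of 0]] o by (simp only: diff_zero) simp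
  have "(\<integral>w. h (V w) * f w \<partial>N) = (\<integral>w. h (V w) * real_cond_exp N ?F f w \<partial>N)"
    by (rule real_cond_exp_intg(2)[OF i vimage_measurable[OF V h] fm, symmetric])
  also have "\<dots> = (\<integral>w. 0 \<partial>N)"
  proof (rule integral_cong_AE)
    show "(\<lambda>w. h (V w) * real_cond_exp N ?F f w) \<in> borel_measurable N"
      using real_cond_exp_intg(1)[OF i vimage_measurable[OF V h] fm] by (rule borel_measurable_integrable)
    show "AE w in N. h (V w) * real_cond_exp N ?F f w = 0" using z by eventually_elim simp
  qed simp
  finally show ?thesis by simp
qed

lemma integrable_mult_sq:
  fixes a b :: "'a \<Rightarrow> real"
  assumes [measurable]: "a \<in> borel_measurable N" "b \<in> borel_measurable N"
    and "integrable N (\<lambda>w. (a w)\<^sup>2)" "integrable N (\<lambda>w. (b w)\<^sup>2)"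
  shows "integrable N (\<lambda>w. a w * b w)"
proof (rule Bochner_Integration.integrable_bound)
  show "integrable N (\<lambda>w. (a w)\<^sup>2 + (b w)\<^sup>2)" using assms by simp
  have "\<bar>x * y\<bar> \<le> x\<^sup>2 + y\<^sup>2" for x y :: real
  proof -
    have "2 * \<bar>x\<bar> * \<bar>y\<bar> \<le> x\<^sup>2 + y\<^sup>2" using sum_squares_bound[of "\<bar>x\<bar>" "\<bar>y\<bar>"] by simp
    moreover have "0 \<le> \<bar>x\<bar> * \<bar>y\<bar>" by simp
    ultimately show ?thesis unfolding abs_mult by linarith
  qed
  then show "AE w in N. norm (a w * b w) \<le> norm ((a w)\<^sup>2 + (b w)\<^sup>2)" by simp
qed measurable

lemma integrable_sq_add:
  fixes a b :: "'a \<Rightarrow> real"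
  assumes [measurable]: "a \<in> borel_measurable N" "b \<in> borel_measurable N"
    and "integrable N (\<lambda>w. (a w)\<^sup>2)" "integrable N (\<lambda>w. (b w)\<^sup>2)"
  shows "integrable N (\<lambda>w. (a w + b w)\<^sup>2)"
proof -
  have "integrable N (\<lambda>w. (a w)\<^sup>2 + (b w)\<^sup>2 + 2 * (a w * b w))"
    using assms integrable_mult_sq[OF assms] by simp
  then show ?thesis by (simp add: power2_sum mult.assoc)
qed

lemma pt_proj:
  fixes X :: "'a \<Rightarrow> pt"
  assumes "X \<in> borel_measurable N"
  shows "(\<lambda>w. fst (X w)) \<in> borel_measurable N" "(\<lambda>w. snd (X w)) \<in> borel_measurable N"
  using assms by (auto intro!: borel_measurable_continuous_on[OF _ assms] continuous_intros)

lemma L2_iff: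
  fixes X :: "'a \<Rightarrow> pt"
  assumes [measurable]: "X \<in> borel_measurable N"
  shows "integrable N (\<lambda>w. (norm (X w))\<^sup>2) \<longleftrightarrow>
     integrable N (\<lambda>w. (fst (X w))\<^sup>2) \<and> integrable N (\<lambda>w. (snd (X w))\<^sup>2)"
proof -
  have n: "(norm x)\<^sup>2 = (fst x)\<^sup>2 + (snd x)\<^sup>2" for x :: pt by (simp add: norm_prod_def)
  have [measurable]: "(\<lambda>w. fst (X w)) \<in> borel_measurable N" "(\<lambda>w. snd (X w)) \<in> borel_measurable N"
    by (rule pt_proj[OF assms])+
  show ?thesis
  proof
    assume i: "integrable N (\<lambda>w. (norm (X w))\<^sup>2)"
    show "integrable N (\<lambda>w. (fst (X w))\<^sup>2) \<and> integrable N (\<lambda>w. (snd (X w))\<^sup>2)"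
      by (intro conjI; rule Bochner_Integration.integrable_bound[OF i]) (auto simp: n)
  qed (simp add: n)
qed

text \<open>The barycentre condition tested against indicators. In this form it passes to image
  measures (\<open>martingale_distr\<close>), so that maps and plans are treated alike;
  \<open>martingale_iff\<close> links it to conditional expectations.\<close>

definition martingale :: "'a measure \<Rightarrow> ('a \<Rightarrow> pt) \<Rightarrow> ('a \<Rightarrow> pt) \<Rightarrow> bool" where
  "martingale N X Y \<longleftrightarrow> (\<forall>A\<in>sets borel. (\<integral>w. indicator A (X w) * (fst (Y w) - fst (X w)) \<partial>N) = 0 \<and>
     (\<integral>w. indicator A (X w) * (snd (Y w) - snd (X w)) \<partial>N) = 0)"

lemma martingale_iff:
  fixes X Y :: "'a \<Rightarrow> pt"
  assumes N: "prob_space N" and X: "L2 N X" and Y: "L2 N Y"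
  shows "martingale N X Y \<longleftrightarrow>
    (AE w in N. real_cond_exp N (vimage_algebra (space N) X borel) (\<lambda>w. fst (Y w)) w = fst (X w)) \<and>
    (AE w in N. real_cond_exp N (vimage_algebra (space N) X borel) (\<lambda>w. snd (Y w)) w = snd (X w))"
proof -
  interpret prob_space N by fact
  have [measurable]: "X \<in> borel_measurable N" "Y \<in> borel_measurable N" using X Y by (auto simp: L2_def)
  note pt_proj[OF \<open>X \<in> borel_measurable N\<close>, measurable] pt_proj[OF \<open>Y \<in> borel_measurable N\<close>, measurable]
  have i: "integrable N (\<lambda>w. fst (X w))" "integrable N (\<lambda>w. snd (X w))" "integrable N (\<lambda>w. fst (Y w))" "integrable N (\<lambda>w. snd (Y w))"
    using X Y by (auto simp: L2_def L2_iff intro!: square_integrable_imp_integrable)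
  have "fst \<in> borel_measurable (borel :: pt measure)" "snd \<in> borel_measurable (borel :: pt measure)"
    by (auto intro!: borel_measurable_continuous_onI continuous_intros)
  then show ?thesis unfolding martingale_def
    using cond_exp_vimage_iff[OF N \<open>X \<in> borel_measurable N\<close> i(3) _ i(1)] cond_exp_vimage_iff[OF N \<open>X \<in> borel_measurable N\<close> i(4) _ i(2)]
    by auto
qed

context curve begin

text \<open>The test point in \<open>G\<close> is the projection of \<open>X\<close> along the antidiagonal, for which the cost
  is minus a square.\<close>

lemma weak_duality:
  fixes X Y :: "'a \<Rightarrow> pt"
  assumes N: "prob_space N" and X: "L2 N X" and Y: "L2 N Y" and m: "martingale N X Y"
    and d: "AE w in N. phiE P Q (fst (Y w)) (snd (Y w)) > -\<infinity>"
    and ip: "integrable N (\<lambda>w. phiR P Q (fst (Y w)) (snd (Y w)))"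
  shows "(\<integral>w. phiR P Q (fst (Y w)) (snd (Y w)) \<partial>N) \<le> (\<integral>w. cost (X w) (Y w) \<partial>N)"
    and "(\<integral>w. cost (X w) (Y w) \<partial>N) \<le> (\<integral>w. phiR P Q (fst (Y w)) (snd (Y w)) \<partial>N) \<Longrightarrow>
      AE w in N. P (fst (X w) + snd (X w)) = fst (X w) \<and> cost (X w) (Y w) = phiR P Q (fst (Y w)) (snd (Y w))"
proof -
  interpret prob_space N by fact
  have mX[measurable]: "X \<in> borel_measurable N" and mY[measurable]: "Y \<in> borel_measurable N" using X Y by (auto simp: L2_def)
  define X1 X2 Y1 Y2 where "X1 = (\<lambda>w. fst (X w))" and "X2 = (\<lambda>w. snd (X w))" and "Y1 = (\<lambda>w. fst (Y w))" and "Y2 = (\<lambda>w. snd (Y w))"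
  have [measurable]: "X1 \<in> borel_measurable N" "X2 \<in> borel_measurable N" "Y1 \<in> borel_measurable N" "Y2 \<in> borel_measurable N"
    unfolding X1_def X2_def Y1_def Y2_def by (rule pt_proj[OF mX] pt_proj[OF mY])+
  have sq: "integrable N (\<lambda>w. (X1 w)\<^sup>2)" "integrable N (\<lambda>w. (X2 w)\<^sup>2)" "integrable N (\<lambda>w. (Y1 w)\<^sup>2)" "integrable N (\<lambda>w. (Y2 w)\<^sup>2)"
    using X Y by (auto simp: L2_def L2_iff X1_def X2_def Y1_def Y2_def)
  \<comment> \<open>Displacement to the antidiagonal projection, which has coordinates
    \<open>x1 + W\<close> and \<open>x2 - W\<close>; its linear growth makes it square
    integrable.\<close>
  define W where "W x = P (fst x + snd x) - fst x" for x :: pt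
  have [measurable]: "(\<lambda>x::pt. fst x + snd x) \<in> borel_measurable borel" "fst \<in> borel_measurable (borel :: pt measure)"
    by (auto intro!: borel_measurable_continuous_onI continuous_intros)
  have Wm[measurable]: "W \<in> borel_measurable borel" unfolding W_def by measurable
  have [measurable]: "(\<lambda>w. W (X w)) \<in> borel_measurable N" by measurable
  have Wb: "\<bar>W x\<bar> \<le> \<bar>P 0\<bar> + \<bar>fst x\<bar> + \<bar>fst x\<bar> + \<bar>snd x\<bar>" for x
    using P_lip'[of "fst x + snd x" 0] unfolding W_def by linarith
  have sa: "integrable N (\<lambda>w. (\<bar>X1 w\<bar>)\<^sup>2)" "integrable N (\<lambda>w. (\<bar>X2 w\<bar>)\<^sup>2)" using sq by auto
  have sqW: "integrable N (\<lambda>w. (W (X w))\<^sup>2)"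
  proof (rule Bochner_Integration.integrable_bound)
    show "integrable N (\<lambda>w. (\<bar>P 0\<bar> + \<bar>X1 w\<bar> + \<bar>X1 w\<bar> + \<bar>X2 w\<bar>)\<^sup>2)"
      by (intro integrable_sq_add sa) auto
    show "AE w in N. norm ((W (X w))\<^sup>2) \<le> norm ((\<bar>P 0\<bar> + \<bar>X1 w\<bar> + \<bar>X1 w\<bar> + \<bar>X2 w\<bar>)\<^sup>2)"
      using Wb unfolding X1_def X2_def by (intro AE_I2) (simp add: abs_le_square_iff[symmetric])
  qed measurable
  have sqd: "integrable N (\<lambda>w. (Y1 w - X1 w)\<^sup>2)" "integrable N (\<lambda>w. (Y2 w - X2 w)\<^sup>2)"
    using integrable_sq_add[of Y1 N "\<lambda>w. - X1 w"] integrable_sq_add[of Y2 N "\<lambda>w. - X2 w"] sq by simp_all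
  have iW: "integrable N (\<lambda>w. W (X w) * (Y1 w - X1 w))" "integrable N (\<lambda>w. W (X w) * (Y2 w - X2 w))"
    by (intro integrable_mult_sq sqW sqd; measurable)+
  have i1: "integrable N (\<lambda>w. Y1 w - X1 w)" "integrable N (\<lambda>w. Y2 w - X2 w)"
    by (rule square_integrable_imp_integrable[OF _ sqd(1)], measurable) (rule square_integrable_imp_integrable[OF _ sqd(2)], measurable)
  have z: "(\<integral>w. W (X w) * (Y1 w - X1 w) \<partial>N) = 0" "(\<integral>w. W (X w) * (Y2 w - X2 w) \<partial>N) = 0"
  proof -
    show "(\<integral>w. W (X w) * (Y1 w - X1 w) \<partial>N) = 0"
      by (rule integral_orthogonal[OF N mX i1(1) _ Wm iW(1)]) (use m in \<open>simp add: martingale_def X1_def Y1_def\<close>)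
    show "(\<integral>w. W (X w) * (Y2 w - X2 w) \<partial>N) = 0"
      by (rule integral_orthogonal[OF N mX i1(2) _ Wm iW(2)]) (use m in \<open>simp add: martingale_def X2_def Y2_def\<close>)
  qed
  have ic: "integrable N (\<lambda>w. cost (X w) (Y w))"
  proof -
    have "integrable N (\<lambda>w. (Y1 w - X1 w) * (Y2 w - X2 w))" by (intro integrable_mult_sq sqd; measurable)
    then show ?thesis by (simp add: cost_def X1_def X2_def Y1_def Y2_def algebra_simps)
  qed
  \<comment> \<open>Cost at the projection minus \<open>phiR\<close>, expanded around
    \<open>X\<close>. The cross terms integrate to 0 by the martingale property, leaving the duality
    gap as the integral of \<open>R\<close> plus that of the square of \<open>W\<close>.\<close>
  define R where "R w = cost (X w) (Y w) - phiR P Q (Y1 w) (Y2 w) - (W (X w))\<^sup>2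
     + W (X w) * (Y1 w - X1 w) - W (X w) * (Y2 w - X2 w)" for w
  have ip': "integrable N (\<lambda>w. phiR P Q (Y1 w) (Y2 w))" using ip by (simp add: Y1_def Y2_def)
  have iR: "integrable N R" unfolding R_def
    by (intro Bochner_Integration.integrable_diff Bochner_Integration.integrable_add ic ip' sqW iW)
  have R0: "AE w in N. 0 \<le> R w"
    using d
  proof eventually_elim
    case (elim w)
    have q: "Q (X1 w + X2 w) = X2 w - W (X w)" and p: "P (X1 w + X2 w) = X1 w + W (X w)"
      using PQ[of "X1 w + X2 w"] unfolding W_def X1_def X2_def by auto
    have "phiR P Q (Y1 w) (Y2 w) \<le> ccost P Q (Y1 w) (Y2 w) (X1 w + X2 w)"
      using elim by (intro phiR_le) (simp add: Y1_def Y2_def)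
    also have "\<dots> = cost (X w) (Y w) - (W (X w))\<^sup>2 + W (X w) * (Y1 w - X1 w) - W (X w) * (Y2 w - X2 w)"
      unfolding ccost_def p q unfolding cost_def X1_def X2_def Y1_def Y2_def by (simp add: algebra_simps power2_eq_square)
    finally show ?case by (simp add: R_def)
  qed
  have eR: "(\<integral>w. R w \<partial>N) = (\<integral>w. cost (X w) (Y w) \<partial>N) - (\<integral>w. phiR P Q (Y1 w) (Y2 w) \<partial>N) - (\<integral>w. (W (X w))\<^sup>2 \<partial>N)"
    unfolding R_def using ic ip' sqW iW z by simp
  have pos: "0 \<le> (\<integral>w. R w \<partial>N)" "0 \<le> (\<integral>w. (W (X w))\<^sup>2 \<partial>N)" using integral_nonneg_AE[OF R0] by auto
  show "(\<integral>w. phiR P Q (fst (Y w)) (snd (Y w)) \<partial>N) \<le> (\<integral>w. cost (X w) (Y w) \<partial>N)"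
    using eR pos unfolding Y1_def Y2_def by linarith
  assume "(\<integral>w. cost (X w) (Y w) \<partial>N) \<le> (\<integral>w. phiR P Q (fst (Y w)) (snd (Y w)) \<partial>N)"
  then have "(\<integral>w. R w \<partial>N) = 0" "(\<integral>w. (W (X w))\<^sup>2 \<partial>N) = 0" using eR pos unfolding Y1_def Y2_def by linarith+
  then have "AE w in N. R w = 0" "AE w in N. (W (X w))\<^sup>2 = 0"
    using integral_nonneg_eq_0_iff_AE[OF iR R0] integral_nonneg_eq_0_iff_AE[OF sqW] by auto
  then show "AE w in N. P (fst (X w) + snd (X w)) = fst (X w) \<and> cost (X w) (Y w) = phiR P Q (fst (Y w)) (snd (Y w))"
    by eventually_elim (auto simp: R_def W_def Y1_def Y2_def)
qed

text \<open>The first rational in a fixed enumeration that is \<open>1 / (n + 1)\<close>-minimal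
  depends measurably on \<open>y\<close>, and well-posedness makes these rationals converge.\<close>

lemma selection:
  obtains u :: "pt \<Rightarrow> real" where "u \<in> borel_measurable borel" "\<And>y U. well_posed P Q (fst y) (snd y) U \<Longrightarrow> u y = U"
proof -
  define q where "q k = (of_rat (nat_to_rat_surj k) :: real)" for k
  define ok where "ok n y k \<longleftrightarrow> ccost P Q (fst y) (snd y) (q k) < phiR P Q (fst y) (snd y) + 1 / (real n + 1)" for n k and y :: pt
  define s where "s n y = q (LEAST k. ok n y k)" for n and y :: pt
  have fs[measurable]: "fst \<in> borel_measurable (borel :: pt measure)" "snd \<in> borel_measurable (borel :: pt measure)"
    by (auto intro!: borel_measurable_continuous_onI continuous_intros)
  have [measurable]: "(\<lambda>y::pt. phiR P Q (fst y) (snd y)) \<in> borel_measurable borel"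
    by (rule phiR_measurable[OF P_cont Q_cont]) measurable
  have [measurable]: "Measurable.pred borel (\<lambda>y. ok n y k)" for n k
    unfolding ok_def ccost_def by measurable
  have [measurable]: "s n \<in> borel_measurable borel" for n
    unfolding s_def by (rule measurable_compose[where N="count_space UNIV"]) measurable
  show ?thesis
  proof (rule that[of "\<lambda>y. lim (\<lambda>n. s n y)"])
    show "(\<lambda>y. lim (\<lambda>n. s n y)) \<in> borel_measurable borel" by measurable
    fix y U assume well_posed: "well_posed P Q (fst y) (snd y) U"
    then have d: "phiE P Q (fst y) (snd y) > -\<infinity>" by (simp add: well_posed_def)
    have "\<exists>k. ok n y k" for n
    proof -
      have "phiE P Q (fst y) (snd y) < ereal (phiR P Q (fst y) (snd y) + 1 / (real n + 1))"
        unfolding phiE_eq_ph[OF d] by simp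
      then obtain r :: rat where r: "ccost P Q (fst y) (snd y) (of_rat r) < phiR P Q (fst y) (snd y) + 1 / (real n + 1)"
        unfolding phiE_rat[OF P_cont Q_cont] INF_less_iff by auto
      obtain k where "r = nat_to_rat_surj k" using surj_nat_to_rat_surj by (metis surjD)
      then show ?thesis using r unfolding ok_def q_def by auto
    qed
    then have ok: "ok n y (LEAST k. ok n y k)" for n by (meson LeastI_ex)
    have "(\<lambda>n. s n y) \<longlonglongrightarrow> U"
    proof (rule LIMSEQ_I)
      fix \<delta> :: real assume "\<delta> > 0"
      then obtain \<eta> where "\<eta> > 0" and \<eta>: "\<And>u. \<bar>u - U\<bar> \<ge> \<delta> \<Longrightarrow> phiR P Q (fst y) (snd y) + \<eta> \<le> ccost P Q (fst y) (snd y) u"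
        using well_posed unfolding well_posed_def by blast
      have "\<forall>\<^sub>F n in sequentially. 1 / (real n + 1) < \<eta>"
        using LIMSEQ_inverse_real_of_nat order_tendstoD(2)[OF _ \<open>\<eta> > 0\<close>] by (simp add: inverse_eq_divide add.commute)
      then have "\<forall>\<^sub>F n in sequentially. norm (s n y - U) < \<delta>"
      proof eventually_elim
        case (elim n)
        have "ccost P Q (fst y) (snd y) (s n y) < phiR P Q (fst y) (snd y) + 1 / (real n + 1)"
          unfolding s_def by (rule ok[of n, unfolded ok_def[of n y "LEAST k. ok n y k"]])
        then show ?case using elim \<eta>[of "s n y"] by (cases "\<delta> \<le> \<bar>s n y - U\<bar>") auto
      qed
      then show "\<exists>no. \<forall>n\<ge>no. norm (s n y - U) < \<delta>" by (simp add: eventually_sequentially)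
    qed
    then show "lim (\<lambda>n. s n y) = U" by (rule limI)
  qed
qed

end

section \<open>Square integrability of the minimizer and removal of the bounded window\<close>

context dual_argmin begin

text \<open>On the window the martingale property turns the integral of
  \<open>(Q (U w))\<^sup>2\<close> into that of \<open>Q (U w) * Y2 w\<close>, a product of at most
  half the sum of squares. Truncation guarantees that the absorbed term is finite.\<close>

lemma square_integrable_window:
  "integrable N (\<lambda>w. if off_segment {-real n..real n} w then (Q (U w))\<^sup>2 else 0)"
  "(\<integral>w. (if off_segment {-real n..real n} w then (Q (U w))\<^sup>2 else 0) \<partial>N) \<le> (\<integral>w. (Y2 w)\<^sup>2 \<partial>N)"
proof -
  define C where "C = {-real n..real n}"
  have [measurable]: "C \<in> sets borel" by (simp add: C_def)
  define f where "f w = (if off_segment C w then Q (U w) - Y2 w else 0)" for w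
  have if': "integrable N f" unfolding f_def by (rule integrable_off_segment[of C "real n"]) (auto simp: C_def)
  then have [measurable]: "f \<in> borel_measurable N" by (rule borel_measurable_integrable)
  define c where "c = \<bar>Q (- real n)\<bar> + \<bar>Q (real n)\<bar>"
  have cb: "\<bar>Q u\<bar> \<le> c" if "u \<in> C" for u
    using that Q_mono[of "-real n" u] Q_mono[of u "real n"] unfolding C_def c_def by auto
  define h where "h u = indicator C u * Q u" for u
  have hm[measurable]: "h \<in> borel_measurable borel" unfolding h_def by measurable
  have hb: "\<bar>h u\<bar> \<le> c" for u using cb[of u] by (auto simp: h_def indicator_def c_def)
  have ihf: "integrable N (\<lambda>w. h (U w) * f w)"
  proof (rule Bochner_Integration.integrable_bound)
    show "integrable N (\<lambda>w. c * f w)" using if' by simp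
    show "AE w in N. norm (h (U w) * f w) \<le> norm (c * f w)"
      using hb by (intro AE_I2) (simp add: abs_mult mult_right_mono order_trans[OF _ abs_ge_self])
  qed measurable
  have z: "(\<integral>w. h (U w) * f w \<partial>N) = 0"
  proof (rule integral_orthogonal[OF prob_space_axioms U if' _ hm ihf])
    fix A :: "real set" assume A: "A \<in> sets borel"
    have "(\<integral>w. indicator A (U w) * f w \<partial>N) = (\<integral>w. (if off_segment (A \<inter> C) w then Q (U w) - Y2 w else 0) \<partial>N)"
      by (rule Bochner_Integration.integral_cong) (auto simp: f_def off_segment_def indicator_def)
    also have "\<dots> = 0" by (rule martingale_bounded[of _ "real n"]) (use A in \<open>auto simp: C_def\<close>)
    finally show "(\<integral>w. indicator A (U w) * f w \<partial>N) = 0" .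
  qed
  define g where "g w = (if off_segment C w then (Q (U w))\<^sup>2 else 0)" for w
  have ig: "integrable N g"
  proof (rule Bochner_Integration.integrable_bound)
    show "integrable N (\<lambda>_. c\<^sup>2)" by simp
    show "g \<in> borel_measurable N" unfolding g_def by measurable
    show "AE w in N. norm (g w) \<le> norm (c\<^sup>2)"
    proof (intro AE_I2)
      fix w show "norm (g w) \<le> norm (c\<^sup>2)"
        using cb[of "U w"] power_mono[of "\<bar>Q (U w)\<bar>" c 2] by (auto simp: g_def off_segment_def)
    qed
  qed
  then show "integrable N (\<lambda>w. if off_segment {-real n..real n} w then (Q (U w))\<^sup>2 else 0)" unfolding g_def C_def .
  have "(\<integral>w. g w - h (U w) * f w \<partial>N) \<le> (\<integral>w. (g w + (Y2 w)\<^sup>2) / 2 \<partial>N)"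
  proof (rule integral_mono)
    fix w
    have "g w - h (U w) * f w = (if off_segment C w then Q (U w) * Y2 w else 0)"
      by (auto simp: g_def h_def f_def off_segment_def algebra_simps power2_eq_square)
    also have "\<dots> \<le> (g w + (Y2 w)\<^sup>2) / 2"
      using sum_squares_bound[of "Q (U w)" "Y2 w"] by (auto simp: g_def)
    finally show "g w - h (U w) * f w \<le> (g w + (Y2 w)\<^sup>2) / 2" .
  qed (use ig ihf sq2 in auto)
  then have "(\<integral>w. g w \<partial>N) \<le> ((\<integral>w. g w \<partial>N) + (\<integral>w. (Y2 w)\<^sup>2 \<partial>N)) / 2" using z ig ihf sq2 by simp
  then show "(\<integral>w. (if off_segment {-real n..real n} w then (Q (U w))\<^sup>2 else 0) \<partial>N) \<le> (\<integral>w. (Y2 w)\<^sup>2 \<partial>N)"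
    by (simp add: g_def C_def)
qed

lemma abs_arch: obtains n0 :: nat where "\<And>n. n \<ge> n0 \<Longrightarrow> x \<in> {-real n..real n}"
proof -
  obtain n0 :: nat where "\<bar>x\<bar> \<le> real n0" using real_arch_simple by blast
  then have "x \<in> {-real n..real n}" if "n \<ge> n0" for n
    using that by (auto simp: abs_le_iff minus_le_iff intro: order_trans[of _ "real n0"])
  then show ?thesis by (rule that)
qed

lemma square_integrable_off_segment: "integrable N (\<lambda>w. if off_segment UNIV w then (Q (U w))\<^sup>2 else 0)"
proof (rule integrableI_nonneg)
  let ?g = "\<lambda>n w. if off_segment {-real n..real n} w then (Q (U w))\<^sup>2 else 0"
  show "(\<lambda>w. if off_segment UNIV w then (Q (U w))\<^sup>2 else 0) \<in> borel_measurable N" by measurable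
  have "(\<integral>\<^sup>+w. ennreal (if off_segment UNIV w then (Q (U w))\<^sup>2 else 0) \<partial>N) \<le> (\<integral>\<^sup>+w. liminf (\<lambda>n. ennreal (?g n w)) \<partial>N)"
  proof (rule nn_integral_mono)
    fix w
    obtain n0 where "\<And>n. n \<ge> n0 \<Longrightarrow> U w \<in> {-real n..real n}" using abs_arch by blast
    then have "\<forall>\<^sub>F n in sequentially. ennreal (if off_segment UNIV w then (Q (U w))\<^sup>2 else 0) \<le> ennreal (?g n w)"
      unfolding eventually_sequentially off_segment_def by (intro exI[of _ n0]) auto
    then show "ennreal (if off_segment UNIV w then (Q (U w))\<^sup>2 else 0) \<le> liminf (\<lambda>n. ennreal (?g n w))" by (rule Liminf_bounded)
  qed
  also have "\<dots> \<le> liminf (\<lambda>n. \<integral>\<^sup>+w. ennreal (?g n w) \<partial>N)" by (rule nn_integral_liminf) measurable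
  also have "\<dots> \<le> liminf (\<lambda>n::nat. ennreal (\<integral>w. (Y2 w)\<^sup>2 \<partial>N))"
  proof (intro Liminf_mono always_eventually allI)
    fix n
    have "(\<integral>\<^sup>+w. ennreal (?g n w) \<partial>N) = ennreal (\<integral>w. ?g n w \<partial>N)"
      by (rule nn_integral_eq_integral[OF square_integrable_window(1)]) auto
    then show "(\<integral>\<^sup>+w. ennreal (?g n w) \<partial>N) \<le> ennreal (\<integral>w. (Y2 w)\<^sup>2 \<partial>N)"
      using square_integrable_window(2)[of n] by (simp add: ennreal_leI)
  qed
  also have "\<dots> < \<infinity>" by (simp add: Liminf_const)
  finally show "(\<integral>\<^sup>+w. ennreal (if off_segment UNIV w then (Q (U w))\<^sup>2 else 0) \<partial>N) < \<infinity>" .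
qed auto

lemma integrable_off_segment_UNIV: "integrable N (\<lambda>w. if off_segment UNIV w then \<bar>Q (U w)\<bar> else 0)"
proof (rule square_integrable_imp_integrable)
  have "(\<lambda>w. (if off_segment UNIV w then \<bar>Q (U w)\<bar> else 0)\<^sup>2) = (\<lambda>w. if off_segment UNIV w then (Q (U w))\<^sup>2 else 0)" by auto
  then show "integrable N (\<lambda>w. (if off_segment UNIV w then \<bar>Q (U w)\<bar> else 0)\<^sup>2)" using square_integrable_off_segment by simp
qed measurable

text \<open>The uniform bound on the windows makes \<open>Q (U w)\<close> integrable off the
  segments and so provides the dominating function as the window grows.\<close>

lemma martingale_off:
  assumes A[measurable]: "A \<in> sets borel"
  shows "(\<integral>w. (if off_segment A w then Q (U w) - Y2 w else 0) \<partial>N) = 0"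
proof -
  let ?f = "\<lambda>A w. if off_segment A w then Q (U w) - Y2 w else 0"
  define C where "C n = A \<inter> {-real n..real n}" for n
  have [measurable]: "C n \<in> sets borel" for n by (simp add: C_def)
  have "(\<lambda>n. \<integral>w. ?f (C n) w \<partial>N) \<longlonglongrightarrow> (\<integral>w. ?f A w \<partial>N)"
  proof (rule integral_dominated_convergence)
    show "integrable N (\<lambda>w. (if off_segment UNIV w then \<bar>Q (U w)\<bar> else 0) + \<bar>Y2 w\<bar>)" using integrable_off_segment_UNIV intY2 by simp
    show "AE w in N. (\<lambda>n. ?f (C n) w) \<longlonglongrightarrow> ?f A w"
    proof (intro AE_I2)
      fix w
      obtain n0 where "\<And>n. n \<ge> n0 \<Longrightarrow> U w \<in> {-real n..real n}" using abs_arch by blast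
      then have "\<forall>\<^sub>F n in sequentially. ?f (C n) w = ?f A w"
        unfolding eventually_sequentially off_segment_def C_def by (intro exI[of _ n0]) auto
      then show "(\<lambda>n. ?f (C n) w) \<longlonglongrightarrow> ?f A w" by (rule tendsto_eventually)
    qed
    show "AE w in N. norm (?f (C n) w) \<le> (if off_segment UNIV w then \<bar>Q (U w)\<bar> else 0) + \<bar>Y2 w\<bar>" for n
      by (intro AE_I2) (auto simp: off_segment_def)
  qed measurable
  moreover have "(\<integral>w. ?f (C n) w \<partial>N) = 0" for n by (rule martingale_bounded[of _ "real n"]) (auto simp: C_def)
  ultimately show ?thesis using LIMSEQ_unique[OF tendsto_const] by fastforce
qed

end

section \<open>Atoms of the law of the minimizer\<close>

context curve begin

text \<open>Minimality at \<open>v\<close> of both costs is probed slightly above \<open>v\<close>.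
  Weighting the two inequalities with \<open>a'\<close> and \<open>a\<close> cancels the linear
  terms in \<open>d2\<close>; after division by \<open>d1\<close> the error is of order
  \<open>d2\<close>.\<close>

lemma atom_ratio_le:
  assumes v: "incr_at Q v" "incr_at P v"
    and y: "phiE P Q y1 y2 > -\<infinity>" "ccost P Q y1 y2 v = phiR P Q y1 y2" "y1 < P v" "Q v < y2"
    and s: "phiE P Q s1 s2 > -\<infinity>" "ccost P Q s1 s2 v = phiR P Q s1 s2" "P v < s1" "s2 < Q v"
  shows "(y2 - Q v) * (s1 - P v) \<le> (Q v - s2) * (P v - y1)"
proof (rule field_le_epsilon)
  fix e :: real assume "e > 0"
  define a b a' b' where "a = P v - y1" and "b = y2 - Q v" and "a' = s1 - P v" and "b' = Q v - s2"
  have pos: "a > 0" "b > 0" "a' > 0" "b' > 0" using y s by (auto simp: a_def b_def a'_def b'_def)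
  \<comment> \<open>This increment makes the remaining error \<open>d2 * (a + a')\<close> at most
    \<open>e\<close>, as \<open>Q\<close> is 1-Lipschitz.\<close>
  define u where "u = v + e / (a + a')"
  have "u > v" using \<open>e > 0\<close> pos by (simp add: u_def)
  define d1 d2 where "d1 = P u - P v" and "d2 = Q u - Q v"
  have d: "d1 > 0" "d2 > 0" "d2 \<le> e / (a + a')"
    using v \<open>u > v\<close> Q_lip[of v u] by (auto simp: incr_at_def d1_def d2_def u_def)
  have 1: "d1 * b - d2 * a \<le> d1 * d2"
    using phiR_le[OF y(1), of u] y(2) unfolding ccost_def d1_def d2_def a_def b_def by (simp add: algebra_simps)
  have 2: "d2 * a' - d1 * b' \<le> d1 * d2"
    using phiR_le[OF s(1), of u] s(2) unfolding ccost_def d1_def d2_def a'_def b'_def by (simp add: algebra_simps)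
  have "a' * (d1 * b - d2 * a) + a * (d2 * a' - d1 * b') \<le> a' * (d1 * d2) + a * (d1 * d2)"
    using 1 2 pos by (intro add_mono mult_left_mono) auto
  then have "d1 * (b * a' - b' * a) \<le> d1 * (d2 * (a + a'))" by (simp add: algebra_simps)
  then have "b * a' - b' * a \<le> d2 * (a + a')" using d(1) by simp
  also have "\<dots> \<le> e / (a + a') * (a + a')" using d(3) pos by (intro mult_right_mono) auto
  also have "\<dots> = e" using pos by simp
  finally show "(y2 - Q v) * (s1 - P v) \<le> (Q v - s2) * (P v - y1) + e"
    by (simp add: a_def b_def a'_def b'_def)
qed

text \<open>At a point of \<open>G\<close> off the segments the normal cone is at most a line as soon as it meets both the
  north-west and the south-east quadrant.\<close>

lemma atom_ratio:
  assumes v: "incr_at Q v" "incr_at P v" "decr_at Q v" "decr_at P v"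
    and y: "phiE P Q y1 y2 > -\<infinity>" "ccost P Q y1 y2 v = phiR P Q y1 y2" "y1 < P v" "Q v < y2"
    and s: "phiE P Q s1 s2 > -\<infinity>" "ccost P Q s1 s2 v = phiR P Q s1 s2" "P v < s1" "s2 < Q v"
  shows "(y2 - Q v) * (s1 - P v) = (Q v - s2) * (P v - y1)"
proof (rule antisym)
  show "(y2 - Q v) * (s1 - P v) \<le> (Q v - s2) * (P v - y1)" by (rule atom_ratio_le[OF v(1,2) y s])
  interpret n: curve "reflect P" "reflect Q" by (rule neg)
  have r: "reflect P (- v) = - P v" "reflect Q (- v) = - Q v" by (simp_all add: reflect_def)
  have "((- s2) - reflect Q (- v)) * ((- y1) - reflect P (- v)) \<le> (reflect Q (- v) - (- y2)) * (reflect P (- v) - (- s1))"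
    by (rule n.atom_ratio_le) (use v y s in \<open>simp_all add: incr_at_refl phiE_neg phiR_neg ccost_neg r\<close>)
  then show "(Q v - s2) * (P v - y1) \<le> (y2 - Q v) * (s1 - P v)" unfolding r by (simp add: algebra_simps)
qed

end

section \<open>Members of \<open>Dfam\<close> as null sets\<close>

lemma Dfam_point: "{(p, q)} \<in> Dfam"
  unfolding Dfam_def
  by (rule CollectI, rule exI[of _ "\<lambda>_. q"], rule exI[of _ p], rule exI[of _ p], rule exI[of _ 1]) auto

lemma Dfam_line:
  assumes "r > 0" "a \<le> b" shows "(\<lambda>t. (t, c - r * t)) ` {a..b} \<in> Dfam"
  unfolding Dfam_def
proof (rule CollectI, rule exI[of _ "\<lambda>t. c - r * t"], rule exI[of _ a], rule exI[of _ b], rule exI[of _ "max r (1 / r)"],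
    intro conjI ballI impI)
  fix s t :: real assume "s < t"
  have "(t - s) / max r (1 / r) \<le> (t - s) / (1 / r)" using assms \<open>s < t\<close> by (intro divide_left_mono) (auto simp: less_max_iff_disj)
  then show "(t - s) / max r (1 / r) \<le> (c - r * s) - (c - r * t)" using assms by (simp add: algebra_simps)
  have "r * (t - s) \<le> max r (1 / r) * (t - s)" using \<open>s < t\<close> by (intro mult_right_mono) auto
  then show "(c - r * s) - (c - r * t) \<le> max r (1 / r) * (t - s)" by (simp add: algebra_simps)
qed (use assms in \<open>auto simp: less_max_iff_disj\<close>)

lemma Dfam_closed: assumes "D \<in> Dfam" shows "closed D"
proof -
  obtain f a b K where K: "K > 0" and f: "\<And>s t. s \<in> {a..b} \<Longrightarrow> t \<in> {a..b} \<Longrightarrow> s < t \<Longrightarrow> (t - s) / K \<le> f s - f t \<and> f s - f t \<le> K * (t - s)"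
    and D: "D = (\<lambda>t. (t, f t)) ` {a..b}"
    using assms unfolding Dfam_def by blast
  have "K-lipschitz_on {a..b} f"
  proof (rule lipschitz_onI)
    have *: "\<bar>f s - f t\<bar> \<le> K * \<bar>s - t\<bar>" if "s \<in> {a..b}" "t \<in> {a..b}" "s < t" for s t
    proof -
      have "0 \<le> (t - s) / K" using K that by simp
      then show ?thesis using f[OF that] that(3) by (simp add: abs_if)
    qed
    show "dist (f s) (f t) \<le> K * dist s t" if "s \<in> {a..b}" "t \<in> {a..b}" for s t
      using *[OF that] *[OF that(2,1)] by (cases s t rule: linorder_cases) (auto simp: dist_real_def abs_minus_commute)
  qed (use K in simp)
  then have "continuous_on {a..b} (\<lambda>t. (t, f t))" by (intro continuous_intros lipschitz_on_continuous_on)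
  then show ?thesis unfolding D by (intro compact_imp_closed compact_continuous_image) auto
qed

lemma D_regular_AE:
  assumes "D_regular \<mu>" "sets \<mu> = sets borel" "D \<in> Dfam" shows "AE y in \<mu>. y \<notin> D"
proof -
  have "D \<in> sets \<mu>" using Dfam_closed[OF assms(3)] assms(2) by simp
  moreover have "emeasure \<mu> D = 0" using assms unfolding D_regular_def by blast
  ultimately have "D \<in> null_sets \<mu>" by (rule null_setsI[rotated])
  then show ?thesis by (rule AE_not_in)
qed

text \<open>A monotone set never descends to the right, whereas members of \<open>Dfam\<close>
  strictly decrease.\<close>

lemma (in curve) Dfam_inter:
  assumes "D \<in> Dfam" shows "\<exists>x. G \<inter> D \<subseteq> {x}"
proof -
  obtain f a b K where K: "K > 0" and f: "\<And>s t. s \<in> {a..b} \<Longrightarrow> t \<in> {a..b} \<Longrightarrow> s < t \<Longrightarrow> (t - s) / K \<le> f s - f t"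
    and D: "D = (\<lambda>t. (t, f t)) ` {a..b}"
    using assms unfolding Dfam_def by blast
  have dec: False if st: "s \<in> {a..b}" "t \<in> {a..b}" "s < t" and g: "(s, f s) \<in> G" "(t, f t) \<in> G" for s t
  proof -
    obtain u v where uv: "s = P u" "f s = Q u" "t = P v" "f t = Q v" using g by (auto simp: G_def)
    have "u < v" using uv \<open>s < t\<close> P_mono[of v u] by (cases "u < v") auto
    then have "f s \<le> f t" using uv Q_mono[of u v] by simp
    moreover have "0 < (t - s) / K" using K \<open>s < t\<close> by simp
    ultimately show False using f[OF st] by simp
  qed
  have "x = y" if xy: "x \<in> G \<inter> D" "y \<in> G \<inter> D" for x y
  proof -
    obtain s t where st: "s \<in> {a..b}" "t \<in> {a..b}" "x = (s, f s)" "y = (t, f t)" using xy D by auto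
    then show ?thesis using xy dec[of s t] dec[of t s] by (cases s t rule: linorder_cases) auto
  qed
  then show ?thesis by blast
qed

text \<open>Points sent to one curve point lie north-west or south-east of it. The barycentre
  condition forces both sides to occur, and then \<open>atom_ratio\<close> puts them all on one line
  of negative slope, a countable union of members of \<open>Dfam\<close> and so a null
  event.\<close>

lemma (in dual_argmin) no_atom:
  assumes reg: "\<And>D. D \<in> Dfam \<Longrightarrow> AE w in N. (Y1 w, Y2 w) \<notin> D"
  shows "AE w in N. \<not> off_segment {v} w"
proof (rule ccontr)
  assume na: "\<not> ?thesis"
  interpret sw: dual_argmin Q P N Y2 Y1 U by (rule dual_argmin_swap)
  interpret sc: curve Q P by (rule swap)
  define gd where "gd w \<longleftrightarrow> off_segment {v} w \<and> phiE P Q (Y1 w) (Y2 w) > -\<infinity> \<and> ccost P Q (Y1 w) (Y2 w) v = phiR P Q (Y1 w) (Y2 w)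
     \<and> incr_at Q v \<and> incr_at P v \<and> decr_at Q v \<and> decr_at P v \<and> (P v - Y1 w) * (Q v - Y2 w) < 0" for w
  have gd: "AE w in N. off_segment {v} w \<longrightarrow> gd w"
    using well_posed_facts no_vertical sw.no_vertical reg[OF Dfam_point[of "P v" "Q v"]]
  proof eventually_elim
    case (elim w)
    show ?case
    proof
      assume o: "off_segment {v} w"
      then have nE: "\<not> on_segment P Q (Y1 w) (Y2 w)" and Uv: "U w = v" by (auto simp: off_segment_def)
      have f: "phiE P Q (Y1 w) (Y2 w) > -\<infinity>" "ccost P Q (Y1 w) (Y2 w) v = phiR P Q (Y1 w) (Y2 w)" using elim(1) nE Uv by auto
      have "ccost P Q (Y1 w) (Y2 w) v < 0"
      proof (cases "v = Y1 w + Y2 w")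
        case True
        have "P v \<noteq> Y1 w" using elim(4) True PQ[of v] by auto
        then show ?thesis using ccost_at_sum[of "Y1 w" "Y2 w"] unfolding True by simp
      next
        case False then show ?thesis by (rule ccost_neg_off_segment[OF f(1) nE f(2)])
      qed
      then show "gd w" unfolding gd_def using o f elim(2,3) nE Uv by (simp add: on_segment_swap[of Q P] ccost_def)
    qed
  qed
  \<comment> \<open>If all points lay on one side, the integrand would have a sign, yet its integral
    is 0.\<close>
  have pos_null: "AE w in N. \<not> off_segment {v} w" if "AE w in N. off_segment {v} w \<longrightarrow> 0 < Q v - Y2 w" 
  proof -
    define h where "h w = (if off_segment {v} w then Q (U w) - Y2 w else 0)" for w
    have ih: "integrable N h" unfolding h_def by (rule integrable_off_segment[of _ "\<bar>v\<bar>"]) auto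
    have h0: "AE w in N. 0 \<le> h w" using that by eventually_elim (auto simp: h_def off_segment_def)
    have "(\<integral>w. h w \<partial>N) = 0" unfolding h_def by (rule martingale_off) auto
    then have "AE w in N. h w = 0" using integral_nonneg_eq_0_iff_AE[OF ih h0] by simp
    with that show ?thesis by eventually_elim (auto simp: h_def off_segment_def)
  qed
  have neg_null: "AE w in N. \<not> off_segment {v} w" if "AE w in N. off_segment {v} w \<longrightarrow> Q v - Y2 w < 0" 
  proof -
    define h where "h w = - (if off_segment {v} w then Q (U w) - Y2 w else 0)" for w
    have ih: "integrable N h" unfolding h_def by (intro integrable_minus integrable_off_segment[of _ "\<bar>v\<bar>"]) auto
    have h0: "AE w in N. 0 \<le> h w" using that by eventually_elim (auto simp: h_def off_segment_def)
    have "(\<integral>w. h w \<partial>N) = 0" unfolding h_def using martingale_off[of "{v}"] by simp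
    then have "AE w in N. h w = 0" using integral_nonneg_eq_0_iff_AE[OF ih h0] by simp
    with that show ?thesis by eventually_elim (auto simp: h_def off_segment_def)
  qed
  obtain w1 where w1: "gd w1" "Q v < Y2 w1"
  proof (rule ccontr)
    assume "\<not> thesis"
    then have *: "gd w \<Longrightarrow> 0 < Q v - Y2 w" for w using that[of w] unfolding gd_def by (auto simp: mult_less_0_iff)
    have "AE w in N. off_segment {v} w \<longrightarrow> 0 < Q v - Y2 w" using gd by eventually_elim (use * in blast)
    from pos_null[OF this] na show False by simp
  qed
  obtain w2 where w2: "gd w2" "Y2 w2 < Q v"
  proof (rule ccontr)
    assume "\<not> thesis"
    then have *: "gd w \<Longrightarrow> Q v - Y2 w < 0" for w using that[of w] unfolding gd_def by (auto simp: mult_less_0_iff)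
    have "AE w in N. off_segment {v} w \<longrightarrow> Q v - Y2 w < 0" using gd by eventually_elim (use * in blast)
    from neg_null[OF this] na show False by simp
  qed
  have w1': "Y1 w1 < P v" using w1 unfolding gd_def by (auto simp: mult_less_0_iff)
  have w2': "P v < Y1 w2" using w2 unfolding gd_def by (auto simp: mult_less_0_iff)
  have rel: "(Y2 w - Q v) * (Y1 w' - P v) = (Q v - Y2 w') * (P v - Y1 w)"
    if "gd w" "gd w'" "Y1 w < P v" "P v < Y1 w'" for w w'
  proof -
    have "Q v < Y2 w" "Y2 w' < Q v" using that unfolding gd_def by (auto simp: mult_less_0_iff)
    then show ?thesis using atom_ratio[of v "Y1 w" "Y2 w" "Y1 w'" "Y2 w'"] that unfolding gd_def by blast
  qed
  \<comment> \<open>Minus the slope of the line: \<open>w1\<close> fixes the ratio for all points on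
    the right, and \<open>w2\<close> then for all points on the left.\<close>
  define r where "r = (Y2 w1 - Q v) / (P v - Y1 w1)"
  have "r > 0" using w1 w1' by (simp add: r_def)
  have r2: "Q v - Y2 w = r * (Y1 w - P v)" if "gd w" "P v < Y1 w" for w
    using rel[OF w1(1) that(1) w1' that(2)] w1' by (simp add: r_def field_simps)
  have r1: "Y2 w - Q v = r * (P v - Y1 w)" if "gd w" "Y1 w < P v" for w
  proof -
    have "(Y2 w - Q v) * (Y1 w2 - P v) = r * (Y1 w2 - P v) * (P v - Y1 w)"
      using rel[OF that(1) w2(1) that(2) w2'] r2[OF w2(1) w2'] by simp
    then have "(Y1 w2 - P v) * (Y2 w - Q v) = (Y1 w2 - P v) * (r * (P v - Y1 w))" by (simp add: algebra_simps)
    then show ?thesis using w2' by simp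
  qed
  have line: "Y2 w = (Q v + r * P v) - r * Y1 w" if "gd w" for w
  proof -
    have "Y1 w < P v \<or> P v < Y1 w" using that unfolding gd_def by (auto simp: mult_less_0_iff)
    then show ?thesis using r1[OF that] r2[OF that] by (auto simp: algebra_simps)
  qed
  have "AE w in N. \<forall>n::nat. (Y1 w, Y2 w) \<notin> (\<lambda>t. (t, (Q v + r * P v) - r * t)) ` {- real n..real n}"
    unfolding AE_all_countable using reg[OF Dfam_line[OF \<open>r > 0\<close>]] by auto
  with gd have "AE w in N. \<not> off_segment {v} w"
  proof eventually_elim
    case (elim w)
    obtain n0 :: nat where "\<And>n. n \<ge> n0 \<Longrightarrow> Y1 w \<in> {-real n..real n}" using abs_arch by blast
    then have "Y1 w \<in> {-real n0..real n0}" by simp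
    then have "gd w \<Longrightarrow> (Y1 w, Y2 w) \<in> (\<lambda>t. (t, (Q v + r * P v) - r * t)) ` {- real n0..real n0}"
      using line[of w] by (intro image_eqI[of _ _ "Y1 w"]) auto
    then show ?case using elim by blast
  qed
  with na show False by simp
qed

section \<open>From the maximizer in \<open>MM\<close> to the abstract dual problem\<close>

lemma phiR_nonpos_surj:
  assumes "surj (\<lambda>u. P u + Q u)" "phiE P Q y1 y2 > -\<infinity>" shows "phiR P Q y1 y2 \<le> (0::real)"
proof -
  obtain u where "P u + Q u = y1 + y2" using surjD[OF assms(1), of "y1 + y2"] by metis
  then have e: "Q u - y2 = - (P u - y1)" by linarith
  have "ccost P Q y1 y2 u \<le> 0" unfolding ccost_def e mult_minus_right by simp
  then show ?thesis using phiR_le[OF assms(2), of u] by linarith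
qed

lemma nn_integral_phiE:
  assumes s: "surj (\<lambda>u. P u + Q u)" and d: "AE y in \<nu>. phiE P Q (fst y) (snd y) > -\<infinity>"
    and i: "integrable \<nu> (\<lambda>y. phiR P Q (fst y) (snd y))"
  shows "(\<integral>\<^sup>+y. e2ennreal (- phiE P Q (fst y) (snd y)) \<partial>\<nu>) = ennreal (- (\<integral>y. phiR P Q (fst y) (snd y) \<partial>\<nu>))"
    and "(\<integral>y. phiR P Q (fst y) (snd y) \<partial>\<nu>) \<le> 0"
proof -
  have n: "AE y in \<nu>. 0 \<le> - phiR P Q (fst y) (snd y)"
    using d by eventually_elim (use phiR_nonpos_surj[OF s] in auto)
  have "(\<integral>\<^sup>+y. e2ennreal (- phiE P Q (fst y) (snd y)) \<partial>\<nu>) = (\<integral>\<^sup>+y. ennreal (- phiR P Q (fst y) (snd y)) \<partial>\<nu>)"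
  proof (rule nn_integral_cong_AE)
    show "AE y in \<nu>. e2ennreal (- phiE P Q (fst y) (snd y)) = ennreal (- phiR P Q (fst y) (snd y))"
      using d
    proof eventually_elim
      case (elim y) show ?case unfolding phiE_eq_ph[OF elim] by simp
    qed
  qed
  also have "\<dots> = ennreal (\<integral>y. - phiR P Q (fst y) (snd y) \<partial>\<nu>)"
    by (rule nn_integral_eq_integral) (use i n in auto)
  finally show "(\<integral>\<^sup>+y. e2ennreal (- phiE P Q (fst y) (snd y)) \<partial>\<nu>) = ennreal (- (\<integral>y. phiR P Q (fst y) (snd y) \<partial>\<nu>))" by simp
  have "0 \<le> (\<integral>y. - phiR P Q (fst y) (snd y) \<partial>\<nu>)" by (rule integral_nonneg_AE[OF n])
  then show "(\<integral>y. phiR P Q (fst y) (snd y) \<partial>\<nu>) \<le> 0" by simp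
qed

lemma phi_integral_le_iff:
  "phi_integral \<nu> G' \<le> phi_integral \<nu> G \<longleftrightarrow>
     (\<integral>\<^sup>+ y. e2ennreal (- phiG G y) \<partial>\<nu>) \<le> (\<integral>\<^sup>+ y. e2ennreal (- phiG G' y) \<partial>\<nu>)"
  unfolding phi_integral_def by (simp add: less_eq_ennreal.rep_eq)

lemma (in curve) surjPQ: "surj (\<lambda>u. P u + Q u)" unfolding PQ by simp

lemma pt_fst_snd[measurable]: "fst \<in> borel_measurable (borel :: pt measure)" "snd \<in> borel_measurable (borel :: pt measure)"
  by (auto intro!: borel_measurable_continuous_onI continuous_intros)

lemma (in curve) dual_max_of_maximizer:
  assumes N: "prob_space \<nu>" and s[measurable_cong]: "sets \<nu> = sets (borel :: pt measure)"
    and sq: "integrable \<nu> (\<lambda>y. (fst y)\<^sup>2)" "integrable \<nu> (\<lambda>y. (snd y)\<^sup>2)"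
    and reg: "D_regular \<nu>" and mx: "\<forall>G'\<in>MM. phi_integral \<nu> G' \<le> phi_integral \<nu> G"
  shows "dual_max P Q \<nu> fst snd"
proof -
  interpret prob_space \<nu> by fact
  have m[measurable]: "fst \<in> borel_measurable \<nu>" "snd \<in> borel_measurable \<nu>"
    using pt_fst_snd by (simp_all add: measurable_cong_sets[OF s refl])
  have le: "(\<integral>\<^sup>+ y. e2ennreal (- phiE P Q (fst y) (snd y)) \<partial>\<nu>) \<le> (\<integral>\<^sup>+ y. e2ennreal (- phiE P' Q' (fst y) (snd y)) \<partial>\<nu>)"
    if "mono P'" "mono Q'" "surj (\<lambda>u. P' u + Q' u)" for P' Q'
    using mx[rule_format, OF range_maximal[OF that]] unfolding phi_integral_le_iff G_def phiG_range .
  \<comment> \<open>The diagonal as a competitor: its dual function is at least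
    \<open>- ((y1 - y2)\<^sup>2 / 4)\<close>, which is integrable, so the maximal value is finite
    and \<open>phiE\<close> is finite almost everywhere.\<close>
  define I where "I u = u / 2" for u :: real
  have Ib: "- ((y1 - y2)\<^sup>2 / 4) \<le> ccost I I y1 y2 u" for y1 y2 u
  proof -
    have "ccost I I y1 y2 u = (u / 2 - (y1 + y2) / 2)\<^sup>2 - (y1 - y2)\<^sup>2 / 4"
      unfolding ccost_def I_def by (simp add: power2_eq_square field_simps)
    then show ?thesis by simp
  qed
  have "(\<integral>\<^sup>+ y. e2ennreal (- phiE P Q (fst y) (snd y)) \<partial>\<nu>) \<le> (\<integral>\<^sup>+ y. e2ennreal (- phiE I I (fst y) (snd y)) \<partial>\<nu>)"
    by (rule le) (auto simp: I_def mono_def surj_def intro: exI[of _ "_ :: real"])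
  also have "\<dots> \<le> (\<integral>\<^sup>+ y. ennreal ((fst y - snd y)\<^sup>2 / 4) \<partial>\<nu>)"
  proof (rule nn_integral_mono)
    fix y :: pt
    have d: "phiE I I (fst y) (snd y) > -\<infinity>" using Ib by (rule phiE_gt_MInf_I)
    have "- ((fst y - snd y)\<^sup>2 / 4) \<le> phiR I I (fst y) (snd y)" using Ib by (rule phiR_greatest)
    then show "e2ennreal (- phiE I I (fst y) (snd y)) \<le> ennreal ((fst y - snd y)\<^sup>2 / 4)"
      unfolding phiE_eq_ph[OF d] by (simp add: ennreal_leI)
  qed
  also have "\<dots> < \<infinity>"
  proof -
    have "integrable \<nu> (\<lambda>y. (fst y - snd y)\<^sup>2 / 4)"
      using integrable_sq_add[of fst \<nu> "\<lambda>y. - snd y"] sq by simp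
    then show ?thesis using nn_integral_eq_integral[of \<nu> "\<lambda>y. (fst y - snd y)\<^sup>2 / 4"] by simp
  qed
  finally have fin: "(\<integral>\<^sup>+ y. e2ennreal (- phiE P Q (fst y) (snd y)) \<partial>\<nu>) < \<infinity>" .
  have mp: "(\<lambda>y. phiE P Q (fst y) (snd y)) \<in> borel_measurable \<nu>" by (rule phiE_measurable[OF P_cont Q_cont m])
  then have me: "(\<lambda>y. e2ennreal (- phiE P Q (fst y) (snd y))) \<in> borel_measurable \<nu>" by measurable
  have d: "AE y in \<nu>. phiE P Q (fst y) (snd y) > -\<infinity>"
    using nn_integral_noteq_infinite[OF me less_imp_neq[OF fin]]
  proof eventually_elim
    case (elim y)
    show "- \<infinity> < phiE P Q (fst y) (snd y)"
    proof (rule ccontr)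
      assume "\<not> ?thesis"
      then have "phiE P Q (fst y) (snd y) = -\<infinity>" by simp
      then show False using elim by simp
    qed
  qed
  have ip: "integrable \<nu> (\<lambda>y. phiR P Q (fst y) (snd y))"
  proof -
    have "integrable \<nu> (\<lambda>y. - phiR P Q (fst y) (snd y))"
    proof (rule integrableI_nonneg)
      show "(\<lambda>y. - phiR P Q (fst y) (snd y)) \<in> borel_measurable \<nu>"
        using phiR_measurable[OF P_cont Q_cont m] by measurable
      show "AE y in \<nu>. 0 \<le> - phiR P Q (fst y) (snd y)" using d by eventually_elim (use phiR_nonpos in auto)
      have "(\<integral>\<^sup>+y. ennreal (- phiR P Q (fst y) (snd y)) \<partial>\<nu>) = (\<integral>\<^sup>+y. e2ennreal (- phiE P Q (fst y) (snd y)) \<partial>\<nu>)"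
      proof (rule nn_integral_cong_AE)
        show "AE y in \<nu>. ennreal (- phiR P Q (fst y) (snd y)) = e2ennreal (- phiE P Q (fst y) (snd y))"
          using d
        proof eventually_elim
          case (elim y) show ?case unfolding phiE_eq_ph[OF elim] by simp
        qed
      qed
      then show "(\<integral>\<^sup>+y. ennreal (- phiR P Q (fst y) (snd y)) \<partial>\<nu>) < \<infinity>" using fin by simp
    qed
    then show ?thesis by simp
  qed
  show ?thesis
  proof
    show "fst \<in> borel_measurable \<nu>" "snd \<in> borel_measurable \<nu>" by (fact m)+
    show "AE y in \<nu>. \<not> (fst y = p \<and> snd y = q)" for p q
      using D_regular_AE[OF reg s Dfam_point[of p q]] by eventually_elim (auto simp: prod_eq_iff)
    fix P' Q' :: "real \<Rightarrow> real"
    assume a: "mono P'" "mono Q'" "surj (\<lambda>u. P' u + Q' u)" "AE y in \<nu>. phiE P' Q' (fst y) (snd y) > -\<infinity>"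
      "integrable \<nu> (\<lambda>y. phiR P' Q' (fst y) (snd y))"
    have "ennreal (- (\<integral>y. phiR P Q (fst y) (snd y) \<partial>\<nu>)) \<le> ennreal (- (\<integral>y. phiR P' Q' (fst y) (snd y) \<partial>\<nu>))"
      using le[OF a(1-3)] unfolding nn_integral_phiE(1)[OF surjPQ d ip] nn_integral_phiE(1)[OF a(3-5)] .
    then show "(\<integral>y. phiR P' Q' (fst y) (snd y) \<partial>\<nu>) \<le> (\<integral>y. phiR P Q (fst y) (snd y) \<partial>\<nu>)"
      using nn_integral_phiE(2)[OF a(3-5)] by (simp add: ennreal_le_iff)
  qed (use sq d ip in auto)
qed

section \<open>Optimal maps and plans\<close>

lemma martingale_distr:
  assumes [measurable]: "T \<in> measurable N K" and X[measurable]: "X \<in> borel_measurable K" and Y[measurable]: "Y \<in> borel_measurable K"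
  shows "martingale (distr N K T) X Y \<longleftrightarrow> martingale N (\<lambda>w. X (T w)) (\<lambda>w. Y (T w))"
proof -
  note pt_proj[OF X, measurable] pt_proj[OF Y, measurable]
  have "(\<integral>w. indicator A (X w) * (fst (Y w) - fst (X w)) \<partial>distr N K T) =
        (\<integral>w. indicator A (X (T w)) * (fst (Y (T w)) - fst (X (T w))) \<partial>N)"
    "(\<integral>w. indicator A (X w) * (snd (Y w) - snd (X w)) \<partial>distr N K T) =
        (\<integral>w. indicator A (X (T w)) * (snd (Y (T w)) - snd (X (T w))) \<partial>N)" if [measurable]: "A \<in> sets borel" for A
    by (rule integral_distr, measurable)+
  then show ?thesis unfolding martingale_def by simp
qed

lemma L2_distr:
  assumes [measurable]: "T \<in> measurable N K" "X \<in> borel_measurable K"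
  shows "L2 (distr N K T) X \<longleftrightarrow> L2 N (\<lambda>w. X (T w))"
  unfolding L2_def by (simp add: integrable_distr_eq)

lemma maps_X_iff:
  assumes "prob_space M" "L2 M Y"
  shows "X \<in> maps_X M Y \<longleftrightarrow> X \<in> measurable (vimage_algebra (space M) Y borel) borel \<and> L2 M X \<and> martingale M X Y"
  unfolding maps_X_def mem_Collect_eq using martingale_iff[OF assms(1) _ assms(2), of X] by blast

lemma plans_iff:
  "\<gamma> \<in> plans \<nu> \<longleftrightarrow> sets \<gamma> = sets borel \<and> prob_space \<gamma> \<and> L2 \<gamma> fst \<and> L2 \<gamma> snd \<and> distr \<gamma> borel snd = \<nu> \<and> martingale \<gamma> fst snd"
proof -
  have "integrable \<gamma> (\<lambda>p. (norm p)\<^sup>2) \<longleftrightarrow> L2 \<gamma> fst \<and> L2 \<gamma> snd" if s: "sets \<gamma> = sets (borel :: (pt \<times> pt) measure)"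
  proof -
    have m[measurable]: "fst \<in> borel_measurable \<gamma>" "snd \<in> borel_measurable \<gamma>"
      by (auto simp: measurable_cong_sets[OF s refl] intro!: borel_measurable_continuous_onI continuous_intros)
    have n: "(norm p)\<^sup>2 = (norm (fst p))\<^sup>2 + (norm (snd p))\<^sup>2" for p :: "pt \<times> pt" by (simp add: norm_prod_def)
    show ?thesis
    proof
      assume i: "integrable \<gamma> (\<lambda>p. (norm p)\<^sup>2)"
      have "integrable \<gamma> (\<lambda>p. (norm (fst p))\<^sup>2)" "integrable \<gamma> (\<lambda>p. (norm (snd p))\<^sup>2)"
        by (rule Bochner_Integration.integrable_bound[OF i], measurable, simp add: n)+
      then show "L2 \<gamma> fst \<and> L2 \<gamma> snd" unfolding L2_def using m by simp
    next
      assume "L2 \<gamma> fst \<and> L2 \<gamma> snd"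
      then show "integrable \<gamma> (\<lambda>p. (norm p)\<^sup>2)" unfolding L2_def n by simp
    qed
  qed
  then show ?thesis unfolding plans_def mem_Collect_eq using martingale_iff[of \<gamma> fst snd] by blast
qed

locale optimal_G = dual_argmin P Q \<nu> fst snd u for P Q and \<nu> :: "pt measure" and u +
  assumes sets_nu[measurable_cong]: "sets \<nu> = sets borel" and ub[measurable]: "u \<in> borel_measurable borel"
    and reg: "D_regular \<nu>"
begin

definition E :: "pt set" where "E = {y. on_segment P Q (fst y) (snd y)}"

text \<open>The optimal map as a function of \<open>y\<close>. The selection \<open>u\<close> makes
  it Borel on the whole plane; its agreement with \<open>Dc_phi\<close> off \<open>E\<close> is
  obtained almost surely.\<close>

definition F :: "pt \<Rightarrow> pt" where "F y = (if y \<in> E then y else (P (u y), Q (u y)))"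

lemma E_sets[measurable]: "E \<in> sets borel"
proof -
  have "Measurable.pred borel (\<lambda>y::pt. on_segment P Q (fst y) (snd y))" by measurable
  then show ?thesis by (simp add: E_def pred_def)
qed

lemma F_measurable[measurable]: "F \<in> borel_measurable borel"
proof -
  have "(\<lambda>y. (P (u y), Q (u y))) \<in> borel_measurable borel" by (intro borel_measurable_Pair) measurable
  then show ?thesis unfolding F_def using E_sets by (intro measurable_If_set) auto
qed

lemma F_measurable_nu[measurable]: "F \<in> borel_measurable \<nu>"
  using F_measurable by (simp add: measurable_cong_sets[OF sets_nu refl])

lemma off_segment_iff: "off_segment A y \<longleftrightarrow> y \<notin> E \<and> u y \<in> A"
  by (simp add: off_segment_def E_def)

lemma F_L2: "L2 \<nu> F"
proof -
  interpret sw: dual_argmin Q P \<nu> snd fst u by (rule dual_argmin_swap)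
  have o: "sw.off_segment UNIV y \<longleftrightarrow> y \<notin> E" "off_segment UNIV y \<longleftrightarrow> y \<notin> E" for y
    unfolding sw.off_segment_def off_segment_def E_def by (simp_all add: on_segment_swap[of Q P])
  have [measurable]: "(\<lambda>y. fst (F y)) \<in> borel_measurable \<nu>" "(\<lambda>y. snd (F y)) \<in> borel_measurable \<nu>"
    by (rule pt_proj[OF F_measurable_nu])+
  have "integrable \<nu> (\<lambda>y. (fst (F y))\<^sup>2)"
  proof (rule Bochner_Integration.integrable_bound)
    show "integrable \<nu> (\<lambda>y. (fst y)\<^sup>2 + (if sw.off_segment UNIV y then (P (u y))\<^sup>2 else 0))" using sw.square_integrable_off_segment sq1 by simp
  qed (measurable, simp add: F_def o)
  moreover have "integrable \<nu> (\<lambda>y. (snd (F y))\<^sup>2)"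
  proof (rule Bochner_Integration.integrable_bound)
    show "integrable \<nu> (\<lambda>y. (snd y)\<^sup>2 + (if off_segment UNIV y then (Q (u y))\<^sup>2 else 0))" using square_integrable_off_segment sq2 by simp
  qed (measurable, simp add: F_def o)
  ultimately show ?thesis unfolding L2_def by (simp add: L2_iff)
qed

lemma F_mart: "martingale \<nu> F (\<lambda>y. y)"
  unfolding martingale_def
proof (intro ballI conjI)
  interpret sw: dual_argmin Q P \<nu> snd fst u by (rule dual_argmin_swap)
  fix A :: "pt set" assume A[measurable]: "A \<in> sets borel"
  \<comment> \<open>On \<open>E\<close> the displacement \<open>y - F y\<close> is zero; off
    \<open>E\<close> the event \<open>F y \<in> A\<close> becomes one about the parameter
    \<open>u y\<close>.\<close>
  define B where "B = {v. (P v, Q v) \<in> A}"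
  have "(\<lambda>v. (P v, Q v)) \<in> borel_measurable borel" by (intro borel_measurable_Pair) measurable
  then have B: "B \<in> sets borel" using measurable_sets[of "\<lambda>v. (P v, Q v)" borel borel A] A by (simp add: B_def vimage_def)
  have "(\<integral>y. indicator A (F y) * (snd y - snd (F y)) \<partial>\<nu>) = (\<integral>y. - (if off_segment B y then Q (u y) - snd y else 0) \<partial>\<nu>)"
    by (rule Bochner_Integration.integral_cong) (auto simp: off_segment_iff F_def B_def indicator_def)
  then show "(\<integral>y. indicator A (F y) * (snd y - snd (F y)) \<partial>\<nu>) = 0" using martingale_off[OF B] by simp
  have o: "sw.off_segment B y \<longleftrightarrow> off_segment B y" for y unfolding sw.off_segment_def off_segment_def by (simp add: on_segment_swap[of Q P])
  have "(\<integral>y. indicator A (F y) * (fst y - fst (F y)) \<partial>\<nu>) = (\<integral>y. - (if sw.off_segment B y then P (u y) - fst y else 0) \<partial>\<nu>)"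
    unfolding o by (rule Bochner_Integration.integral_cong) (auto simp: off_segment_iff F_def B_def indicator_def)
  then show "(\<integral>y. indicator A (F y) * (fst y - fst (F y)) \<partial>\<nu>) = 0" using sw.martingale_off[OF B] by simp
qed

lemma F_cost: "AE y in \<nu>. cost (F y) y = phiR P Q (fst y) (snd y)"
  using well_posed_facts
proof eventually_elim
  case (elim y)
  show ?case
  proof (cases "y \<in> E")
    case True
    then show ?thesis using on_segment_ph[of "fst y" "snd y"] by (simp add: F_def cost_def E_def)
  next
    case False
    then show ?thesis using elim by (simp add: F_def cost_def E_def ccost_def)
  qed
qed

lemma cost_measurable[measurable]: "(\<lambda>p. cost (fst p) (snd p)) \<in> borel_measurable borel"
  unfolding cost_def by (intro borel_measurable_continuous_onI continuous_intros)

lemma F_value: "(\<integral>y. cost (F y) y \<partial>\<nu>) = (\<integral>y. phiR P Q (fst y) (snd y) \<partial>\<nu>)"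
proof (rule integral_cong_AE)
  have "(\<lambda>y. (F y, y)) \<in> borel_measurable \<nu>" by (intro borel_measurable_Pair) measurable
  from measurable_compose[OF this cost_measurable] show "(\<lambda>y. cost (F y) y) \<in> borel_measurable \<nu>" by simp
qed (use intph F_cost in auto)

text \<open>\<open>F\<close> takes values in the curve, which meets \<open>D\<close> in at most one
  point \<open>x\<close>. On \<open>E\<close> the event \<open>F y = x\<close> means
  \<open>y = x\<close>; off \<open>E\<close> it is an atom of the parameter, excluded by
  \<open>no_atom\<close>.\<close>

lemma F_reg: "D_regular (distr \<nu> borel F)"
  unfolding D_regular_def
proof
  fix D assume D: "D \<in> Dfam"
  obtain x where x: "G \<inter> D \<subseteq> {x}" using Dfam_inter[OF D] by blast
  have r: "AE y in \<nu>. (fst y, snd y) \<notin> D'" if "D' \<in> Dfam" for D'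
    using D_regular_AE[OF reg sets_nu that] by simp
  have na: "AE y in \<nu>. \<not> off_segment {fst x + snd x} y" by (rule no_atom) (rule r)
  have "AE y in \<nu>. F y \<notin> D"
    using na D_regular_AE[OF reg sets_nu Dfam_point[of "fst x" "snd x"]]
  proof eventually_elim
    case (elim y)
    have "F y \<in> G"
    proof (cases "y \<in> E")
      case True then show ?thesis unfolding mem_G_iff by (simp add: F_def E_def on_segment_def)
    next
      case False then show ?thesis by (simp add: F_def G_def)
    qed
    show ?case
    proof
      assume "F y \<in> D"
      then have Fx: "F y = x" using x \<open>F y \<in> G\<close> by blast
      show False
      proof (cases "y \<in> E")
        case True then show ?thesis using Fx elim(2) by (simp add: F_def)
      next
        case False
        then have "fst x + snd x = u y" using Fx PQ[of "u y"] by (auto simp: F_def)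
        then show ?thesis using False elim(1) by (simp add: off_segment_iff)
      qed
    qed
  qed
  moreover have "D \<in> sets borel" using Dfam_closed[OF D] by simp
  ultimately show "emeasure (distr \<nu> borel F) D = 0"
    by (subst emeasure_distr) (auto simp: AE_iff_measurable[OF _ refl] vimage_def Int_def conj_commute)
qed

text \<open>Stated for any space carrying a pair whose second component has law
  \<open>\<nu>\<close>, to cover maps and plans at once. In the equality case \<open>X\<close> is a
  curve point minimizing the cost at \<open>Y\<close>, so uniqueness of the minimizer identifies it
  with \<open>F (Y w)\<close>.\<close>

lemma duality:
  assumes N: "prob_space N" and X: "L2 N X" and Y: "L2 N Y" and m: "martingale N X Y" and d: "distr N borel Y = \<nu>"
  shows "(\<integral>y. phiR P Q (fst y) (snd y) \<partial>\<nu>) \<le> (\<integral>w. cost (X w) (Y w) \<partial>N)"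
    and "(\<integral>w. cost (X w) (Y w) \<partial>N) \<le> (\<integral>y. phiR P Q (fst y) (snd y) \<partial>\<nu>) \<Longrightarrow>
      AE w in N. Y w \<notin> E \<longrightarrow> X w = F (Y w)"
proof -
  have Ym: "Y \<in> borel_measurable N" using Y by (simp add: L2_def)
  have pm: "(\<lambda>y::pt. phiR P Q (fst y) (snd y)) \<in> borel_measurable borel" by (rule phiR_measurable[OF P_cont Q_cont]) measurable
  have AEd: "AE w in N. R (Y w)" if "AE y in \<nu>. R y" for R
    using AE_distrD[OF Ym] that unfolding d[symmetric] by blast
  have ip: "integrable N (\<lambda>w. phiR P Q (fst (Y w)) (snd (Y w)))"
    using intph unfolding d[symmetric] by (simp add: integrable_distr_eq[OF Ym pm])
  have e: "(\<integral>y. phiR P Q (fst y) (snd y) \<partial>\<nu>) = (\<integral>w. phiR P Q (fst (Y w)) (snd (Y w)) \<partial>N)"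
    unfolding d[symmetric] by (rule integral_distr[OF Ym pm])
  note wd = weak_duality[OF N X Y m AEd[OF dom] ip]
  show "(\<integral>y. phiR P Q (fst y) (snd y) \<partial>\<nu>) \<le> (\<integral>w. cost (X w) (Y w) \<partial>N)" using wd(1) unfolding e .
  assume "(\<integral>w. cost (X w) (Y w) \<partial>N) \<le> (\<integral>y. phiR P Q (fst y) (snd y) \<partial>\<nu>)"
  from wd(2)[OF this[unfolded e]] AEd[OF WPU] show "AE w in N. Y w \<notin> E \<longrightarrow> X w = F (Y w)"
  proof eventually_elim
    case (elim w)
    show ?case
    proof
      assume nE: "Y w \<notin> E"
      define v where "v = fst (X w) + snd (X w)"
      have v: "P v = fst (X w)" "Q v = snd (X w)" using elim(1) PQ[of v] by (auto simp: v_def)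
      have "ccost P Q (fst (Y w)) (snd (Y w)) v = phiR P Q (fst (Y w)) (snd (Y w))"
        using elim(1) unfolding ccost_def v cost_def by simp
      then have "v = u (Y w)" using well_posed_unique elim(2) nE unfolding E_def by blast
      then show "X w = F (Y w)" using nE v by (simp add: F_def prod_eq_iff)
    qed
  qed
qed

text \<open>Off \<open>E\<close> the plan sits on the graph of \<open>F\<close>, so its restriction
  is expressed through \<open>\<nu>\<close> and \<open>F\<close> alone; this is how any two optimal
  plans agree there.\<close>

lemma density_off:
  assumes s[measurable_cong]: "sets \<gamma> = sets (borel :: (pt \<times> pt) measure)" and d: "distr \<gamma> borel snd = \<nu>"
    and ae: "AE p in \<gamma>. snd p \<notin> E \<longrightarrow> fst p = F (snd p)" and A[measurable]: "A \<in> sets borel"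
  shows "emeasure (density \<gamma> (\<lambda>p. indicator {p. snd p \<notin> E} p)) A =
    (\<integral>\<^sup>+y. indicator (- E) y * indicator A (F y, y) \<partial>\<nu>)"
proof -
  have fs[measurable]: "fst \<in> borel_measurable (borel :: (pt \<times> pt) measure)" "snd \<in> borel_measurable (borel :: (pt \<times> pt) measure)"
    by (auto intro!: borel_measurable_continuous_onI continuous_intros)
  have snd: "snd \<in> measurable \<gamma> borel" using fs(2) by (simp add: measurable_cong_sets[OF s refl])
  have [measurable]: "{p :: pt \<times> pt. snd p \<notin> E} \<in> sets borel"
    using measurable_sets[OF fs(2), of "- E"] E_sets by (simp add: vimage_def Compl_eq)
  have [measurable]: "(\<lambda>y. (F y, y)) \<in> borel_measurable borel" by (intro borel_measurable_Pair) measurable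
  have "emeasure (density \<gamma> (\<lambda>p. indicator {p. snd p \<notin> E} p)) A =
      (\<integral>\<^sup>+p. indicator {p. snd p \<notin> E} p * indicator A p \<partial>\<gamma>)"
    by (rule emeasure_density) (use A in \<open>auto simp: s \<open>{p. snd p \<notin> E} \<in> sets borel\<close>\<close>)
  also have "\<dots> = (\<integral>\<^sup>+p. indicator (- E) (snd p) * indicator A (F (snd p), snd p) \<partial>\<gamma>)"
  proof (rule nn_integral_cong_AE)
    show "AE p in \<gamma>. indicator {p. snd p \<notin> E} p * indicator A p = (indicator (- E) (snd p) * indicator A (F (snd p), snd p) :: ennreal)"
      using ae
    proof eventually_elim
      case (elim p)
      show ?case
      proof (cases "snd p \<in> E")
        case False
        then have "(F (snd p), snd p) = p" using elim by (simp add: prod_eq_iff)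
        then show ?thesis using False by simp
      qed simp
    qed
  qed
  also have "\<dots> = (\<integral>\<^sup>+y. indicator (- E) y * indicator A (F y, y) \<partial>\<nu>)"
    unfolding d[symmetric] by (rule nn_integral_distr[OF snd, symmetric]) measurable
  finally show ?thesis .
qed

lemma conclusion:
  fixes M :: "'b measure" and Y :: "'b \<Rightarrow> pt"
  assumes M: "prob_space M" and Y: "L2 M Y" and d: "distr M borel Y = \<nu>"
  defines "X \<equiv> \<lambda>w. F (Y w)"
  shows "optimal_map M Y X"
    and "optimal_plan \<nu> (distr M borel (\<lambda>w. (X w, Y w)))"
    and "D_regular (distr M borel X)"
    and "\<And>\<gamma>. optimal_plan \<nu> \<gamma> \<Longrightarrow>
      density (distr M borel (\<lambda>w. (X w, Y w))) (\<lambda>p. indicator {p. snd p \<notin> E} p) = density \<gamma> (\<lambda>p. indicator {p. snd p \<notin> E} p)"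
    and "\<And>X'. optimal_map M Y X' \<Longrightarrow> AE w in M. Y w \<notin> E \<longrightarrow> X w = X' w"
proof -
  have Ym[measurable]: "Y \<in> borel_measurable M" using Y by (simp add: L2_def)
  have Xm[measurable]: "X \<in> borel_measurable M" unfolding X_def by measurable
  have idm: "(\<lambda>y::pt. y) \<in> borel_measurable borel" by simp
  have XL: "L2 M X" using F_L2 unfolding d[symmetric] X_def by (simp add: L2_distr[OF Ym F_measurable])
  have Xmart: "martingale M X Y" using F_mart unfolding d[symmetric] X_def by (simp add: martingale_distr[OF Ym F_measurable idm])
  have Xvalue: "(\<integral>w. cost (X w) (Y w) \<partial>M) = (\<integral>y. phiR P Q (fst y) (snd y) \<partial>\<nu>)"
  proof -
    have "(\<lambda>y. (F y, y)) \<in> borel_measurable borel" by (intro borel_measurable_Pair) measurable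
    from measurable_compose[OF this cost_measurable] have cm: "(\<lambda>y. cost (F y) y) \<in> borel_measurable borel" by simp
    show ?thesis unfolding F_value[symmetric] unfolding d[symmetric] X_def by (rule integral_distr[OF Ym cm, symmetric])
  qed
  have Xmap: "X \<in> maps_X M Y"
    unfolding maps_X_iff[OF M Y]
  proof (intro conjI XL Xmart)
    show "X \<in> measurable (vimage_algebra (space M) Y borel) borel" unfolding X_def
      using Ym by (intro measurable_compose[OF measurable_vimage_algebra1 F_measurable]) (auto simp: measurable_def)
  qed
  show om: "optimal_map M Y X"
    unfolding optimal_map_def Xvalue using Xmap duality(1)[OF M _ Y _ d] by (auto simp: maps_X_iff[OF M Y])
  have pm[measurable]: "(\<lambda>w. (X w, Y w)) \<in> borel_measurable M" by (intro borel_measurable_Pair) measurable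
  have fs[measurable]: "fst \<in> borel_measurable (borel :: (pt \<times> pt) measure)" "snd \<in> borel_measurable (borel :: (pt \<times> pt) measure)"
    by (auto intro!: borel_measurable_continuous_onI continuous_intros)
  define \<gamma> where "\<gamma> = distr M borel (\<lambda>w. (X w, Y w))"
  have gp: "\<gamma> \<in> plans \<nu>"
    unfolding plans_iff
  proof (intro conjI)
    show "sets \<gamma> = sets borel" by (simp add: \<gamma>_def)
    show "prob_space \<gamma>" unfolding \<gamma>_def by (rule prob_space.prob_space_distr[OF M pm])
    show "L2 \<gamma> fst" "L2 \<gamma> snd" unfolding \<gamma>_def using XL Y by (simp_all add: L2_distr[OF pm fs(1)] L2_distr[OF pm fs(2)])
    show "martingale \<gamma> fst snd" unfolding \<gamma>_def using Xmart by (simp add: martingale_distr[OF pm fs])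
    show "distr \<gamma> borel snd = \<nu>" unfolding \<gamma>_def d[symmetric] by (subst distr_distr[OF fs(2) pm]) (simp add: comp_def)
  qed
  have gv: "(\<integral>p. cost (fst p) (snd p) \<partial>\<gamma>) = (\<integral>y. phiR P Q (fst y) (snd y) \<partial>\<nu>)"
    unfolding \<gamma>_def Xvalue[symmetric] by (subst integral_distr[OF pm cost_measurable]) simp
  have go: "optimal_plan \<nu> \<gamma>"
    unfolding optimal_plan_def gv using gp duality(1) by (auto simp: plans_iff)
  then show "optimal_plan \<nu> (distr M borel (\<lambda>w. (X w, Y w)))" by (simp add: \<gamma>_def)
  show "D_regular (distr M borel X)"
  proof -
    have "distr \<nu> borel F = distr M borel X" unfolding d[symmetric] X_def
      by (subst distr_distr[OF F_measurable Ym]) (simp add: comp_def)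
    then show ?thesis using F_reg by simp
  qed
  have dens: "emeasure (density \<gamma>' (\<lambda>p. indicator {p. snd p \<notin> E} p)) A = (\<integral>\<^sup>+y. indicator (- E) y * indicator A (F y, y) \<partial>\<nu>)"
    if o: "optimal_plan \<nu> \<gamma>'" and A: "A \<in> sets borel" for \<gamma>' A
  proof -
    have p: "sets \<gamma>' = sets borel" "prob_space \<gamma>'" "L2 \<gamma>' fst" "L2 \<gamma>' snd" "distr \<gamma>' borel snd = \<nu>" "martingale \<gamma>' fst snd"
      using o unfolding optimal_plan_def plans_iff by auto
    \<comment> \<open>The plan of \<open>X\<close> attains the dual value, so an optimal plan cannot
      exceed it and the equality case applies.\<close>
    have "(\<integral>p. cost (fst p) (snd p) \<partial>\<gamma>') \<le> (\<integral>y. phiR P Q (fst y) (snd y) \<partial>\<nu>)"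
      using o gp unfolding optimal_plan_def gv[symmetric] by blast
    from duality(2)[OF p(2-4) p(6) p(5) this] have "AE p in \<gamma>'. snd p \<notin> E \<longrightarrow> fst p = F (snd p)" .
    from density_off[OF p(1) p(5) this A] show ?thesis .
  qed
  show "density (distr M borel (\<lambda>w. (X w, Y w))) (\<lambda>p. indicator {p. snd p \<notin> E} p) = density \<gamma>' (\<lambda>p. indicator {p. snd p \<notin> E} p)"
    if o: "optimal_plan \<nu> \<gamma>'" for \<gamma>'
  proof (rule measure_eqI)
    show "sets (density (distr M borel (\<lambda>w. (X w, Y w))) (\<lambda>p. indicator {p. snd p \<notin> E} p)) = sets (density \<gamma>' (\<lambda>p. indicator {p. snd p \<notin> E} p))"
      using o unfolding optimal_plan_def plans_iff by simp
    fix A assume "A \<in> sets (density (distr M borel (\<lambda>w. (X w, Y w))) (\<lambda>p. indicator {p. snd p \<notin> E} p))"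
    then have "A \<in> sets borel" by simp
    then show "emeasure (density (distr M borel (\<lambda>w. (X w, Y w))) (\<lambda>p. indicator {p. snd p \<notin> E} p)) A =
       emeasure (density \<gamma>' (\<lambda>p. indicator {p. snd p \<notin> E} p)) A"
      using dens[OF go] dens[OF o] by (simp add: \<gamma>_def)
  qed
  show "AE w in M. Y w \<notin> E \<longrightarrow> X w = X' w" if o: "optimal_map M Y X'" for X'
  proof -
    have "L2 M X'" "martingale M X' Y" using o unfolding optimal_map_def maps_X_iff[OF M Y] by auto
    moreover have "(\<integral>w. cost (X' w) (Y w) \<partial>M) \<le> (\<integral>y. phiR P Q (fst y) (snd y) \<partial>\<nu>)"
      using o Xmap unfolding optimal_map_def Xvalue[symmetric] by blast
    ultimately have "AE w in M. Y w \<notin> E \<longrightarrow> X' w = F (Y w)" using duality(2)[OF M _ Y _ d] by blast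
    then show ?thesis by eventually_elim (simp add: X_def)
  qed
qed

end

theorem theorem4:
  fixes M :: "'a measure" and Y :: "'a \<Rightarrow> pt" and G :: "pt set"
  assumes "prob_space M"
    and "L2 M Y"
    and "D_regular (distr M borel Y)"
    and "G \<in> MM"
    and "\<forall>G'\<in>MM. phi_integral (distr M borel Y) G' \<le> phi_integral (distr M borel Y) G"
  shows "(AE \<omega> in M. Y \<omega> \<in> E_G G \<or> Y \<omega> \<in> dom_grad G) \<and>
    (let X = (\<lambda>\<omega>. if Y \<omega> \<in> E_G G then Y \<omega> else Dc_phi G (Y \<omega>)) in
      (\<exists>X'. (AE \<omega> in M. X' \<omega> = X \<omega>) \<and> optimal_map M Y X' \<and>
         optimal_plan (distr M borel Y) (distr M borel (\<lambda>\<omega>. (X' \<omega>, Y \<omega>))) \<and>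
         D_regular (distr M borel X') \<and>
         (\<forall>\<gamma>t. optimal_plan (distr M borel Y) \<gamma>t \<longrightarrow>
            density (distr M borel (\<lambda>\<omega>. (X' \<omega>, Y \<omega>))) (\<lambda>p. indicator {p. snd p \<notin> E_G G} p)
            = density \<gamma>t (\<lambda>p. indicator {p. snd p \<notin> E_G G} p))) \<and>
      (\<forall>Xt. optimal_map M Y Xt \<longrightarrow> (AE \<omega> in M. Y \<omega> \<notin> E_G G \<longrightarrow> X \<omega> = Xt \<omega>)))"
proof -
  define \<nu> where "\<nu> = distr M borel Y"
  have Ym[measurable]: "Y \<in> borel_measurable M" using assms(2) by (simp add: L2_def)
  have s: "sets \<nu> = sets borel" by (simp add: \<nu>_def)
  have pn: "prob_space \<nu>" unfolding \<nu>_def by (rule prob_space.prob_space_distr[OF assms(1) Ym])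
  have sq: "integrable \<nu> (\<lambda>y. (fst y)\<^sup>2)" "integrable \<nu> (\<lambda>y. (snd y)\<^sup>2)"
    using assms(2) unfolding \<nu>_def L2_def by (simp_all add: integrable_distr_eq L2_iff)
  obtain P Q where "curve P Q" and Gr: "G = range (\<lambda>u. (P u, Q u))"
    using maximal_curve assms(4) unfolding MM_def by blast
  interpret c: curve P Q by fact
  have G: "c.G = G" by (simp add: c.G_def Gr)
  interpret o: dual_max P Q \<nu> fst snd
    by (rule c.dual_max_of_maximizer[OF pn s sq]) (use assms(3,5) in \<open>simp_all add: \<nu>_def G\<close>)
  obtain u where u: "u \<in> borel_measurable borel" "\<And>y U. well_posed P Q (fst y) (snd y) U \<Longrightarrow> u y = U"
    using c.selection by blast
  obtain D where D: "\<And>i n. D i n \<in> Dfam" "{y. multi_argmin P Q y} \<subseteq> (\<Union>i. \<Union>n. D (i :: rat \<times> rat \<times> nat) (n::nat))"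
    using c.multi_argmin_cover by blast
  have "AE y in \<nu>. \<forall>i n. y \<notin> D i n"
    unfolding AE_all_countable using D_regular_AE[OF _ s D(1)] assms(3) by (simp add: \<nu>_def)
  then have nm: "AE y in \<nu>. \<not> multi_argmin P Q y" by eventually_elim (use D(2) in blast)
  \<comment> \<open>Absence of escape gives a minimizer, D-regularity makes it unique, and both
    together give well-posedness.\<close>
  have well_posed: "AE y in \<nu>. \<not> on_segment P Q (fst y) (snd y) \<longrightarrow> well_posed P Q (fst y) (snd y) (u y)"
    using o.no_escape_up o.no_escape_dn o.dom nm
  proof eventually_elim
    case (elim y)
    show ?case
    proof
      assume n: "\<not> on_segment P Q (fst y) (snd y)"
      obtain U where U: "ccost P Q (fst y) (snd y) U = phiR P Q (fst y) (snd y)"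
        using c.no_escape_attained elim n by blast
      have "well_posed P Q (fst y) (snd y) U"
      proof (rule c.well_posed_I[OF _ _ _ U])
        fix v assume "ccost P Q (fst y) (snd y) v = phiR P Q (fst y) (snd y)"
        then show "v = U" using elim(3,4) n U unfolding multi_argmin_def by (metis linorder_neqE)
      qed (use elim n in auto)
      then show "well_posed P Q (fst y) (snd y) (u y)" using u(2) by metis
    qed
  qed
  interpret g: optimal_G P Q \<nu> u
  proof
    show "u \<in> borel_measurable \<nu>" using u(1) by (simp add: measurable_cong_sets[OF s refl])
    show "D_regular \<nu>" using assms(3) by (simp add: \<nu>_def)
  qed (use well_posed s u(1) in auto)
  have E: "E_G G = g.E" using c.E_G_curve unfolding G g.E_def .
  have WPM: "AE w in M. Y w \<notin> g.E \<longrightarrow> well_posed P Q (fst (Y w)) (snd (Y w)) (u (Y w))"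
    using AE_distrD[OF Ym well_posed[unfolded \<nu>_def]] by (simp add: g.E_def)
  have gr: "AE w in M. Y w \<notin> g.E \<longrightarrow> Y w \<in> dom_grad G \<and> Dc_phi G (Y w) = g.F (Y w)"
    using WPM
  proof eventually_elim
    case (elim w)
    then show ?case using c.well_posed_Dc[of "Y w" "u (Y w)"] by (auto simp: G g.E_def g.F_def)
  qed
  note con = g.conclusion[OF assms(1,2) \<nu>_def[symmetric]]
  have X: "AE w in M. g.F (Y w) = (if Y w \<in> g.E then Y w else Dc_phi G (Y w))"
    using gr by eventually_elim (auto simp: g.F_def)
  show ?thesis unfolding Let_def E \<nu>_def[symmetric]
  \<comment> \<open>The version of \<open>X\<close> is \<open>F\<close> composed with
    \<open>Y\<close>: a Borel function of \<open>Y\<close> everywhere, while \<open>Dc_phi G\<close>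
    is identified only almost surely.\<close>
  proof (intro conjI exI[of _ "\<lambda>w. g.F (Y w)"] allI impI)
    show "AE w in M. Y w \<in> g.E \<or> Y w \<in> dom_grad G" using gr by eventually_elim auto
    show "AE w in M. Y w \<notin> g.E \<longrightarrow> (if Y w \<in> g.E then Y w else Dc_phi G (Y w)) = Xt w"
      if "optimal_map M Y Xt" for Xt
      using con(5)[OF that] X by eventually_elim auto
  qed (use con(1-4) X in auto)
qed

end
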